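(* Let $\alpha,\sigma>0$ be the mean and variance constants of the logarithm of the Stern sequence and let $\mu$ be the Minkowski measure on $[0,1]$ (see context). (i) Let $m_k:=\int_0^1x^k\,d\mu(x)$. Then $\displaystyle \alpha=\log2-\sum_{k=1}^\infty\frac{m_k}{k2^k}$. (ii) We have $\displaystyle\alpha=\int_0^1\log(1+x)\,d\mu(x)$; therefore the $\mu$-almost-sure Lipschitz exponent $\beta$ of $x\mapsto\Psi(x)$ is related to $\alpha$ by $\beta=\dfrac{\log2}{2\alpha}$. (iii) Consider the system $([0,1],\mathcal F,\mu)$ given by the Farey map $\mathcal F(x)=\min\{\frac x{1-x},\frac{1-x}x\}$. Then $\displaystyle2\alpha=\int_0^1\log|\mathcal F'(x)|\,d\mu(x)$. (iv) The constant $\alpha$ is the maximal Lyapunov exponent $\lambda_1$ of the measure $\eta=\frac12\delta_{A_0}+\frac12\delta_{A_1}$ on $GL_2(\mathbb R)$, where $A_0=\begin{pmatrix}1&1\\0&1\end{pmatrix}$ and $A_1=\begin{pmatrix}1&0\\1&1\end{pmatrix}$. An $\eta$-stationary measure $\xi$ on $\mathbb P(\mathbb R^2)=\mathbb R\cup\{\infty\}$ (that is, $\eta*\xi=\xi$) is given by $$\xi=\tfrac12\mu+\tfrac12T^*\mu,\qquad T(x)=1/x,$$ where $\mu$ is extended trivially to a measure on $\mathbb R\cup\{\infty\}$ with support in $[0,1]$. (v) The variance $\sigma^2$ can be expressed as $$\sigma^2=\frac12\int_0^1\Bigl(\log x+\alpha\lfloor\tfrac1x\rfloor+\int_0^1\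log\Bigl(\frac{1+y\{\frac1x\}}{1+yx}\Bigr)d\mu(y)\Bigr)^2d\mu(x).$$
   Context: Stern sequence: $s(0)=0$, $s(1)=1$, $s(2n)=s(n)$, $s(2n+1)=s(n)+s(n+1)$ for $n\ge1$. Let $\mathbf S_N=s(n)$ with $n$ uniformly random in $\mathbb Z\cap[2^N,2^{N+1})$. The constants $\alpha,\sigma>0$ are those for which $\mathbb E[\log\mathbf S_N]=\alpha N+O(1)$ and $\operatorname{Var}[\log\mathbf S_N]=\sigma^2N+O(1)$ as $N\to\infty$ (such constants exist and are unique). The Minkowski question-mark function $\Psi={?}:[0,1]\to[0,1]$ is the strictly increasing continuous bijection given at irrational $x=[0;a_1,a_2,\dots]$ (regular continued fraction) by $\Psi(x)=2\sum_{n\ge1}(-1)^{n+1}2^{-(a_1+\dots+a_n)}$, and extended by continuity. The Minkowski measure is $d\mu=d\Psi$, i.e. the probability measure with $\mu([0,x])=\Psi(x)$. The $\mu$-almost-sure Lipschitz exponent of $\Psi$ is the number $\beta$ such that for $\mu$-almost every $x$, $\lim_{h\to0^+}\frac{\log(\Psi(x+h)-\Psi(x-h))}{\log h}=\beta$. $\lfloor\cdot\rfloor$ and $\{\cdot\}$ denote integer and fractional parts. $\delta_A$ is the Dirac mass at $A$. The maximal Lyapunov exponent of $\eta$ is $\lambda_1=\lim_{N\to\infty}\frac1N\mathbb E\log\|g_N\cdots g_1\|$ with $g_j$ i.i.d. of law $\eta$. The group $GL_2(\mathbb R)$ acts on $\mathbb P(\mathbb R^2)=\mathbb R\cup\{\infty\}$,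 with $x$ identified to the line spanned by $(x,1)^t$, by homographies; $\eta*\xi$ is the image of $\eta\otimes\xi$ under $(g,v)\mapsto gv$, and $T^*\mu$ is the image of $\mu$ under $T$. *)

theory Defs
  imports "HOL-Probability.Probability" "HOL-Library.Landau_Symbols"
begin

function stern :: "nat \<Rightarrow> nat" where
  "stern n = (if n \<le> 1 then n
              else if even n then stern (n div 2)
              else stern (n div 2) + stern (n div 2 + 1))"
  by pat_completeness auto
termination
  by (relation "Wellfounded.measure id") (auto; presburger)+

declare stern.simps [simp del]

lemma stern_rec:
  "stern 0 = 0" "stern 1 = 1"
  "n \<ge> 1 \<Longrightarrow> stern (2 * n) = stern n"
  "n \<ge> 1 \<Longrightarrow> stern (2 * n + 1) = stern n + stern (n + 1)"
  by (subst stern.simps; simp)+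

definition stern_index :: "nat \<Rightarrow> nat pmf" where
  "stern_index N = pmf_of_set {2 ^ N ..< 2 ^ (N + 1)}"

definition log_stern_mean :: "nat \<Rightarrow> real" where
  "log_stern_mean N = measure_pmf.expectation (stern_index N) (\<lambda>n. ln (real (stern n)))"

definition log_stern_var :: "nat \<Rightarrow> real" where
  "log_stern_var N = measure_pmf.variance (stern_index N) (\<lambda>n. ln (real (stern n)))"

text \<open>The regular continued fraction digits of an irrational \<open>x\<close> in \<open>[0,1]\<close>, counted from 0:
  \<open>x = [0; cf_digit x 0, cf_digit x 1, \<dots>]\<close>.\<close>

definition gauss_map :: "real \<Rightarrow> real" where
  "gauss_map x = frac (1 / x)"

definition cf_digit :: "real \<Rightarrow> nat \<Rightarrow> nat" where
  "cf_digit x n = nat \<lfloor>1 / (gauss_map ^^ n) x\<rfloor>"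

definition question_mark_series :: "real \<Rightarrow> real" where
  "question_mark_series x = 2 * (\<Sum>n. (-1) ^ n / 2 ^ (\<Sum>i\<le>n. cf_digit x i))"

text \<open>Outside \<open>[0,1]\<close> the function is continued by the constants 0 and 1, which makes it the
  distribution function of the Minkowski measure, regarded as a measure on the real line.\<close>

definition question_mark :: "real \<Rightarrow> real" where
  "question_mark x =
     (if x < 0 then 0
      else if x > 1 then 1
      else if x \<in> \<rat> then Lim (at x within {0..1} - \<rat>) question_mark_series
      else question_mark_series x)"

definition minkowski_measure :: "real measure" where
  "minkowski_measure = interval_measure question_mark"

definition minkowski_moment :: "nat \<Rightarrow> real" where
  "minkowski_moment k = (LINT x:{0..1}|minkowski_measure. x ^ k)"

definition ae_Lipschitz_exponent :: "real measure \<Rightarrow> (real \<Rightarrow> real) \<Rightarrow> real \<Rightarrow> bool" where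
  "ae_Lipschitz_exponent M F b \<longleftrightarrow>
     (AE x in M. ((\<lambda>h. ln (F (x + h) - F (x - h)) / ln h) \<longlongrightarrow> b) (at_right 0))"

text \<open>With \<open>1 / 0 = 0\<close> the formula also gives the intended values \<open>farey 0 = 0\<close> and
  \<open>farey 1 = 0\<close>.\<close>

definition farey :: "real \<Rightarrow> real" where
  "farey x = min (x / (1 - x)) ((1 - x) / x)"

text \<open>The measure \<open>\<onehalf> M + \<onehalf> N\<close>, for \<open>M\<close> and \<open>N\<close> on the same \<open>\<sigma>\<close>-algebra.\<close>

definition half_sum :: "'a measure \<Rightarrow> 'a measure \<Rightarrow> 'a measure" where
  "half_sum M N =
     measure_of (space M) (sets M) (\<lambda>A. emeasure M A / 2 + emeasure N A / 2)"

lemma sets_half_sum [simp, measurable_cong]: "sets (half_sum M N) = sets M"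
  by (simp add: half_sum_def)

lemma emeasure_half_sum:
  assumes "sets M = sets N" "A \<in> sets M"
  shows "emeasure (half_sum M N) A = emeasure M A / 2 + emeasure N A / 2"
  unfolding half_sum_def
proof (rule emeasure_measure_of_sigma[OF _ _ _ assms(2)])
  show "countably_additive (sets M) (\<lambda>A. emeasure M A / 2 + emeasure N A / 2)"
  proof (rule countably_additiveI)
    fix A :: "nat \<Rightarrow> 'a set"
    assume A: "range A \<subseteq> sets M" "disjoint_family A"
    with assms(1) have "range A \<subseteq> sets N" by simp
    with A show "(\<Sum>i. emeasure M (A i) / 2 + emeasure N (A i) / 2) =
        emeasure M (\<Union>i. A i) / 2 + emeasure N (\<Union>i. A i) / 2"
      by (simp add: divide_ennreal_def suminf_emeasure flip: suminf_add)
  qed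
qed (auto simp: positive_def sets.sigma_algebra_axioms)

definition GL2 :: "(real^2^2) measure" where
  "GL2 = restrict_space borel {A. invertible A}"

primrec left_prod :: "(nat \<Rightarrow> real^2^2) \<Rightarrow> nat \<Rightarrow> real^2^2" where
  "left_prod g 0 = mat 1"
| "left_prod g (Suc n) = g (Suc n) ** left_prod g n"

text \<open>The product measure on \<open>{1..N}\<close> is the joint law of i.i.d. \<open>g\<^sub>1, \<dots>, g\<^sub>N\<close> of law \<open>\<eta>\<close>.\<close>

definition is_max_Lyapunov_exponent :: "(real^2^2) measure \<Rightarrow> real \<Rightarrow> bool" where
  "is_max_Lyapunov_exponent \<eta> l \<longleftrightarrow>
     (\<lambda>N. (LINT g|(\<Pi>\<^sub>M j\<in>{1..N}. \<eta>). ln (onorm ((*v) (left_prod g N)))) / real N)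
       \<longlonglongrightarrow> l"

text \<open>The projective line \<open>\<real> \<union> {\<infinity>}\<close> is represented by the type \<open>real option\<close>, where \<open>None\<close> is
  \<open>\<infinity>\<close> and \<open>Some x\<close> is the line spanned by \<open>(x, 1)\<close>.\<close>

definition proj_line :: "real option \<Rightarrow> (real^2) set" where
  "proj_line p = (case p of None \<Rightarrow> span {vector [1, 0]} | Some x \<Rightarrow> span {vector [x, 1]})"

definition homography :: "real^2^2 \<Rightarrow> real option \<Rightarrow> real option" where
  "homography g p =
     (case p of
        None \<Rightarrow> if g $ 2 $ 1 = 0 then None else Some (g $ 1 $ 1 / g $ 2 $ 1)
      | Some x \<Rightarrow> if g $ 2 $ 1 * x + g $ 2 $ 2 = 0 then None
                 else Some ((g $ 1 $ 1 * x + g $ 1 $ 2) / (g $ 2 $ 1 * x + g $ 2 $ 2)))"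

lemma proj_line_homography:
  assumes "invertible g"
  shows "proj_line (homography g p) = (*v) g ` proj_line p"
proof -
  have scale: "span {v} = span {w}" if "v = c *\<^sub>R w" "c \<noteq> 0" for v w :: "real^2" and c
    using span_image_scale[of "{w}" "\<lambda>_. c"] that by simp
  have img: "(*v) g ` span {v} = span {g *v v}" for v :: "real^2"
    using linear_span_image[OF matrix_vector_mul_linear, of g "{v}"] by simp
  have nz: "g *v v \<noteq> 0" if "v \<noteq> 0" for v
    using assms that by (metis invertible_def matrix_left_invertible_ker)
  show ?thesis
  proof (cases p)
    case None
    have e: "g *v vector [1, 0] = vector [g $ 1 $ 1, g $ 2 $ 1]"
      by (simp add: vec_eq_iff forall_2 matrix_vector_mult_def sum_2)
    have "g *v vector [1, 0] \<noteq> 0"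
      by (rule nz) (simp add: vec_eq_iff forall_2)
    then have ne: "g $ 2 $ 1 = 0 \<Longrightarrow> g $ 1 $ 1 \<noteq> 0"
      unfolding e by (auto simp: vec_eq_iff forall_2)
    show ?thesis
    proof (cases "g $ 2 $ 1 = 0")
      case True
      then have "span {vector [g $ 1 $ 1, g $ 2 $ 1]} = span {vector [1, 0] :: real^2}"
        by (intro scale[of _ "g $ 1 $ 1"] ne) (simp_all add: vec_eq_iff forall_2)
      with True None show ?thesis by (simp add: proj_line_def homography_def img e)
    next
      case False
      then have "span {vector [g $ 1 $ 1, g $ 2 $ 1]} =
          span {vector [g $ 1 $ 1 / g $ 2 $ 1, 1] :: real^2}"
        by (intro scale[of _ "g $ 2 $ 1"]) (simp_all add: vec_eq_iff forall_2)
      with False None show ?thesis by (simp add: proj_line_def homography_def img e)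
    qed
  next
    case (Some x)
    define a b where "a = g $ 1 $ 1 * x + g $ 1 $ 2" and "b = g $ 2 $ 1 * x + g $ 2 $ 2"
    have e: "g *v vector [x, 1] = vector [a, b]"
      by (simp add: vec_eq_iff forall_2 matrix_vector_mult_def sum_2 a_def b_def)
    have "g *v vector [x, 1] \<noteq> 0"
      by (rule nz) (simp add: vec_eq_iff forall_2)
    then have ne: "b = 0 \<Longrightarrow> a \<noteq> 0"
      unfolding e by (auto simp: vec_eq_iff forall_2)
    show ?thesis
    proof (cases "b = 0")
      case True
      then have "span {vector [a, b]} = span {vector [1, 0] :: real^2}"
        by (intro scale[of _ a] ne) (simp_all add: vec_eq_iff forall_2)
      with True Some show ?thesis
        by (simp add: proj_line_def homography_def img e flip: a_def b_def)
    next
      case False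
      then have "span {vector [a, b]} = span {vector [a / b, 1] :: real^2}"
        by (intro scale[of _ b]) (simp_all add: vec_eq_iff forall_2)
      with False Some show ?thesis
        by (simp add: proj_line_def homography_def img e flip: a_def b_def)
    qed
  qed
qed

definition proj_borel :: "real option measure" where
  "proj_borel = sigma UNIV {U. openin (Alexandroff_compactification euclideanreal) U}"

definition is_stationary :: "(real^2^2) measure \<Rightarrow> real option measure \<Rightarrow> bool" where
  "is_stationary \<eta> \<xi> \<longleftrightarrow>
     prob_space \<xi> \<and> sets \<xi> = sets proj_borel \<and>
     distr (\<eta> \<Otimes>\<^sub>M \<xi>) proj_borel (\<lambda>(g, v). homography g v) = \<xi>"

definition proj_inverse :: "real option \<Rightarrow> real option" where
  "proj_inverse p =
     (case p of None \<Rightarrow> Some 0 | Some x \<Rightarrow> if x = 0 then None else Some (1 / x))"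

definition A0 :: "real^2^2" where "A0 = vector [vector [1, 1], vector [0, 1]]"

definition A1 :: "real^2^2" where "A1 = vector [vector [1, 0], vector [1, 1]]"

definition eta :: "(real^2^2) measure" where
  "eta = half_sum (return GL2 A0) (return GL2 A1)"

definition minkowski_proj :: "real option measure" where
  "minkowski_proj = distr minkowski_measure proj_borel Some"

definition xi :: "real option measure" where
  "xi = half_sum minkowski_proj (distr minkowski_proj proj_borel proj_inverse)"

end

theory Submission
  imports Defs
begin

text \<open>
  The Minkowski measure \<open>\<mu>\<close> is self-similar: it is the average of its images under
  \<open>x \<mapsto> x / (1 + x)\<close> and \<open>x \<mapsto> 1 / (1 + x)\<close>. Each step down the Stern tree replaces a pair \<open>(a, b)\<close> by
  \<open>(a, a + b)\<close> or \<open>(a + b, b)\<close>. Put \<open>K(a, b) = \<onehalf> \<integral> ln (a + b y) + ln (a y + b) d\<mu>(y)\<close>.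
  Self-similarity says that \<open>K\<close> takes the values \<open>K(a, b) + \<alpha> \<plusminus> \<delta>(a, b)\<close> at the two children of
  \<open>(a, b)\<close>, where \<open>\<alpha> = \<integral> ln (1 + x) d\<mu>(x)\<close> and \<open>\<delta>\<close> is bounded and homogeneous of degree 0. So \<open>K\<close> minus
  its drift is a martingale with bounded increments, at bounded \<open>L\<^sup>2\<close> distance from \<open>ln s\<close>. This gives
  the mean constant \<open>\<alpha>\<close>, and, since the ratios \<open>min(a, b) / max(a, b)\<close> equidistribute with
  respect to \<open>\<mu>\<close>, the variance constant \<open>\<integral> \<delta>(1, x)\<^sup>2 d\<mu>(x)\<close>.

  Pairs of denominators of Farey cylinders evolve in the same way, so the fourth moment of the
  martingale and a Borel-Cantelli argument give their almost sure growth rate \<open>\<alpha>\<close>. Cylinders of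
  level \<open>n\<close> have measure \<open>1 / 2 ^ n\<close> and length \<open>exp (- 2 \<alpha> n + o(n))\<close>, whence the Lipschitz exponent.
\<close>

section \<open>The question-mark function\<close>

text \<open>\<open>question_mark\<close> is a digit series at irrationals and a limit at rationals,
  so neither monotonicity nor continuity is at hand; both come from recognising it as the fixed
  point of the functional equation behind self-similarity. The potential \<open>K\<close> is not
  guessed: it integrates \<open>ln\<close> of a linear form against the stationary measure
  \<open>xi\<close>, the points \<open>y\<close> and \<open>1 / y\<close> being represented by the
  vectors \<open>(y, 1)\<close> and \<open>(1, y)\<close>. What fails is uniformity.
  \<open>ln a\<close> is not within bounded distance of \<open>K(a, b)\<close> when
  \<open>b / a\<close> is large, and the Farey branches have derivative of modulus 1 at 0. The first
  obstacle is met by averaging: the mean of \<open>a / b + b / a\<close> is at most 3 on every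
  level, and all logarithmic singularities are dominated by the integrable
  \<open>1 / y\<^sup>2\<close>. The second is met by the harmonic rate \<open>1 / (n + 1)\<close>.
  The mean is thus known up to O(1) and the variance up to O(sqrt N), which is enough, because the
  assumed expansions fix \<alpha> and \<open>\<sigma>\<^sup>2\<close> on division by
  \<open>N\<close>. Fourth moments are used because second moments of order \<open>n\<close>,
  divided by \<open>n\<^sup>2\<close>, are not summable.\<close>

definition farey_lift :: "(real \<Rightarrow> real) \<Rightarrow> real \<Rightarrow> real" where
  "farey_lift G x = (if x \<le> 1/2 then G (x / (1 - x)) / 2 else 1 - G ((1 - x) / x) / 2)"

lemma farey_branch_in_unit:
  fixes x :: real
  shows "0 \<le> x \<Longrightarrow> x \<le> 1/2 \<Longrightarrow> x / (1 - x) \<in> {0..1}"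
    and "1/2 \<le> x \<Longrightarrow> x \<le> 1 \<Longrightarrow> (1 - x) / x \<in> {0..1}"
  by (auto simp: divide_simps)

text \<open>The factor 1/2 in both branches makes \<open>farey_lift\<close> a contraction for the
  sup distance on \<open>{0..1}\<close>.\<close>

lemma farey_lift_diff:
  assumes "\<And>x. x \<in> {0..1} \<Longrightarrow> \<bar>G x - H x\<bar> \<le> e" and "x \<in> {0..1}"
  shows "\<bar>farey_lift G x - farey_lift H x\<bar> \<le> e / 2"
proof -
  have half: "\<bar>a / 2 - b / 2\<bar> \<le> e / 2" "\<bar>(1 - a / 2) - (1 - b / 2)\<bar> \<le> e / 2"
    if "\<bar>a - b\<bar> \<le> e" for a b :: real
    using that by linarith+
  show ?thesis
  proof (cases "x \<le> 1/2")
    case True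
    then have "\<bar>G (x / (1 - x)) - H (x / (1 - x))\<bar> \<le> e"
      using assms farey_branch_in_unit(1)[of x] by auto
    then show ?thesis using True unfolding farey_lift_def by (simp only: if_True half)
  next
    case False
    then have "\<bar>G ((1 - x) / x) - H ((1 - x) / x)\<bar> \<le> e"
      using assms farey_branch_in_unit(2)[of x] by auto
    then show ?thesis using False unfolding farey_lift_def by (simp only: if_False half)
  qed
qed

lemma farey_lift_endpoints:
  assumes "G 0 = 0" "G 1 = 1"
  shows "farey_lift G 0 = 0" "farey_lift G 1 = 1"
  using assms by (auto simp: farey_lift_def)

lemma continuous_on_farey_lift:
  assumes "continuous_on {0..1} G" "G 1 = 1"
  shows "continuous_on {0..1} (farey_lift G)"
proof -
  have *: "{0..1} = {0..1/2} \<union> {1/2..1::real}" by auto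
  have "continuous_on ({0..1/2} \<union> {1/2..1})
     (\<lambda>x. if x \<le> 1/2 then G (x / (1 - x)) / 2 else 1 - G ((1 - x) / x) / 2)"
  proof (rule continuous_on_If)
    show "continuous_on {0..1/2} (\<lambda>x. G (x / (1 - x)) / 2)"
      using farey_branch_in_unit(1)
      by (intro continuous_intros continuous_on_compose2[OF assms(1)]) auto
    show "continuous_on {1/2..1} (\<lambda>x. 1 - G ((1 - x) / x) / 2)"
      using farey_branch_in_unit(2)
      by (intro continuous_intros continuous_on_compose2[OF assms(1)]) auto
  next
    \<comment> \<open>The branches meet only at 1/2, where both give 1/2 because
      \<open>G 1 = 1\<close>.\<close>
    fix x :: real assume "x \<in> {1/2..1}" "x \<le> 1/2"
    then have x: "x = 1/2" by auto
    show "G (x / (1 - x)) / 2 = 1 - G ((1 - x) / x) / 2" unfolding x using assms(2) by simp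
  qed auto
  then show ?thesis unfolding * farey_lift_def[abs_def] .
qed

lemma mono_on_farey_lift:
  assumes "mono_on {0..1} G" "G 0 = 0" "G 1 = 1"
  shows "mono_on {0..1} (farey_lift G)"
proof (rule mono_onI)
  fix x y :: real assume xy: "x \<in> {0..1}" "y \<in> {0..1}" "x \<le> y"
  have le1: "G z \<le> 1" if "z \<in> {0..1}" for z
    using mono_onD[OF assms(1), of z 1] that assms(3) by auto
  consider "y \<le> 1/2" | "x \<le> 1/2" "y > 1/2" | "x > 1/2" by linarith
  then show "farey_lift G x \<le> farey_lift G y"
  proof cases
    case 1
    have "x / (1 - x) \<le> y / (1 - y)" using xy 1 by (intro frac_le) auto
    then have "G (x / (1 - x)) \<le> G (y / (1 - y))"
      using xy 1 by (intro mono_onD[OF assms(1)] farey_branch_in_unit(1)) auto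
    then show ?thesis using 1 xy by (auto simp: farey_lift_def)
  next
    case 2
    then show ?thesis
      using xy le1[of "x/(1-x)"] le1[of "(1-y)/y"] farey_branch_in_unit(1)[of x] farey_branch_in_unit(2)[of y]
      by (auto simp: farey_lift_def)
  next
    case 3
    have "(1 - y) / y \<le> (1 - x) / x" using xy 3 by (intro frac_le) auto
    then have "G ((1 - y) / y) \<le> G ((1 - x) / x)"
      using xy 3 by (intro mono_onD[OF assms(1)] farey_branch_in_unit(2)) auto
    then show ?thesis using 3 xy by (auto simp: farey_lift_def)
  qed
qed

text \<open>\<open>farey_lift\<close> is the functional equation of the question-mark function, read
  as an operator. Iteration from the identity keeps continuity, monotonicity and the endpoint
  values, and all of these survive the uniform limit.\<close>

lemma exists_farey_lift_fixpoint:
  obtains G where "continuous_on {0..1} G" "mono_on {0..1} G" "G 0 = 0" "G 1 = 1"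
    "\<And>x. x \<in> {0..1} \<Longrightarrow> farey_lift G x = G x"
proof -
  define g where "g n = (farey_lift ^^ n) id" for n
  have g_Suc: "g (Suc n) = farey_lift (g n)" for n by (simp add: g_def)
  have g0: "g n 0 = 0" and g1: "g n 1 = 1" for n
    by (induction n) (auto simp: g_Suc farey_lift_endpoints, auto simp: g_def)
  have cont: "continuous_on {0..1} (g n)" for n
    by (induction n) (auto simp: g_Suc g1 intro!: continuous_on_farey_lift, simp add: g_def)
  have mono: "mono_on {0..1} (g n)" for n
    by (induction n) (auto simp: g_Suc g0 g1 intro!: mono_on_farey_lift, simp add: g_def mono_on_def)
  have range: "g n x \<in> {0..1}" if "x \<in> {0..1}" for n x
    using mono_onD[OF mono[of n], of 0 x] mono_onD[OF mono[of n], of x 1] that g0 g1 by auto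
  have step: "\<bar>g (Suc n) x - g n x\<bar> \<le> (1/2) ^ n" if "x \<in> {0..1}" for n x
    using that
  proof (induction n arbitrary: x)
    case 0 then show ?case using range[of x "Suc 0"] range[of x 0] by auto
  next
    case (Suc n)
    show ?case using farey_lift_diff[OF Suc.IH Suc.prems] by (simp add: g_Suc)
  qed
  \<comment> \<open>The limit is taken as a telescoping series, so that the geometric bound
    \<open>step\<close> feeds the Weierstrass M-test.\<close>
  have "uniform_limit {0..1} (\<lambda>n x. \<Sum>i<n. g (Suc i) x - g i x) (\<lambda>x. suminf (\<lambda>i. g (Suc i) x - g i x)) sequentially"
    by (rule Weierstrass_m_test[where M="\<lambda>n. (1/2)^n"]) (use step in auto)
  then have "uniform_limit {0..1} (\<lambda>n x. x + (\<Sum>i<n. g (Suc i) x - g i x)) (\<lambda>x. x + suminf (\<lambda>i. g (Suc i) x - g i x)) sequentially"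
    by (intro uniform_limit_intros)
  moreover have "x + (\<Sum>i<n. g (Suc i) x - g i x) = g n x" for n x
    by (subst sum_lessThan_telescope) (simp add: g_def)
  ultimately obtain G where G: "uniform_limit {0..1} g G sequentially"
    by (metis (no_types, lifting) ext)
  have lim: "(\<lambda>n. g n x) \<longlonglongrightarrow> G x" if "x \<in> {0..1}" for x
    using tendsto_uniform_limitI[OF G that] .
  show ?thesis
  proof
    show "continuous_on {0..1} G"
      using uniform_limit_theorem[OF _ G] cont by auto
    show "mono_on {0..1} G"
    proof (rule mono_onI)
      fix x y :: real assume "x \<in> {0..1}" "y \<in> {0..1}" "x \<le> y"
      then show "G x \<le> G y"
        using mono by (intro LIMSEQ_le[OF lim lim]) (auto simp: mono_on_def)
    qed
    show "G 0 = 0" using lim[of 0] g0 by (auto simp: LIMSEQ_const_iff)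
    show "G 1 = 1" using lim[of 1] g1 by (auto simp: LIMSEQ_const_iff)
    show "farey_lift G x = G x" if x: "x \<in> {0..1}" for x
    proof -
      have "(\<lambda>n. farey_lift (g n) x) \<longlonglongrightarrow> farey_lift G x"
        unfolding farey_lift_def using x farey_branch_in_unit
        by (auto intro!: tendsto_intros lim)
      then have "(\<lambda>n. g (Suc n) x) \<longlonglongrightarrow> farey_lift G x" by (simp add: g_Suc)
      moreover have "(\<lambda>n. g (Suc n) x) \<longlonglongrightarrow> G x" using lim[OF x] by (rule LIMSEQ_Suc)
      ultimately show ?thesis by (rule LIMSEQ_unique)
    qed
  qed
qed

section \<open>Continued fraction digits under the Farey branches\<close>

abbreviation unit_irrationals :: "real set" where
  "unit_irrationals \<equiv> {0..1} - \<rat>"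

lemma Rats_inverse_iff: "inverse x \<in> \<rat> \<longleftrightarrow> x \<in> (\<rat> :: 'a :: field_char_0 set)"
  by (metis Rats_inverse inverse_inverse_eq)

lemma farey_branch_irrational:
  assumes "x \<in> unit_irrationals"
  shows "x / (1 + x) \<in> unit_irrationals" "1 / (1 + x) \<in> unit_irrationals"
proof -
  have 1: "1 / (1 + x) \<notin> \<rat>"
    using assms Rats_add_iff[of 1 x] Rats_inverse_iff[of "1 + x"] by (auto simp: divide_inverse)
  then show "1 / (1 + x) \<in> unit_irrationals" using assms by auto
  have "x / (1 + x) = 1 - 1 / (1 + x)" using assms by (auto simp: field_simps)
  then show "x / (1 + x) \<in> unit_irrationals"
    using assms 1 Rats_diff[of 1 "x / (1 + x)"] by (auto simp: divide_simps)
qed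

lemma unit_irrationals_cases:
  assumes "x \<in> unit_irrationals"
  obtains y where "y \<in> unit_irrationals" "x = y / (1 + y)" "x < 1/2" "y = x / (1 - x)"
    | y where "y \<in> unit_irrationals" "x = 1 / (1 + y)" "x > 1/2" "y = (1 - x) / x"
proof -
  have "1/2 \<in> (\<rat> :: real set)" by simp
  then have "x \<noteq> 1/2" using assms by blast
  moreover have x01: "0 < x" "x < 1" using assms by (auto simp: less_le)
  ultimately consider "x < 1/2" | "x > 1/2" by linarith
  then show ?thesis
  proof cases
    case 1
    define y where "y = x / (1 - x)"
    have xy: "x = y / (1 + y)" using x01 1 by (simp add: y_def field_simps)
    then have "y \<notin> \<rat>" using assms by auto
    moreover have "y \<in> {0..1}" unfolding y_def using x01 1 by (intro farey_branch_in_unit) auto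
    ultimately show ?thesis by (intro that(1)[OF _ xy 1 y_def]) auto
  next
    case 2
    define y where "y = (1 - x) / x"
    have xy: "x = 1 / (1 + y)" using x01 2 by (simp add: y_def field_simps)
    then have "y \<notin> \<rat>" using assms by auto
    moreover have "y \<in> {0..1}" unfolding y_def using x01 2 by (intro farey_branch_in_unit) auto
    ultimately show ?thesis by (intro that(2)[OF _ xy 2 y_def]) auto
  qed
qed

lemma gauss_map_unit_irrationals:
  assumes "x \<in> unit_irrationals" shows "gauss_map x \<in> unit_irrationals"
proof -
  have "1 / x \<notin> \<rat>" using assms Rats_inverse_iff[of x] by (auto simp: divide_inverse)
  then have "gauss_map x \<notin> \<rat>"
    unfolding gauss_map_def frac_def using Rats_add[of "1/x - \<lfloor>1/x\<rfloor>" "\<lfloor>1/x\<rfloor>"] by auto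
  then show ?thesis using frac_ge_0[of "1/x"] frac_lt_1[of "1/x"]
    by (auto simp: gauss_map_def simp del: frac_ge_0)
qed

lemma funpow_gauss_map_unit_irrationals:
  "x \<in> unit_irrationals \<Longrightarrow> (gauss_map ^^ n) x \<in> unit_irrationals"
  by (induction n) (simp_all only: funpow.simps o_apply id_apply gauss_map_unit_irrationals)

lemma cf_digit_ge_1: "x \<in> unit_irrationals \<Longrightarrow> cf_digit x n \<ge> 1"
proof -
  assume "x \<in> unit_irrationals"
  then have "(gauss_map ^^ n) x \<in> unit_irrationals" by (rule funpow_gauss_map_unit_irrationals)
  then have "0 < (gauss_map ^^ n) x" "(gauss_map ^^ n) x \<le> 1" by (auto simp: less_le)
  then have "1 \<le> \<lfloor>1 / (gauss_map ^^ n) x\<rfloor>" by (simp add: le_floor_iff)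
  then show ?thesis unfolding cf_digit_def by linarith
qed

lemma cf_digit_Suc: "cf_digit x (Suc n) = cf_digit (gauss_map x) n"
  by (simp add: cf_digit_def funpow_swap1)

lemma sum_cf_digit_ge: "x \<in> unit_irrationals \<Longrightarrow> Suc n \<le> (\<Sum>i\<le>n. cf_digit x i)"
  using sum_mono[of "{..n}" "\<lambda>_. 1" "cf_digit x"] cf_digit_ge_1 by simp

lemma question_mark_term_le:
  assumes "x \<in> unit_irrationals"
  shows "norm ((-1) ^ n / 2 ^ (\<Sum>i\<le>n. cf_digit x i) :: real) \<le> (1/2) ^ Suc n"
  using power_increasing[OF sum_cf_digit_ge[OF assms, of n], of "2::real"]
  by (simp add: norm_divide norm_power power_one_over field_simps del: power_Suc)

lemma summable_question_mark:
  assumes "x \<in> unit_irrationals"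
  shows "summable (\<lambda>n. (-1) ^ n / 2 ^ (\<Sum>i\<le>n. cf_digit x i) :: real)"
  by (rule summable_comparison_test[OF _ summable_Suc_iff[THEN iffD2, OF summable_geometric[of "1/2"]]])
     (use question_mark_term_le[OF assms] in auto)

lemma abs_question_mark_series_le: "x \<in> unit_irrationals \<Longrightarrow> \<bar>question_mark_series x\<bar> \<le> 2"
proof -
  assume x: "x \<in> unit_irrationals"
  have "norm (\<Sum>n. (-1) ^ n / 2 ^ (\<Sum>i\<le>n. cf_digit x i) :: real) \<le> (\<Sum>n. (1/2) ^ Suc n)"
    using question_mark_term_le[OF x] power_half_series
    by (intro norm_suminf_le) (auto simp: sums_iff)
  also have "\<dots> = 1" using power_half_series sums_iff by metis
  finally show ?thesis by (simp add: question_mark_series_def abs_mult)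
qed

text \<open>Shifting the digits by one divides all later terms by \<open>2 ^ cf_digit x 0\<close>
  and flips their sign; the 2 comes from the factor in front of the series.\<close>

lemma question_mark_series_first_digit:
  assumes "x \<in> unit_irrationals"
  shows "question_mark_series x = (2 - question_mark_series (gauss_map x)) / 2 ^ cf_digit x 0"
proof -
  have gx: "gauss_map x \<in> unit_irrationals" using assms by (rule gauss_map_unit_irrationals)
  have sum: "(\<Sum>i\<le>Suc n. cf_digit x i) = cf_digit x 0 + (\<Sum>i\<le>n. cf_digit (gauss_map x) i)" for n
    by (simp add: sum.atMost_Suc_shift cf_digit_Suc del: sum.atMost_Suc)
  have "(\<Sum>n. (-1) ^ n / 2 ^ (\<Sum>i\<le>n. cf_digit x i) :: real)
      = 1 / 2 ^ cf_digit x 0 + (\<Sum>n. (-1) ^ Suc n / 2 ^ (\<Sum>i\<le>Suc n. cf_digit x i))"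
    using suminf_split_head[OF summable_question_mark[OF assms]] by simp
  also have "(\<Sum>n. (-1) ^ Suc n / 2 ^ (\<Sum>i\<le>Suc n. cf_digit x i) :: real)
      = (\<Sum>n. (- 1 / 2 ^ cf_digit x 0) * ((-1) ^ n / 2 ^ (\<Sum>i\<le>n. cf_digit (gauss_map x) i)))"
    unfolding sum by (simp add: power_add)
  also have "\<dots> = (- 1 / 2 ^ cf_digit x 0) * (\<Sum>n. (-1) ^ n / 2 ^ (\<Sum>i\<le>n. cf_digit (gauss_map x) i))"
    by (rule suminf_mult[OF summable_question_mark[OF gx]])
  finally show ?thesis by (simp add: question_mark_series_def field_simps)
qed

text \<open>\<open>x / (1 + x)\<close> raises the first digit by one and keeps the others;
  \<open>1 / (1 + x)\<close> puts a digit 1 in front of the digits of \<open>x\<close>. So the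
  series obeys the functional equation of \<open>farey_lift\<close> at irrationals.\<close>

lemma question_mark_series_branches:
  assumes "x \<in> unit_irrationals"
  shows "question_mark_series (x / (1 + x)) = question_mark_series x / 2"
    and "question_mark_series (1 / (1 + x)) = 1 - question_mark_series x / 2"
proof -
  have x: "0 < x" "x < 1" using assms by (auto simp: less_le)
  have inv: "1 / (x / (1 + x)) = 1 / x + 1" using x by (simp add: field_simps)
  have "gauss_map (x / (1 + x)) = gauss_map x"
    unfolding gauss_map_def inv by (simp add: frac_def)
  moreover have "cf_digit (x / (1 + x)) 0 = Suc (cf_digit x 0)"
    using x by (simp add: cf_digit_def inv nat_add_distrib del: divide_divide_eq_right)
  ultimately show "question_mark_series (x / (1 + x)) = question_mark_series x / 2"
    using question_mark_series_first_digit[OF assms]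
      question_mark_series_first_digit[OF farey_branch_irrational(1)[OF assms]]
    by simp
  have "\<lfloor>1 + x\<rfloor> = 1" using x by (simp add: floor_eq_iff)
  then have "gauss_map (1 / (1 + x)) = x" "cf_digit (1 / (1 + x)) 0 = 1"
    by (simp_all add: gauss_map_def cf_digit_def frac_def)
  then show "question_mark_series (1 / (1 + x)) = 1 - question_mark_series x / 2"
    using question_mark_series_first_digit[OF farey_branch_irrational(2)[OF assms]] by simp
qed

text \<open>Two bounded solutions of the functional equation agree, since following the Farey
  branches of \<open>x\<close> through n steps divides their difference by \<open>2 ^ n\<close>.
  This identifies \<open>question_mark\<close> with the fixed point at irrationals, and continuity
  of the fixed point does so at rationals.\<close>

lemma
  shows continuous_on_question_mark_unit: "continuous_on {0..1} question_mark"
    and mono_on_question_mark_unit: "mono_on {0..1} question_mark"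
    and question_mark_0: "question_mark 0 = 0" and question_mark_1: "question_mark 1 = 1"
    and farey_lift_question_mark: "x \<in> {0..1} \<Longrightarrow> farey_lift question_mark x = question_mark x"
proof -
  obtain G where G: "continuous_on {0..1} G" "mono_on {0..1} G" "G 0 = 0" "G 1 = 1"
    "\<And>x. x \<in> {0..1} \<Longrightarrow> farey_lift G x = G x"
    using exists_farey_lift_fixpoint by blast
  \<comment> \<open>The 3 is the crude start of the induction: the series is at most 2 in absolute
    value, and \<open>G\<close> at most 1.\<close>
  have diff: "\<bar>question_mark_series x - G x\<bar> \<le> 3 / 2 ^ n" if "x \<in> unit_irrationals" for x n
    using that
  proof (induction n arbitrary: x)
    case 0
    have "0 \<le> G x" "G x \<le> 1"
      using mono_onD[OF G(2), of 0 x] mono_onD[OF G(2), of x 1] 0 G(3,4) by auto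
    then show ?case using abs_question_mark_series_le[OF 0] by auto
  next
    case (Suc n)
    from Suc.prems show ?case
    proof (cases rule: unit_irrationals_cases)
      case (1 y)
      have "G x = G y / 2"
        using 1(3,4) G(5)[of x] Suc.prems by (simp add: farey_lift_def)
      moreover have "question_mark_series x = question_mark_series y / 2"
        unfolding 1(2) by (rule question_mark_series_branches(1)[OF 1(1)])
      ultimately show ?thesis using Suc.IH[OF 1(1)] by simp
    next
      case (2 y)
      have "G x = 1 - G y / 2"
        using 2(3,4) G(5)[of x] Suc.prems by (simp add: farey_lift_def)
      moreover have "question_mark_series x = 1 - question_mark_series y / 2"
        unfolding 2(2) by (rule question_mark_series_branches(2)[OF 2(1)])
      ultimately show ?thesis using Suc.IH[OF 2(1)] by simp
    qed
  qed
  have series: "question_mark_series x = G x" if "x \<in> unit_irrationals" for x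
  proof -
    have "(\<lambda>n. 3 * (1 / 2) ^ n :: real) \<longlonglongrightarrow> 3 * 0"
      by (intro tendsto_mult tendsto_const LIMSEQ_power_zero) simp
    then have "(\<lambda>n. 3 / 2 ^ n :: real) \<longlonglongrightarrow> 0" by (simp add: power_one_over)
    then have "\<bar>question_mark_series x - G x\<bar> \<le> 0"
      by (rule LIMSEQ_le_const) (use diff[OF that] in auto)
    then show ?thesis by simp
  qed
  have eq: "question_mark x = G x" if x: "x \<in> {0..1}" for x
  proof (cases "x \<in> \<rat>")
    case True
    \<comment> \<open>The \<open>Lim\<close> in \<open>question_mark\<close> is determined only
      because irrationals accumulate at \<open>x\<close>. The \<open>max\<close> and
      \<open>min\<close> below keep the approximants inside the interval when \<open>x\<close> is 0
      or 1.\<close>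
    have islim: "x islimpt unit_irrationals"
      unfolding islimpt_approachable
    proof (intro allI impI)
      fix e :: real assume "e > 0"
      then have "max 0 (x - e) < min 1 (x + e)" using x by auto
      then have "uncountable ({max 0 (x - e)<..<min 1 (x + e)} - (\<rat> \<union> {x}))"
        by (intro uncountable_minus_countable uncountable_open_interval[THEN iffD2])
          (auto simp: countable_rat)
      then obtain z where "z \<in> {max 0 (x - e)<..<min 1 (x + e)} - (\<rat> \<union> {x})"
        by (metis countable_empty ex_in_conv)
      then show "\<exists>z\<in>unit_irrationals. z \<noteq> x \<and> dist z x < e"
        by (intro bexI[of _ z]) (auto simp: dist_real_def)
    qed
    have "(G \<longlongrightarrow> G x) (at x within {0..1})" using G(1) x by (auto simp: continuous_on_def)
    then have "(G \<longlongrightarrow> G x) (at x within unit_irrationals)"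
      by (rule tendsto_within_subset) auto
    then have "(question_mark_series \<longlongrightarrow> G x) (at x within unit_irrationals)"
      by (rule Lim_transform_eventually) (auto simp: eventually_at_filter series)
    then show ?thesis using True x islim
      by (auto simp: question_mark_def trivial_limit_within intro!: tendsto_Lim)
  qed (use x series in \<open>auto simp: question_mark_def\<close>)
  show "continuous_on {0..1} question_mark"
    using G(1) by (rule continuous_on_eq) (simp add: eq)
  show "mono_on {0..1} question_mark" using G(2) eq by (auto simp: mono_on_def)
  show "question_mark 0 = 0" "question_mark 1 = 1" using G(3,4) eq by auto
  show "farey_lift question_mark x = question_mark x" if x: "x \<in> {0..1}" for x
    using G(5)[OF x] x eq farey_branch_in_unit[of x] by (auto simp: farey_lift_def)
qed

section \<open>The Minkowski measure\<close>

lemma space_half_sum [simp]: "space (half_sum M N) = space M"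
  by (simp add: half_sum_def)

lemma nn_integral_half_sum:
  assumes sets: "sets M = sets N" and "f \<in> borel_measurable M"
  shows "(\<integral>\<^sup>+x. f x \<partial>half_sum M N) = ((\<integral>\<^sup>+x. f x \<partial>M) + (\<integral>\<^sup>+x. f x \<partial>N)) / 2"
  using assms(2)
proof induction
  case (cong f g)
  have "space N = space M" using sets by (metis sets_eq_imp_space_eq)
  then have "(\<integral>\<^sup>+x. f x \<partial>half_sum M N) = (\<integral>\<^sup>+x. g x \<partial>half_sum M N)"
    "(\<integral>\<^sup>+x. f x \<partial>M) = (\<integral>\<^sup>+x. g x \<partial>M)" "(\<integral>\<^sup>+x. f x \<partial>N) = (\<integral>\<^sup>+x. g x \<partial>N)"
    using cong(3) by (auto intro!: nn_integral_cong)
  then show ?case using cong(4) by (simp only:)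
next
  case (set A)
  then have "A \<in> sets N" "A \<in> sets (half_sum M N)" using sets by auto
  with set show ?case by (simp add: emeasure_half_sum[OF sets] add_divide_distrib_ennreal)
next
  case (mult u c)
  then have "u \<in> borel_measurable N" "u \<in> borel_measurable (half_sum M N)"
    using sets by (auto cong: measurable_cong_sets)
  with mult show ?case
    by (simp add: nn_integral_cmult ennreal_times_divide distrib_left)
next
  case (add u v)
  then have "u \<in> borel_measurable N" "u \<in> borel_measurable (half_sum M N)"
    "v \<in> borel_measurable N" "v \<in> borel_measurable (half_sum M N)"
    using sets by (auto cong: measurable_cong_sets)
  with add show ?case
    by (simp add: nn_integral_add add_divide_distrib_ennreal ac_simps)
next
  case (seq U)
  then have U: "U i \<in> borel_measurable M" "U i \<in> borel_measurable N" "U i \<in> borel_measurable (half_sum M N)" for i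
    using sets by (auto cong: measurable_cong_sets)
  have inc: "incseq (\<lambda>i. \<integral>\<^sup>+x. U i x \<partial>M)" "incseq (\<lambda>i. \<integral>\<^sup>+x. U i x \<partial>N)"
    using seq by (auto intro!: monoI nn_integral_mono simp: le_fun_def mono_def)
  have "(\<integral>\<^sup>+x. (SUP i. U i) x \<partial>half_sum M N) = (SUP i. \<integral>\<^sup>+x. U i x \<partial>half_sum M N)"
    using U seq by (simp add: nn_integral_monotone_convergence_SUP image_comp)
  also have "\<dots> = (SUP i. ((\<integral>\<^sup>+x. U i x \<partial>M) + (\<integral>\<^sup>+x. U i x \<partial>N)) / 2)"
    using seq by simp
  also have "\<dots> = ((SUP i. \<integral>\<^sup>+x. U i x \<partial>M) + (SUP i. \<integral>\<^sup>+x. U i x \<partial>N)) / 2"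
    by (simp add: SUP_divide_ennreal flip: ennreal_SUP_add[OF inc])
  also have "\<dots> = ((\<integral>\<^sup>+x. (SUP i. U i) x \<partial>M) + (\<integral>\<^sup>+x. (SUP i. U i) x \<partial>N)) / 2"
    using U seq by (simp add: nn_integral_monotone_convergence_SUP image_comp)
  finally show ?case .
qed

lemma question_mark_clamp: "question_mark x = question_mark (max 0 (min 1 x))"
proof -
  consider "x < 0" | "x > 1" | "0 \<le> x" "x \<le> 1" by linarith
  then show ?thesis
  proof cases
    case 1
    then show ?thesis using question_mark_0 by (simp add: question_mark_def[of x])
  next
    case 2
    then show ?thesis using question_mark_1 by (simp add: question_mark_def[of x])
  qed simp
qed

lemma mono_question_mark: "x \<le> y \<Longrightarrow> question_mark x \<le> question_mark y"
  unfolding question_mark_clamp[of x] question_mark_clamp[of y]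
  by (rule mono_onD[OF mono_on_question_mark_unit]) auto

lemma question_mark_nonpos: "x \<le> 0 \<Longrightarrow> question_mark x = 0"
  using question_mark_clamp[of x] question_mark_0 by simp

lemma question_mark_ge_1: "x \<ge> 1 \<Longrightarrow> question_mark x = 1"
  using question_mark_clamp[of x] question_mark_1 by simp

lemma continuous_on_question_mark: "continuous_on UNIV question_mark"
proof -
  have "continuous_on UNIV (\<lambda>x. question_mark (max 0 (min 1 x)))"
    by (intro continuous_on_compose2[OF continuous_on_question_mark_unit] continuous_intros) auto
  then show ?thesis by (simp flip: question_mark_clamp)
qed

lemma question_mark_branches:
  assumes "x \<in> {0..1}"
  shows "question_mark (x / (1 + x)) = question_mark x / 2"
    and "question_mark (1 / (1 + x)) = 1 - question_mark x / 2"
proof -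
  have "x / (1 + x) / (1 - x / (1 + x)) = x" "x / (1 + x) \<le> 1/2" "x / (1 + x) \<in> {0..1}"
    using assms by (auto simp: field_simps)
  then show "question_mark (x / (1 + x)) = question_mark x / 2"
    using farey_lift_question_mark[of "x / (1 + x)"] by (simp add: farey_lift_def)
  have "(1 - 1 / (1 + x)) / (1 / (1 + x)) = x" "1 / (1 + x) > 1/2 \<or> x = 1" "1 / (1 + x) \<in> {0..1}"
    using assms by (auto simp: field_simps)
  then show "question_mark (1 / (1 + x)) = 1 - question_mark x / 2"
    using farey_lift_question_mark[of "1 / (1 + x)"] by (auto simp: farey_lift_def question_mark_1)
qed

lemma sets_minkowski [simp, measurable_cong]: "sets minkowski_measure = sets borel"
  and space_minkowski [simp]: "space minkowski_measure = UNIV"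
  by (simp_all add: minkowski_measure_def)

lemma real_distribution_minkowski: "real_distribution minkowski_measure"
  and cdf_minkowski: "cdf minkowski_measure = question_mark"
proof -
  have right: "continuous (at_right a) question_mark" for a
    using continuous_on_question_mark
    by (simp add: continuous_on_eq_continuous_at continuous_at_imp_continuous_at_within)
  have bot: "(question_mark \<longlongrightarrow> 0) at_bot"
    by (rule tendsto_eventually, rule eventually_mono[OF eventually_le_at_bot[of 0]]) (rule question_mark_nonpos)
  have top: "(question_mark \<longlongrightarrow> 1) at_top"
    by (rule tendsto_eventually, rule eventually_mono[OF eventually_ge_at_top[of 1]]) (rule question_mark_ge_1)
  show "real_distribution minkowski_measure"
    unfolding minkowski_measure_def
    by (rule real_distribution_interval_measure[OF mono_question_mark right bot top])
  show "cdf minkowski_measure = question_mark"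
    unfolding minkowski_measure_def
    by (rule cdf_interval_measure[OF mono_question_mark right bot])
qed

interpretation minkowski: real_distribution minkowski_measure
  by (rule real_distribution_minkowski)

lemma measure_minkowski_Icc:
  assumes "a \<le> b" shows "measure minkowski_measure {a..b} = question_mark b - question_mark a"
  unfolding minkowski_measure_def measure_def
  by (subst emeasure_interval_measure_Icc[OF assms mono_question_mark continuous_on_question_mark])
     (use mono_question_mark[OF assms] in auto)

lemma emeasure_minkowski_singleton: "emeasure minkowski_measure {x} = 0"
  using measure_minkowski_Icc[of x x] by (simp add: minkowski.emeasure_eq_measure)

lemma AE_minkowski_unit_irrational: "AE x in minkowski_measure. 0 < x \<and> x < 1 \<and> x \<notin> \<rat>"
proof -
  have "AE y in minkowski_measure. y \<noteq> x" for x
    by (intro AE_I[of _ _ "{x}"]) (auto simp: emeasure_minkowski_singleton)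
  then have irrat: "AE y in minkowski_measure. \<forall>x\<in>\<rat>. y \<noteq> x"
    by (subst AE_ball_countable) (auto simp: countable_rat)
  have "AE y in minkowski_measure. y \<in> {0..1}"
    by (rule minkowski.AE_prob_1) (simp add: measure_minkowski_Icc question_mark_0 question_mark_1)
  with irrat show ?thesis
  proof eventually_elim
    case (elim y)
    then have "y \<noteq> 0" "y \<noteq> 1" "y \<notin> \<rat>" using Rats_0 Rats_1 by blast+
    with elim show ?case by (auto simp: less_le)
  qed
qed

lemma AE_minkowskiI:
  assumes "\<And>x. 0 < x \<Longrightarrow> x < 1 \<Longrightarrow> x \<notin> \<rat> \<Longrightarrow> P x"
  shows "AE x in minkowski_measure. P x"
  by (rule eventually_mono[OF AE_minkowski_unit_irrational]) (use assms in blast)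

lemma measure_minkowski_cong:
  assumes "\<And>y. 0 < y \<Longrightarrow> y < 1 \<Longrightarrow> y \<in> A \<longleftrightarrow> y \<in> B" "A \<in> sets borel" "B \<in> sets borel"
  shows "measure minkowski_measure A = measure minkowski_measure B"
  using AE_minkowski_unit_irrational assms
  by (intro minkowski.finite_measure_eq_AE) (auto elim: eventually_mono)

text \<open>Distribution functions are compared. At \<open>x\<close> the right-hand side averages
  the masses of \<open>y / (1 + y) \<le> x\<close> and \<open>1 / (1 + y) \<le> x\<close>. Up to 1/2
  the second set is null, beyond 1/2 the first one is full, and the remaining set reproduces the
  matching branch of \<open>farey_lift question_mark\<close>.\<close>

lemma minkowski_self_similar:
  "minkowski_measure = half_sum (distr minkowski_measure borel (\<lambda>x. x / (1 + x)))
      (distr minkowski_measure borel (\<lambda>x. 1 / (1 + x)))"  (is "_ = half_sum ?F ?G")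
proof -
  let ?M = "half_sum ?F ?G"
  have emM: "emeasure ?M A = emeasure ?F A / 2 + emeasure ?G A / 2" if "A \<in> sets borel" for A
    by (rule emeasure_half_sum[of ?F ?G A]) (use that in auto)
  have meas: "measure ?M A = measure minkowski_measure {x. x / (1 + x) \<in> A} / 2
      + measure minkowski_measure {x. 1 / (1 + x) \<in> A} / 2" if "A \<in> sets borel" for A
    unfolding measure_def[of ?M] emM[OF that] using that
    by (simp add: emeasure_distr vimage_def minkowski.emeasure_eq_measure ennreal_divide_numeral
      flip: ennreal_plus)
  have "prob_space ?M"
    by (rule prob_spaceI)
      (simp add: emM emeasure_distr minkowski.emeasure_space_1[simplified] flip: add_divide_distrib_ennreal)
  then interpret M: prob_space ?M .
  have "real_distribution ?M"
    by unfold_locales simp_all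
  moreover have "cdf ?M x = question_mark x" for x
  proof -
    have f0: "y / (1 + y) \<le> x \<longleftrightarrow> y * (1 - x) \<le> x" and f1: "1 / (1 + y) \<le> x \<longleftrightarrow> 1 - x \<le> y * x" if "0 < y" for y
      using that by (auto simp: field_simps)
    have measure_Iic: "measure minkowski_measure {..z} = question_mark z" for z
      using fun_cong[OF cdf_minkowski, of z] by (simp add: cdf_def)
    consider "x \<le> 0" | "0 < x" "x \<le> 1/2" | "1/2 < x" "x < 1" | "x \<ge> 1" by linarith
    then have "measure minkowski_measure {y. y / (1 + y) \<le> x} / 2
      + measure minkowski_measure {y. 1 / (1 + y) \<le> x} / 2 = question_mark x"
    proof cases
      case 1
      have "y * (1 - x) > x" "1 - x > y * x" if "0 < y" for y
      proof -
        have "y * (1 - x) > 0" "y * x \<le> 0" using that 1 by (auto simp: mult_nonneg_nonpos)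
        then show "y * (1 - x) > x" "1 - x > y * x" using 1 by linarith+
      qed
      then have "measure minkowski_measure {y. y / (1 + y) \<le> x} = measure minkowski_measure {}"
        "measure minkowski_measure {y. 1 / (1 + y) \<le> x} = measure minkowski_measure {}"
        by (intro measure_minkowski_cong; force simp: f0 f1)+
      then show ?thesis using 1 by (simp add: question_mark_nonpos)
    next
      case 2
      have "measure minkowski_measure {y. y / (1 + y) \<le> x} = measure minkowski_measure {..x / (1 - x)}"
        using 2 by (intro measure_minkowski_cong) (auto simp: f0 pos_le_divide_eq)
      moreover have "measure minkowski_measure {y. 1 / (1 + y) \<le> x} = measure minkowski_measure {}"
      proof (intro measure_minkowski_cong)
        fix y :: real assume y: "0 < y" "y < 1"
        have "y * x < x" using 2 y by simp
        then have "\<not> 1 - x \<le> y * x" using 2 by linarith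
        then show "y \<in> {y. 1 / (1 + y) \<le> x} \<longleftrightarrow> y \<in> {}" using y by (simp add: f1)
      qed auto
      moreover have "question_mark (x / (1 - x)) / 2 = question_mark x"
        using 2 farey_lift_question_mark[of x] by (simp add: farey_lift_def)
      ultimately show ?thesis using measure_Iic[of "x / (1 - x)"] by simp
    next
      case 3
      have "measure minkowski_measure {y. y / (1 + y) \<le> x} = measure minkowski_measure UNIV"
      proof (intro measure_minkowski_cong)
        fix y :: real assume y: "0 < y" "y < 1"
        have "y * (1 - x) < 1 - x" using 3 y mult_strict_right_mono[of y 1 "1 - x"] by simp
        then have "y * (1 - x) \<le> x" using 3 by linarith
        then show "y \<in> {y. y / (1 + y) \<le> x} \<longleftrightarrow> y \<in> UNIV" using y by (simp add: f0)
      qed auto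
      moreover have "measure minkowski_measure {y. 1 / (1 + y) \<le> x} = measure minkowski_measure {(1 - x) / x..1}"
        using 3 by (intro measure_minkowski_cong) (auto simp: f1 pos_divide_le_eq algebra_simps)
      moreover have "measure minkowski_measure {(1 - x) / x..1} = 1 - question_mark ((1 - x) / x)"
        using 3 by (subst measure_minkowski_Icc) (auto simp: question_mark_1 pos_divide_le_eq)
      moreover have "1 - question_mark ((1 - x) / x) / 2 = question_mark x"
        using 3 farey_lift_question_mark[of x] by (simp add: farey_lift_def)
      moreover have "1 / 2 + (1 - a) / 2 = 1 - a / 2" for a :: real by (simp add: field_simps)
      ultimately show ?thesis using minkowski.prob_space by simp
    next
      case 4
      have "y * (1 - x) \<le> x" "1 - x \<le> y * x" if "0 < y" for y
      proof -
        have "y * (1 - x) \<le> 0" "y * x \<ge> 0" using that 4 by (auto simp: mult_nonneg_nonpos)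
        then show "y * (1 - x) \<le> x" "1 - x \<le> y * x" using 4 by linarith+
      qed
      then have "measure minkowski_measure {y. y / (1 + y) \<le> x} = measure minkowski_measure UNIV"
        "measure minkowski_measure {y. 1 / (1 + y) \<le> x} = measure minkowski_measure UNIV"
        by (intro measure_minkowski_cong; force simp: f0 f1)+
      then show ?thesis using 4 minkowski.prob_space by (simp add: question_mark_ge_1)
    qed
    then show ?thesis by (simp add: cdf_def meas)
  qed
  ultimately show ?thesis
    by (intro cdf_unique) (auto simp: real_distribution_minkowski cdf_minkowski)
qed

section \<open>Self-similarity as a rule for integrals\<close>

lemma nn_integral_minkowski:
  assumes [measurable]: "f \<in> borel_measurable borel"
  shows "(\<integral>\<^sup>+x. f x \<partial>minkowski_measure) =
    ((\<integral>\<^sup>+x. f (x / (1 + x)) \<partial>minkowski_measure) + (\<integral>\<^sup>+x. f (1 / (1 + x)) \<partial>minkowski_measure)) / 2"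
  by (subst minkowski_self_similar, subst nn_integral_half_sum) (simp_all add: nn_integral_distr)

lemma integrable_minkowski_iff:
  fixes f :: "real \<Rightarrow> real"
  assumes [measurable]: "f \<in> borel_measurable borel"
  shows "integrable minkowski_measure f \<longleftrightarrow> integrable minkowski_measure (\<lambda>x. f (x / (1 + x)))
    \<and> integrable minkowski_measure (\<lambda>x. f (1 / (1 + x)))"
proof -
  have "(a + b) / 2 < \<infinity> \<longleftrightarrow> a < \<infinity> \<and> b < \<infinity>" for a b :: ennreal
    by (auto simp: less_top[symmetric] ennreal_divide_eq_top_iff)
  then show ?thesis
    by (simp add: integrable_iff_bounded nn_integral_minkowski[of "\<lambda>x. ennreal (norm (f x))"]
      del: real_norm_def infinity_ennreal_def)
qed

lemma integral_minkowski:
  fixes f :: "real \<Rightarrow> real"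
  assumes [measurable]: "f \<in> borel_measurable borel"
    and int: "integrable minkowski_measure (\<lambda>x. f (x / (1 + x)))" "integrable minkowski_measure (\<lambda>x. f (1 / (1 + x)))"
  shows "integrable minkowski_measure f"
    and "(LINT x|minkowski_measure. f x) =
      ((LINT x|minkowski_measure. f (x / (1 + x))) + (LINT x|minkowski_measure. f (1 / (1 + x)))) / 2"
proof -
  show f: "integrable minkowski_measure f" using int integrable_minkowski_iff[OF assms(1)] by blast
  \<comment> \<open>Applied to the positive and the negative part separately:
    \<open>enn2real\<close> is additive on finite values only, and domination by
    \<open>norm (f x)\<close> supplies the finiteness.\<close>
  have *: "enn2real (\<integral>\<^sup>+x. g x \<partial>minkowski_measure) =
      (enn2real (\<integral>\<^sup>+x. g (x / (1 + x)) \<partial>minkowski_measure) + enn2real (\<integral>\<^sup>+x. g (1 / (1 + x)) \<partial>minkowski_measure)) / 2"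
    if [measurable]: "g \<in> borel_measurable borel" and "\<And>x. g x \<le> norm (f x)" for g :: "real \<Rightarrow> ennreal"
  proof -
    have "(\<integral>\<^sup>+x. g (x / (1 + x)) \<partial>minkowski_measure) < \<infinity>" "(\<integral>\<^sup>+x. g (1 / (1 + x)) \<partial>minkowski_measure) < \<infinity>"
      using int unfolding integrable_iff_bounded
      by (auto intro: le_less_trans[OF nn_integral_mono[OF that(2)]])
    moreover have "enn2real ((a + b) / 2) = (enn2real a + enn2real b) / 2" if "a < \<infinity>" "b < \<infinity>" for a b
      using that by (cases a; cases b) (auto simp: ennreal_divide_numeral simp flip: ennreal_plus)
    ultimately show ?thesis
      by (subst nn_integral_minkowski) auto
  qed
  show "(LINT x|minkowski_measure. f x) =
      ((LINT x|minkowski_measure. f (x / (1 + x))) + (LINT x|minkowski_measure. f (1 / (1 + x)))) / 2"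
    unfolding real_lebesgue_integral_def[OF f] real_lebesgue_integral_def[OF int(1)] real_lebesgue_integral_def[OF int(2)]
    by (subst *, simp, simp add: ennreal_leI, subst *, simp, simp add: ennreal_leI, simp add: field_simps)
qed

text \<open>The map \<open>1 - x\<close> exchanges the images \<open>x / (1 + x)\<close> and
  \<open>1 / (1 + x)\<close>, so one application of self-similarity to each side is enough.\<close>

lemma nn_integral_minkowski_reflect:
  assumes [measurable]: "f \<in> borel_measurable borel"
  shows "(\<integral>\<^sup>+x. f (1 - x) \<partial>minkowski_measure) = (\<integral>\<^sup>+x. f x \<partial>minkowski_measure)"
proof -
  have "(\<integral>\<^sup>+x. f (1 - x / (1 + x)) \<partial>minkowski_measure) = (\<integral>\<^sup>+x. f (1 / (1 + x)) \<partial>minkowski_measure)"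
    using AE_minkowski_unit_irrational
    by (intro nn_integral_cong_AE, eventually_elim) (simp add: diff_divide_eq_iff)
  moreover have "(\<integral>\<^sup>+x. f (1 - 1 / (1 + x)) \<partial>minkowski_measure) = (\<integral>\<^sup>+x. f (x / (1 + x)) \<partial>minkowski_measure)"
    using AE_minkowski_unit_irrational
    by (intro nn_integral_cong_AE, eventually_elim) (simp add: diff_divide_eq_iff)
  ultimately show ?thesis
    using nn_integral_minkowski[of "\<lambda>x. f (1 - x)"] nn_integral_minkowski[of f] by (simp add: add.commute)
qed

lemma minkowski_reflect: "distr minkowski_measure borel (\<lambda>x. 1 - x) = minkowski_measure"
proof (rule measure_eqI)
  fix A assume "A \<in> sets (distr minkowski_measure borel (\<lambda>x. 1 - x))"
  then have A[measurable]: "A \<in> sets borel" by simp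
  have "emeasure (distr minkowski_measure borel (\<lambda>x. 1 - x)) A
      = (\<integral>\<^sup>+x. indicator A x \<partial>distr minkowski_measure borel (\<lambda>x. 1 - x))"
    by simp
  also have "\<dots> = (\<integral>\<^sup>+x. indicator A (1 - x) \<partial>minkowski_measure)"
    by (rule nn_integral_distr) simp_all
  also have "\<dots> = (\<integral>\<^sup>+x. indicator A x \<partial>minkowski_measure)" by (rule nn_integral_minkowski_reflect) simp
  finally show "emeasure (distr minkowski_measure borel (\<lambda>x. 1 - x)) A = emeasure minkowski_measure A" by simp
qed simp

lemma integral_minkowski_reflect:
  fixes f :: "real \<Rightarrow> real"
  assumes [measurable]: "f \<in> borel_measurable borel"
  shows "(LINT x|minkowski_measure. f (1 - x)) = (LINT x|minkowski_measure. f x)"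
  by (subst (2) minkowski_reflect[symmetric], subst integral_distr) auto

lemma set_integral_minkowski:
  fixes f :: "real \<Rightarrow> real"
  assumes [measurable]: "f \<in> borel_measurable borel"
  shows "(LINT x:{0..1}|minkowski_measure. f x) = (LINT x|minkowski_measure. f x)"
  unfolding set_lebesgue_integral_def using AE_minkowski_unit_irrational
proof (intro integral_cong_AE, goal_cases)
  case 3
  from 3 show ?case by eventually_elim simp
qed simp_all

text \<open>Passing from \<open>x\<close> to \<open>x / (1 + x)\<close> adds 1 to
  \<open>1 / x\<close>, and this branch has weight 1/2, so the second moment of \<open>1 / x\<close>
  obeys a contracting inequality. Truncation at \<open>n\<close> makes the integral finite
  beforehand, so that it can be absorbed.\<close>

lemma integrable_inverse_square_minkowski: "integrable minkowski_measure (\<lambda>x. 1 / x\<^sup>2)"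
proof -
  define g where "g n x = (min (real n) (1 / x))\<^sup>2" for n x
  have g_meas[measurable]: "g n \<in> borel_measurable borel" for n
    unfolding g_def by measurable
  have g_nonneg: "0 \<le> g n x" for n x by (simp add: g_def)
  have g_le: "g n x \<le> (real n)\<^sup>2" if "x > 0" for n x
    unfolding g_def using that by (intro power_mono) auto
  have g_int: "integrable minkowski_measure (g n)" for n
    using AE_minkowski_unit_irrational
    by (intro minkowski.integrable_const_bound[where B="(real n)\<^sup>2"]) (auto elim!: eventually_mono simp: g_nonneg g_le)
  have bound: "(LINT x|minkowski_measure. g n x) \<le> 14" for n
  proof -
    have int: "integrable minkowski_measure (\<lambda>x. g n (x / (1 + x)))" "integrable minkowski_measure (\<lambda>x. g n (1 / (1 + x)))"
      using g_int[of n] integrable_minkowski_iff[OF g_meas] by blast+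
    have "(LINT x|minkowski_measure. g n (x / (1 + x))) \<le> (LINT x|minkowski_measure. 3 / 2 * g n x + 3)"
      using AE_minkowski_unit_irrational
    proof (intro integral_mono_AE int(1), goal_cases)
      case 2
      from 2 show ?case
      proof eventually_elim
        case (elim x)
        let ?t = "min (real n) (1 / x)"
        have "g n (x / (1 + x)) \<le> (?t + 1)\<^sup>2"
          unfolding g_def using elim by (intro power_mono) (auto simp: min_def field_simps)
        \<comment> \<open>The slack is \<open>(?t - 2)\<^sup>2 / 2\<close>. The coefficient 3/2 must
          stay below 2, so that half of it can be absorbed.\<close>
        also have "\<dots> \<le> 3 / 2 * ?t\<^sup>2 + 3"
          using zero_le_power2[of "?t - 2"] by (simp add: power2_eq_square algebra_simps)
        finally show ?case by (simp add: g_def)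
      qed
    qed (use g_int[of n] in simp)
    moreover have "(LINT x|minkowski_measure. g n (1 / (1 + x))) \<le> (LINT x|minkowski_measure. 4)"
      using AE_minkowski_unit_irrational
    proof (intro integral_mono_AE int(2), goal_cases)
      case 2
      from 2 show ?case
      proof eventually_elim
        case (elim x)
        have "g n (1 / (1 + x)) \<le> 2\<^sup>2"
          unfolding g_def using elim by (intro power_mono) (auto simp: min_def)
        then show ?case by simp
      qed
    qed simp
    \<comment> \<open>14 is the fixed point of \<open>I = (3 / 2 * I + 3 + 4) / 2\<close>.\<close>
    moreover have "I \<le> 14" if "A \<le> 3 / 2 * I + 3" "B \<le> 4" "I = (A + B) / 2" for I A B :: real
      using that by argo
    ultimately show ?thesis
      using integral_minkowski(2)[OF g_meas int] g_int[of n] minkowski.prob_space by simp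
  qed
  have "(\<integral>\<^sup>+x. ennreal (1 / x\<^sup>2) \<partial>minkowski_measure) = (\<integral>\<^sup>+x. (SUP n. ennreal (g n x)) \<partial>minkowski_measure)"
    using AE_minkowski_unit_irrational
  proof (intro nn_integral_cong_AE, eventually_elim)
    case (elim x)
    obtain N where N: "1 / x \<le> real N" using real_arch_simple by blast
    have "(SUP n. ennreal (g n x)) = ennreal (1 / x\<^sup>2)"
    proof (rule antisym)
      show "(SUP n. ennreal (g n x)) \<le> ennreal (1 / x\<^sup>2)"
      proof (rule SUP_least, rule ennreal_leI)
        fix n show "g n x \<le> 1 / x\<^sup>2"
          unfolding g_def power_one_over[symmetric] using elim by (intro power_mono) auto
      qed
      have "ennreal (1 / x\<^sup>2) = ennreal (g N x)"
        using N by (simp add: g_def min_absorb2 power_one_over)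
      then show "ennreal (1 / x\<^sup>2) \<le> (SUP n. ennreal (g n x))"
        by (auto intro: SUP_upper)
    qed
    then show ?case by simp
  qed
  also have "\<dots> = (SUP n. \<integral>\<^sup>+x. ennreal (g n x) \<partial>minkowski_measure)"
  proof (rule nn_integral_monotone_convergence_SUP_AE)
    show "AE x in minkowski_measure. ennreal (g i x) \<le> ennreal (g (Suc i) x)" for i
      using AE_minkowski_unit_irrational
      by eventually_elim (auto intro!: ennreal_leI power_mono simp: g_def)
  qed simp
  also have "\<dots> \<le> 14"
  proof (rule SUP_least)
    fix n
    show "(\<integral>\<^sup>+x. ennreal (g n x) \<partial>minkowski_measure) \<le> 14"
      using bound[of n] by (subst nn_integral_eq_integral[OF g_int]) (auto simp: g_nonneg ennreal_le_iff2 simp flip: ennreal_numeral)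
  qed
  finally have "(\<integral>\<^sup>+x. ennreal (1 / x\<^sup>2) \<partial>minkowski_measure) < \<infinity>"
    using le_less_trans by fastforce
  then show ?thesis by (simp add: integrable_iff_bounded)
qed

section \<open>Logarithmic integrals and the Farey transfer operator\<close>

definition log_int :: "real \<Rightarrow> real \<Rightarrow> real" where
  "log_int a b = (LINT y|minkowski_measure. ln (a + b * y))"

text \<open>The \<open>K\<close> of the overview; \<open>log_increment\<close> below is its
  \<delta>.\<close>

definition log_potential :: "real \<Rightarrow> real \<Rightarrow> real" where
  "log_potential a b = (log_int a b + log_int b a) / 2"

definition log_increment :: "real \<Rightarrow> real \<Rightarrow> real" where
  "log_increment a b = (log_int a b - log_int b a) / 2"

definition farey_drift :: real where
  "farey_drift = log_int 1 1"

text \<open>One constant for all logarithmic errors; the same inverse moment also dominates the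
  square of \<open>run_increment\<close>.\<close>

definition log_defect :: real where
  "log_defect = (LINT y|minkowski_measure. 1 / y\<^sup>2)"

text \<open>\<open>(a + b) * y \<le> a + b * y \<le> a + b\<close>, so the error is at most
  \<open>- ln y\<close>, uniformly in \<open>a\<close> and \<open>b\<close>.\<close>

lemma abs_ln_affine_le:
  fixes a b y :: real
  assumes "a \<ge> 0" "b \<ge> 0" "a + b > 0" "0 < y" "y < 1"
  shows "\<bar>ln (a + b * y) - ln (a + b)\<bar> \<le> 1 / y\<^sup>2"
proof -
  have "b * y \<le> b" "a * y \<le> a" using assms by (auto simp: mult_left_le)
  then have le: "(a + b) * y \<le> a + b * y" "a + b * y \<le> a + b" by (auto simp: distrib_right)
  have pos: "0 < (a + b) * y" using assms by simp
  have "ln ((a + b) * y) \<le> ln (a + b * y)" "ln (a + b * y) \<le> ln (a + b)"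
    using le pos by simp_all
  moreover have "ln ((a + b) * y) = ln (a + b) + ln y" using assms by (simp add: ln_mult)
  moreover have "- ln y \<le> 1 / y\<^sup>2"
  proof -
    have "- ln y = ln (1 / y)" using assms by (simp add: ln_div)
    also have "\<dots> \<le> 1 / y" using assms by (intro ln_bound) simp
    also have "\<dots> \<le> 1 / y\<^sup>2" using assms by (intro divide_left_mono) (auto simp: power2_eq_square mult_left_le)
    finally show ?thesis .
  qed
  ultimately show ?thesis by linarith
qed

lemma integrable_ln_affine:
  assumes "a \<ge> 0" "b \<ge> 0" "a + b > 0"
  shows "integrable minkowski_measure (\<lambda>y. ln (a + b * y))"
proof (rule Bochner_Integration.integrable_bound)
  show "integrable minkowski_measure (\<lambda>y. \<bar>ln (a + b)\<bar> + 1 / y\<^sup>2)"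
    using integrable_inverse_square_minkowski by simp
  show "AE y in minkowski_measure. norm (ln (a + b * y)) \<le> norm (\<bar>ln (a + b)\<bar> + 1 / y\<^sup>2)"
    using AE_minkowski_unit_irrational
    by eventually_elim (use abs_ln_affine_le[OF assms] in fastforce)
qed measurable

lemma abs_log_int_le:
  assumes "a \<ge> 0" "b \<ge> 0" "a + b > 0"
  shows "\<bar>log_int a b - ln (a + b)\<bar> \<le> log_defect"
proof -
  have int: "integrable minkowski_measure (\<lambda>y. ln (a + b * y) - ln (a + b))"
    using integrable_ln_affine[OF assms] by simp
  have "log_int a b - ln (a + b) = (LINT y|minkowski_measure. ln (a + b * y) - ln (a + b))"
    using integrable_ln_affine[OF assms] minkowski.prob_space by (simp add: log_int_def)
  also have "\<bar>\<dots>\<bar> \<le> (LINT y|minkowski_measure. \<bar>ln (a + b * y) - ln (a + b)\<bar>)"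
    by (rule integral_abs_bound)
  also have "\<dots> \<le> log_defect"
    unfolding log_defect_def
  proof (rule integral_mono_AE)
    show "AE y in minkowski_measure. \<bar>ln (a + b * y) - ln (a + b)\<bar> \<le> 1 / y\<^sup>2"
      using AE_minkowski_unit_irrational
      by eventually_elim (use abs_ln_affine_le[OF assms] in auto)
  qed (use int integrable_inverse_square_minkowski in auto)
  finally show ?thesis .
qed

lemma log_defect_nonneg: "0 \<le> log_defect"
  unfolding log_defect_def by (rule integral_nonneg_AE) simp

lemma log_int_scale:
  assumes "a \<ge> 0" "b \<ge> 0" "a + b > 0" "c > 0"
  shows "log_int (c * a) (c * b) = ln c + log_int a b"
proof -
  have "log_int (c * a) (c * b) = (LINT y|minkowski_measure. ln c + ln (a + b * y))"
    unfolding log_int_def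
  proof (rule integral_cong_AE)
    show "AE y in minkowski_measure. ln (c * a + c * b * y) = ln c + ln (a + b * y)"
      using AE_minkowski_unit_irrational
    proof eventually_elim
      case (elim y)
      have "c * a + c * b * y = c * (a + b * y)" by (simp add: distrib_left)
      moreover have "a + b * y > 0"
        using assms elim by (cases "a = 0") (auto simp: add_pos_nonneg)
      ultimately show ?case using assms by (simp add: ln_mult)
    qed
  qed measurable
  also have "\<dots> = ln c + log_int a b"
    using integrable_ln_affine[OF assms(1-3)] minkowski.prob_space by (simp add: log_int_def)
  finally show ?thesis .
qed

text \<open>Both branches turn \<open>a + b * y\<close> into a linear form divided by
  \<open>1 + y\<close>, with coefficients \<open>(a, a + b)\<close> and \<open>(a + b, a)\<close>.
  The common denominator accounts for \<open>farey_drift\<close>.\<close>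

lemma log_int_split:
  assumes "a \<ge> 0" "b \<ge> 0" "a + b > 0"
  shows "log_int a b = (log_int a (a + b) + log_int (a + b) a) / 2 - farey_drift"
proof -
  have int: "integrable minkowski_measure (\<lambda>y. ln (a + (a + b) * y))"
    "integrable minkowski_measure (\<lambda>y. ln (a + b + a * y))"
    "integrable minkowski_measure (\<lambda>y. ln (1 + 1 * y))"
    using assms by (intro integrable_ln_affine; simp)+
  have split: "ln (a + b * (y / (1 + y))) = ln (a + (a + b) * y) - ln (1 + 1 * y) \<and>
     ln (a + b * (1 / (1 + y))) = ln (a + b + a * y) - ln (1 + 1 * y)" if "0 < y" for y
  proof -
    have "a + b * (y / (1 + y)) = (a + (a + b) * y) / (1 + y)"
      "a + b * (1 / (1 + y)) = (a + b + a * y) / (1 + y)"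
      using that by (auto simp: field_simps)
    moreover have "(a + b) * y > 0" "a * y \<ge> 0" using assms that by simp_all
    then have "a + (a + b) * y > 0" "a + b + a * y > 0"
      using assms by linarith+
    ultimately show ?thesis using that by (simp add: ln_div)
  qed
  have 0: "(LINT y|minkowski_measure. ln (a + b * (y / (1 + y))))
      = (LINT y|minkowski_measure. ln (a + (a + b) * y) - ln (1 + 1 * y))"
    by (intro integral_cong_AE AE_minkowskiI) (measurable, simp only: split)
  have 1: "(LINT y|minkowski_measure. ln (a + b * (1 / (1 + y))))
      = (LINT y|minkowski_measure. ln (a + b + a * y) - ln (1 + 1 * y))"
    by (intro integral_cong_AE AE_minkowskiI) (measurable, simp only: split)
  have meas: "(\<lambda>y. ln (a + b * y)) \<in> borel_measurable borel" by measurable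
  have "log_int a b = ((LINT y|minkowski_measure. ln (a + b * (y / (1 + y))))
      + (LINT y|minkowski_measure. ln (a + b * (1 / (1 + y))))) / 2"
    unfolding log_int_def
    using integrable_minkowski_iff[OF meas] integrable_ln_affine[OF assms]
    by (intro integral_minkowski(2)[OF meas]) blast+
  also have "\<dots> = (log_int a (a + b) + log_int (a + b) a) / 2 - farey_drift"
    unfolding 0 1 Bochner_Integration.integral_diff[OF int(1,3)] Bochner_Integration.integral_diff[OF int(2,3)]
    by (simp add: log_int_def farey_drift_def field_simps)
  finally show ?thesis .
qed

lemma log_potential_commute: "log_potential a b = log_potential b a"
  by (simp add: log_potential_def)

lemma log_increment_swap: "log_increment a b = - log_increment b a"
  by (simp add: log_increment_def field_simps)

text \<open>By \<open>log_int_split\<close> the potential is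
  \<open>log_int a b + farey_drift\<close> at the child \<open>(a, a + b)\<close> and
  \<open>log_int b a + farey_drift\<close> at the child \<open>(a + b, b)\<close>. These lie
  symmetrically about \<open>log_potential a b + farey_drift\<close>, which forces the form of
  \<open>log_increment\<close>.\<close>

lemma
  assumes "a \<ge> 0" "b \<ge> 0" "a + b > 0"
  shows log_potential_left: "log_potential a (a + b) = log_potential a b + farey_drift + log_increment a b"
    and log_potential_right: "log_potential (a + b) b = log_potential a b + farey_drift - log_increment a b"
  using log_int_split[of a b] log_int_split[of b a] assms
  by (simp_all add: log_potential_def log_increment_def add.commute field_simps)

lemma abs_log_potential_le:
  assumes "a \<ge> 0" "b \<ge> 0" "a + b > 0"
  shows "\<bar>log_potential a b - ln (a + b)\<bar> \<le> log_defect"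
  using abs_log_int_le[of a b] abs_log_int_le[of b a] assms
  unfolding log_potential_def by (simp add: add.commute abs_le_iff field_simps)

lemma abs_log_increment_le:
  assumes "a \<ge> 0" "b \<ge> 0" "a + b > 0"
  shows "\<bar>log_increment a b\<bar> \<le> log_defect"
  using abs_log_int_le[of a b] abs_log_int_le[of b a] assms
  unfolding log_increment_def by (simp add: add.commute abs_le_iff field_simps)

lemma log_increment_scale:
  assumes "a \<ge> 0" "b \<ge> 0" "a + b > 0" "c > 0"
  shows "log_increment (c * a) (c * b) = log_increment a b"
  using log_int_scale[of a b c] log_int_scale[of b a c] assms
  by (simp add: log_increment_def add.commute)

text \<open>Dominated convergence, with a majorant that also covers the point 0, where
  \<open>log_int 0 1\<close> integrates \<open>ln y\<close>.\<close>

lemma continuous_on_log_increment: "continuous_on {0..1} (log_increment 1)"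
proof -
  have bound: "\<bar>ln (a + b * y)\<bar> \<le> ln 2 + 1 / y\<^sup>2"
    if "a \<ge> 0" "b \<ge> 0" "1 \<le> a + b" "a + b \<le> 2" "0 < y" "y < 1" for a b y :: real
  proof -
    have "0 \<le> ln (a + b)" "ln (a + b) \<le> ln 2" using that by simp_all
    then show ?thesis using abs_ln_affine_le[of a b y] that by linarith
  qed
  have lim: "(\<lambda>n. log_int (a n) (b n)) \<longlonglongrightarrow> log_int A B"
    if "a \<longlonglongrightarrow> A" "b \<longlonglongrightarrow> B" and ab: "\<And>n. a n \<ge> 0" "\<And>n. b n \<ge> 0" "\<And>n. 1 \<le> a n + b n" "\<And>n. a n + b n \<le> 2"
      and AB: "A \<ge> 0" "B \<ge> 0" "A + B > 0"
    for a b :: "nat \<Rightarrow> real" and A B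
    unfolding log_int_def
  proof (rule integral_dominated_convergence[where w="\<lambda>y. ln 2 + 1 / y\<^sup>2"])
    show "integrable minkowski_measure (\<lambda>y. ln 2 + 1 / y\<^sup>2)"
      using integrable_inverse_square_minkowski by simp
    show "AE y in minkowski_measure. norm (ln (a i + b i * y)) \<le> ln 2 + 1 / y\<^sup>2" for i
      using AE_minkowski_unit_irrational by eventually_elim (use bound ab in auto)
    show "AE y in minkowski_measure. (\<lambda>i. ln (a i + b i * y)) \<longlonglongrightarrow> ln (A + B * y)"
      using AE_minkowski_unit_irrational
    proof eventually_elim
      case (elim y)
      have "A + B * y > 0" using AB elim by (cases "A = 0") (auto simp: add_pos_nonneg)
      then show ?case by (intro tendsto_intros that(1,2)) auto
    qed
  qed measurable
  show ?thesis
    unfolding continuous_on_sequentially o_def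
  proof (intro ballI allI impI)
    fix r and u :: "nat \<Rightarrow> real"
    assume "r \<in> {0..1}" and u: "(\<forall>n. u n \<in> {0..1}) \<and> u \<longlonglongrightarrow> r"
    then show "(\<lambda>n. log_increment 1 (u n)) \<longlonglongrightarrow> log_increment 1 r"
      unfolding log_increment_def
      by (intro tendsto_intros lim[where a="\<lambda>_. 1"] lim[where b="\<lambda>_. 1"]) auto
  qed
qed

lemma borel_measurable_log_int [measurable]:
  assumes [measurable]: "f \<in> borel_measurable M" "g \<in> borel_measurable M"
  shows "(\<lambda>x. log_int (f x) (g x)) \<in> borel_measurable M"
  unfolding log_int_def by measurable

lemma borel_measurable_log_increment [measurable]:
  assumes [measurable]: "f \<in> borel_measurable M" "g \<in> borel_measurable M"
  shows "(\<lambda>x. log_increment (f x) (g x)) \<in> borel_measurable M"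
  unfolding log_increment_def by measurable

section \<open>The Farey transfer operator\<close>

definition farey_transfer :: "(real \<Rightarrow> real) \<Rightarrow> real \<Rightarrow> real" where
  "farey_transfer \<phi> x = (\<phi> (x / (1 + x)) + \<phi> (1 / (1 + x))) / 2"

text \<open>Both branches shrink a distance \<open>d\<close> to at most \<open>d / (1 + d)\<close>,
  which sends \<open>1 / (n + 1)\<close> to \<open>1 / (n + 2)\<close>. The parabolic fixed point 0
  of \<open>x / (1 + x)\<close> excludes a geometric rate.\<close>

lemma farey_branch_contract:
  fixes x y :: real
  assumes "0 \<le> x" "0 \<le> y" "\<bar>x - y\<bar> \<le> 1 / (real n + 1)"
  shows "\<bar>x / (1 + x) - y / (1 + y)\<bar> \<le> 1 / (real n + 2)"
    and "\<bar>1 / (1 + x) - 1 / (1 + y)\<bar> \<le> 1 / (real n + 2)"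
proof -
  have eq: "\<bar>x / (1 + x) - y / (1 + y)\<bar> = \<bar>x - y\<bar> / ((1 + x) * (1 + y))"
  proof -
    have "x / (1 + x) - y / (1 + y) = (x - y) / ((1 + x) * (1 + y))"
      using assms by (simp add: divide_simps) (simp add: algebra_simps)
    then show ?thesis using assms by (simp add: abs_divide abs_mult)
  qed
  have eq2: "\<bar>1 / (1 + x) - 1 / (1 + y)\<bar> = \<bar>x - y\<bar> / ((1 + x) * (1 + y))"
  proof -
    have "1 / (1 + x) - 1 / (1 + y) = (y - x) / ((1 + x) * (1 + y))"
      using assms by (simp add: divide_simps)
    then show ?thesis using assms by (simp add: abs_divide abs_mult abs_minus_commute)
  qed
  have "1 * (1 + \<bar>x - y\<bar>) \<le> (1 + x) * (1 + y)"
    using assms by (cases "x \<le> y") (auto simp: algebra_simps)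
  then have "\<bar>x - y\<bar> / ((1 + x) * (1 + y)) \<le> \<bar>x - y\<bar> / (1 + \<bar>x - y\<bar>)"
    by (intro divide_left_mono) (auto intro: add_pos_nonneg)
  also have "\<dots> \<le> 1 / (real n + 2)"
    using assms(3) by (simp add: field_simps)
  finally show "\<bar>x / (1 + x) - y / (1 + y)\<bar> \<le> 1 / (real n + 2)"
    "\<bar>1 / (1 + x) - 1 / (1 + y)\<bar> \<le> 1 / (real n + 2)"
    unfolding eq eq2 by simp_all
qed

lemma farey_transfer_oscillation:
  assumes "\<And>x y. x \<in> {0..1} \<Longrightarrow> y \<in> {0..1} \<Longrightarrow> \<bar>x - y\<bar> \<le> 1 / (real n + 1) \<Longrightarrow> \<bar>\<phi> x - \<phi> y\<bar> \<le> e"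
    and "x \<in> {0..1}" "y \<in> {0..1}"
  shows "\<bar>(farey_transfer ^^ n) \<phi> x - (farey_transfer ^^ n) \<phi> y\<bar> \<le> e"
  using assms
proof (induction n arbitrary: \<phi> x y)
  case 0
  then show ?case by auto
next
  case (Suc n)
  have unit: "z / (1 + z) \<in> {0..1}" "1 / (1 + z) \<in> {0..1}" if "z \<in> {0..1}" for z :: real
    using that by auto
  have "\<bar>farey_transfer \<phi> u - farey_transfer \<phi> v\<bar> \<le> e"
    if uv: "u \<in> {0..1}" "v \<in> {0..1}" "\<bar>u - v\<bar> \<le> 1 / (real n + 1)" for u v
  proof -
    have "\<bar>\<phi> (u / (1 + u)) - \<phi> (v / (1 + v))\<bar> \<le> e" "\<bar>\<phi> (1 / (1 + u)) - \<phi> (1 / (1 + v))\<bar> \<le> e"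
      using farey_branch_contract[of u v n] uv
      by (intro Suc.prems(1) unit; auto simp: add.commute)+
    then show ?thesis unfolding farey_transfer_def by argo
  qed
  then show ?case
    using Suc.IH[of "farey_transfer \<phi>" x y] Suc.prems(2,3) by (simp add: funpow_swap1)
qed

lemma continuous_on_farey_transfer:
  assumes "continuous_on {0..1} \<phi>"
  shows "continuous_on {0..1} (farey_transfer \<phi>)"
  unfolding farey_transfer_def
  by (intro continuous_intros continuous_on_compose2[OF assms]) auto

lemma borel_measurable_farey_transfer:
  assumes [measurable]: "\<phi> \<in> borel_measurable borel"
  shows "farey_transfer \<phi> \<in> borel_measurable borel"
  unfolding farey_transfer_def by measurable

lemma integral_farey_transfer:
  assumes [measurable]: "\<phi> \<in> borel_measurable borel" and cont: "continuous_on {0..1} \<phi>"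
  shows "integrable minkowski_measure \<phi>"
    and "(LINT x|minkowski_measure. farey_transfer \<phi> x) = (LINT x|minkowski_measure. \<phi> x)"
proof -
  have "bounded (\<phi> ` {0..1})" using cont by (intro compact_imp_bounded compact_continuous_image) auto
  then obtain B where B: "\<forall>x\<in>{0..1}. \<bar>\<phi> x\<bar> \<le> B" by (auto simp: bounded_iff)
  show int: "integrable minkowski_measure \<phi>"
    by (intro minkowski.integrable_const_bound[where B=B] AE_minkowskiI) (use B in auto)
  then show "(LINT x|minkowski_measure. farey_transfer \<phi> x) = (LINT x|minkowski_measure. \<phi> x)"
    using integrable_minkowski_iff[of \<phi>] integral_minkowski(2)[of \<phi>] by (simp add: farey_transfer_def)
qed

text \<open>The iterates keep their integral and lose their oscillation, hence approach the constant
  with that integral.\<close>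

lemma farey_transfer_LIMSEQ:
  assumes [measurable]: "\<phi> \<in> borel_measurable borel" and cont: "continuous_on {0..1} \<phi>" and x: "x \<in> {0..1}"
  shows "(\<lambda>n. (farey_transfer ^^ n) \<phi> x) \<longlonglongrightarrow> (LINT y|minkowski_measure. \<phi> y)"
proof -
  let ?f = "\<lambda>n. (farey_transfer ^^ n) \<phi>"
  have "?f n \<in> borel_measurable borel \<and> continuous_on {0..1} (?f n) \<and>
    (LINT y|minkowski_measure. ?f n y) = (LINT y|minkowski_measure. \<phi> y)" for n
  proof (induction n)
    case (Suc n)
    then have [measurable]: "?f n \<in> borel_measurable borel" and c: "continuous_on {0..1} (?f n)" by auto
    show ?case using Suc integral_farey_transfer(2)[of "?f n"] continuous_on_farey_transfer[OF c]
      by (simp add: borel_measurable_farey_transfer)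
  qed (use cont in auto)
  then have meas[measurable]: "?f n \<in> borel_measurable borel" and int: "integrable minkowski_measure (?f n)"
    and eq: "(LINT y|minkowski_measure. ?f n y) = (LINT y|minkowski_measure. \<phi> y)" for n
    using integral_farey_transfer(1) by blast+
  show ?thesis
  proof (rule LIMSEQ_I)
    fix e :: real assume "e > 0"
    then obtain d where d: "d > 0" "\<And>u v. u \<in> {0..1} \<Longrightarrow> v \<in> {0..1} \<Longrightarrow> \<bar>u - v\<bar> < d \<Longrightarrow> \<bar>\<phi> u - \<phi> v\<bar> < e / 2"
      using compact_uniformly_continuous[OF cont] unfolding uniformly_continuous_on_def dist_real_def
      by (metis compact_Icc half_gt_zero)
    obtain N where N: "1 / (real N + 1) < d" using d(1) nat_approx_posE by (metis of_nat_Suc add.commute)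
    show "\<exists>N. \<forall>n\<ge>N. norm (?f n x - (LINT y|minkowski_measure. \<phi> y)) < e"
    proof (intro exI allI impI)
      fix n assume "N \<le> n"
      then have "1 / (real n + 1) \<le> 1 / (real N + 1)" by (intro divide_left_mono) auto
      then have osc: "\<bar>?f n u - ?f n v\<bar> \<le> e / 2" if "u \<in> {0..1}" "v \<in> {0..1}" for u v
        using that N d(2) by (intro farey_transfer_oscillation) (fastforce intro: less_imp_le)+
      have "?f n x - (LINT y|minkowski_measure. \<phi> y) = (LINT y|minkowski_measure. ?f n x - ?f n y)"
        using int[of n] eq[of n] minkowski.prob_space by simp
      also have "\<bar>\<dots>\<bar> \<le> (LINT y|minkowski_measure. \<bar>?f n x - ?f n y\<bar>)" by (rule integral_abs_bound)
      also have "\<dots> \<le> (LINT y|minkowski_measure. e / 2)"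
        using int[of n] by (intro integral_mono_AE AE_minkowskiI osc x) auto
      also have "\<dots> < e" using \<open>e > 0\<close> minkowski.prob_space by simp
      finally show "norm (?f n x - (LINT y|minkowski_measure. \<phi> y)) < e" by simp
    qed
  qed
qed

section \<open>Moments of the Stern sequence\<close>

lemma stern_pos: "n \<ge> 1 \<Longrightarrow> stern n \<ge> 1"
proof (induction n rule: less_induct)
  case (less n)
  show ?case
  proof (cases "n = 1")
    case False
    then have "stern (n div 2) \<ge> 1" using less by (intro less.IH) auto
    with False less.prems show ?thesis by (subst stern.simps) auto
  qed (use stern_rec(2) in simp)
qed

text \<open>The neighbour \<open>stern (n + 1)\<close> is carried along because consecutive pairs
  obey a recursion: if \<open>m\<close> carries \<open>(a, b)\<close>, then \<open>2 * m\<close>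
  carries \<open>(a, a + b)\<close> and \<open>2 * m + 1\<close> carries
  \<open>(a + b, b)\<close>.\<close>

definition stern_avg :: "(real \<Rightarrow> real \<Rightarrow> real) \<Rightarrow> nat \<Rightarrow> real" where
  "stern_avg f N = (\<Sum>n\<in>{2 ^ N..<2 ^ (N + 1)}. f (real (stern n)) (real (stern (n + 1)))) / 2 ^ N"

definition stern_step :: "(real \<Rightarrow> real \<Rightarrow> real) \<Rightarrow> real \<Rightarrow> real \<Rightarrow> real" where
  "stern_step f a b = (f a (a + b) + f (a + b) b) / 2"

lemma stern_avg_0: "stern_avg f 0 = f 1 1"
proof -
  have "{2 ^ 0..<2 ^ (0 + 1)} = {1::nat}" by auto
  moreover have "stern 2 = 1" using stern_rec(3)[of 1] stern_rec(2) by simp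
  ultimately show ?thesis using stern_rec(2) by (simp add: stern_avg_def numeral_2_eq_2)
qed

lemma sum_double_interval:
  fixes g :: "nat \<Rightarrow> 'a :: comm_monoid_add"
  assumes "p \<le> q" shows "(\<Sum>n\<in>{2 * p..<2 * q}. g n) = (\<Sum>m\<in>{p..<q}. g (2 * m) + g (2 * m + 1))"
  using assms
proof (induction q rule: dec_induct)
  case (step q)
  have "{2 * p..<2 * Suc q} = insert (2 * q) (insert (2 * q + 1) {2 * p..<2 * q})" using step by auto
  then show ?case using step by (simp add: add.assoc add.commute add.left_commute)
qed simp

lemma stern_avg_Suc: "stern_avg f (Suc N) = stern_avg (stern_step f) N"
proof -
  let ?g = "\<lambda>n. f (real (stern n)) (real (stern (n + 1)))"
  have "(\<Sum>n\<in>{2 ^ Suc N..<2 ^ (Suc N + 1)}. ?g n) = (\<Sum>n\<in>{2 * 2 ^ N..<2 * 2 ^ (N + 1)}. ?g n)" by simp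
  also have "\<dots> = (\<Sum>m\<in>{2 ^ N..<2 ^ (N + 1)}. ?g (2 * m) + ?g (2 * m + 1))"
    by (rule sum_double_interval) simp
  also have "\<dots> = (\<Sum>m\<in>{2 ^ N..<2 ^ (N + 1)}. 2 * stern_step f (real (stern m)) (real (stern (m + 1))))"
  proof (rule sum.cong)
    fix m :: nat assume "m \<in> {2 ^ N..<2 ^ (N + 1)}"
    moreover have "(1::nat) \<le> 2 ^ N" by simp
    ultimately have "m \<ge> 1" by auto
    then have "stern (2 * m) = stern m" "stern (2 * m + 1) = stern m + stern (m + 1)"
      "stern (2 * m + 1 + 1) = stern (m + 1)"
      using stern_rec(3)[of m] stern_rec(4)[of m] stern_rec(3)[of "m + 1"] by simp_all
    then show "?g (2 * m) + ?g (2 * m + 1) = 2 * stern_step f (real (stern m)) (real (stern (m + 1)))"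
      by (simp add: stern_step_def)
  qed simp
  finally show ?thesis
    by (simp add: stern_avg_def flip: sum_distrib_left)
qed

lemma stern_avg_mono_ge_1:
  assumes "\<And>a b. a \<ge> 1 \<Longrightarrow> b \<ge> 1 \<Longrightarrow> f a b \<le> g a b"
  shows "stern_avg f N \<le> stern_avg g N"
  unfolding stern_avg_def
proof (intro divide_right_mono sum_mono)
  fix m :: nat assume "m \<in> {2 ^ N..<2 ^ (N + 1)}"
  moreover have "(1::nat) \<le> 2 ^ N" by simp
  ultimately have "m \<ge> 1" by auto
  then show "f (real (stern m)) (real (stern (m + 1))) \<le> g (real (stern m)) (real (stern (m + 1)))"
    using stern_pos[of m] stern_pos[of "m + 1"] by (intro assms) linarith+
qed simp

lemma stern_avg_mono:
  assumes "\<And>a b. a > 0 \<Longrightarrow> b > 0 \<Longrightarrow> f a b \<le> g a b"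
  shows "stern_avg f N \<le> stern_avg g N"
  using assms by (intro stern_avg_mono_ge_1) simp

lemma stern_avg_cong:
  assumes "\<And>a b. a > 0 \<Longrightarrow> b > 0 \<Longrightarrow> f a b = g a b"
  shows "stern_avg f N = stern_avg g N"
  using assms by (intro antisym stern_avg_mono) auto

lemma stern_avg_const [simp]: "stern_avg (\<lambda>_ _. c) N = c"
  by (simp add: stern_avg_def)

lemma stern_avg_add: "stern_avg (\<lambda>a b. f a b + g a b) N = stern_avg f N + stern_avg g N"
  by (simp add: stern_avg_def sum.distrib add_divide_distrib)

lemma stern_avg_diff: "stern_avg (\<lambda>a b. f a b - g a b) N = stern_avg f N - stern_avg g N"
  by (simp add: stern_avg_def sum_subtractf diff_divide_distrib)

lemma stern_avg_cmult: "stern_avg (\<lambda>a b. c * f a b) N = c * stern_avg f N"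
  by (simp add: stern_avg_def sum_distrib_left)

lemma stern_avg_nonneg: "(\<And>a b. a > 0 \<Longrightarrow> b > 0 \<Longrightarrow> 0 \<le> f a b) \<Longrightarrow> 0 \<le> stern_avg f N"
  using stern_avg_mono[of "\<lambda>_ _. 0" f N] by simp

lemma abs_stern_avg_le:
  assumes "\<And>a b. a > 0 \<Longrightarrow> b > 0 \<Longrightarrow> \<bar>f a b\<bar> \<le> g a b"
  shows "\<bar>stern_avg f N\<bar> \<le> stern_avg g N"
proof -
  have "stern_avg f N \<le> stern_avg g N" "stern_avg (\<lambda>a b. - 1 * f a b) N \<le> stern_avg g N"
    using assms by (intro stern_avg_mono; fastforce)+
  then show ?thesis unfolding stern_avg_cmult by linarith
qed

lemma stern_avg_log_potential:
  "stern_avg log_potential N = log_potential 1 1 + farey_drift * real N"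
proof (induction N)
  case (Suc N)
  have "stern_avg log_potential (Suc N) = stern_avg (\<lambda>a b. log_potential a b + farey_drift) N"
    unfolding stern_avg_Suc
    by (rule stern_avg_cong) (simp add: stern_step_def log_potential_left log_potential_right)
  then show ?case using Suc by (simp add: stern_avg_add algebra_simps)
qed (simp add: stern_avg_0)

text \<open>One step gives \<open>3 / 2 + (a / b + b / a) / 2\<close>, whose fixed point is 3, and
  the root value 2 lies below it. This controls, on average, the pairs with very unequal
  entries.\<close>

lemma stern_avg_ratio_le: "stern_avg (\<lambda>a b. a / b + b / a) N \<le> 3"
proof (induction N)
  case (Suc N)
  have "stern_avg (\<lambda>a b. a / b + b / a) (Suc N) = stern_avg (\<lambda>a b. 3 / 2 + 1 / 2 * (a / b + b / a)) N"
    unfolding stern_avg_Suc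
  proof (rule stern_avg_cong)
    fix a b :: real assume "a > 0" "b > 0"
    then have "a / (a + b) + b / (a + b) = 1" "(a + b) / a = 1 + b / a" "(a + b) / b = a / b + 1"
      by (simp_all add: add_divide_distrib flip: add_divide_distrib[of a b "a + b"])
    then show "stern_step (\<lambda>a b. a / b + b / a) a b = 3 / 2 + 1 / 2 * (a / b + b / a)"
      unfolding stern_step_def by argo
  qed
  then show ?case using Suc unfolding stern_avg_add stern_avg_cmult stern_avg_const by argo
qed (simp add: stern_avg_0)

text \<open>Normalised to vanish at the root \<open>(1, 1)\<close> for \<open>N = 0\<close>, so that
  its second moment is exactly the sum of those of the increments.\<close>

definition centred_potential :: "nat \<Rightarrow> real \<Rightarrow> real \<Rightarrow> real" where
  "centred_potential N a b = log_potential a b - log_potential 1 1 - farey_drift * real N"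

lemma
  assumes "a > 0" "b > 0"
  shows centred_potential_left: "centred_potential (Suc N) a (a + b) = centred_potential N a b + log_increment a b"
    and centred_potential_right: "centred_potential (Suc N) (a + b) b = centred_potential N a b - log_increment a b"
  using log_potential_left[of a b] log_potential_right[of a b] assms
  by (simp_all add: centred_potential_def algebra_simps)

text \<open>The corrections at the two children are opposite, so the cross terms cancel.\<close>

lemma stern_avg_centred_square_Suc:
  "stern_avg (\<lambda>a b. (centred_potential (Suc N) a b)\<^sup>2) (Suc N) =
   stern_avg (\<lambda>a b. (centred_potential N a b)\<^sup>2) N + stern_avg (\<lambda>a b. (log_increment a b)\<^sup>2) N"
  unfolding stern_avg_Suc stern_avg_add[symmetric]
  by (rule stern_avg_cong)
    (simp add: stern_step_def centred_potential_left centred_potential_right power2_eq_square algebra_simps)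

lemma stern_avg_increment_square_le: "stern_avg (\<lambda>a b. (log_increment a b)\<^sup>2) N \<le> log_defect\<^sup>2"
proof -
  have "stern_avg (\<lambda>a b. (log_increment a b)\<^sup>2) N \<le> stern_avg (\<lambda>_ _. log_defect\<^sup>2) N"
  proof (rule stern_avg_mono)
    fix a b :: real assume "a > 0" "b > 0"
    then show "(log_increment a b)\<^sup>2 \<le> log_defect\<^sup>2"
      using abs_log_increment_le[of a b] by (intro abs_le_square_iff[THEN iffD1]) simp
  qed
  then show ?thesis by simp
qed

lemma stern_avg_centred_square:
  "stern_avg (\<lambda>a b. (centred_potential N a b)\<^sup>2) N = (\<Sum>i<N. stern_avg (\<lambda>a b. (log_increment a b)\<^sup>2) i)"
  by (induction N) (simp_all add: stern_avg_0 centred_potential_def[of 0] stern_avg_centred_square_Suc)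

lemma stern_avg_centred_square_le:
  "stern_avg (\<lambda>a b. (centred_potential N a b)\<^sup>2) N \<le> log_defect\<^sup>2 * real N"
  using sum_mono[of "{..<N}" "stern_avg (\<lambda>a b. (log_increment a b)\<^sup>2)" "\<lambda>_. log_defect\<^sup>2"]
    stern_avg_increment_square_le
  by (simp add: stern_avg_centred_square mult.commute)

lemma stern_avg_centred_fourth_le:
  "stern_avg (\<lambda>a b. (centred_potential N a b) ^ 4) N \<le> 3 * log_defect ^ 4 * (real N)\<^sup>2"
proof (induction N)
  case 0
  then show ?case by (simp add: stern_avg_0 centred_potential_def)
next
  case (Suc N)
  let ?Z = "centred_potential N" and ?C = log_defect
  have "stern_avg (\<lambda>a b. (centred_potential (Suc N) a b) ^ 4) (Suc N)
      \<le> stern_avg (\<lambda>a b. (?Z a b) ^ 4 + 6 * ?C\<^sup>2 * (?Z a b)\<^sup>2 + ?C ^ 4) N"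
    unfolding stern_avg_Suc
  proof (rule stern_avg_mono)
    fix a b :: real assume ab: "a > 0" "b > 0"
    define z d where "z = ?Z a b" and "d = log_increment a b"
    have d: "\<bar>d\<bar> \<le> ?C" using abs_log_increment_le[of a b] ab by (simp add: d_def)
    then have d2: "d\<^sup>2 \<le> ?C\<^sup>2" by (intro abs_le_square_iff[THEN iffD1]) simp
    then have d4: "d ^ 4 \<le> ?C ^ 4" using power_mono[of "d\<^sup>2" "?C\<^sup>2" 2] by simp
    have "stern_step (\<lambda>a b. (centred_potential (Suc N) a b) ^ 4) a b = ((z + d) ^ 4 + (z - d) ^ 4) / 2"
      using ab by (simp add: stern_step_def centred_potential_left centred_potential_right z_def d_def)
    also have "\<dots> = z ^ 4 + 6 * d\<^sup>2 * z\<^sup>2 + d ^ 4"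
      by (simp add: power4_eq_xxxx power2_eq_square algebra_simps)
    also have "\<dots> \<le> z ^ 4 + 6 * ?C\<^sup>2 * z\<^sup>2 + ?C ^ 4"
      using d2 d4 by (intro add_mono mult_right_mono mult_left_mono) auto
    finally show "stern_step (\<lambda>a b. (centred_potential (Suc N) a b) ^ 4) a b
      \<le> (?Z a b) ^ 4 + 6 * ?C\<^sup>2 * (?Z a b)\<^sup>2 + ?C ^ 4" by (simp add: z_def)
  qed
  also have "\<dots> = stern_avg (\<lambda>a b. (?Z a b) ^ 4) N + 6 * ?C\<^sup>2 * stern_avg (\<lambda>a b. (?Z a b)\<^sup>2) N + ?C ^ 4"
    unfolding stern_avg_add stern_avg_cmult by simp
  \<comment> \<open>The last \<open>?C ^ 4\<close> is enlarged to \<open>3 * ?C ^ 4\<close>, which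
    completes the square in \<open>N + 1\<close>.\<close>
  also have "\<dots> \<le> 3 * ?C ^ 4 * (real N)\<^sup>2 + 6 * ?C\<^sup>2 * (?C\<^sup>2 * real N) + 3 * ?C ^ 4"
    using stern_avg_centred_square_le by (intro add_mono Suc mult_left_mono) auto
  also have "\<dots> = 3 * ?C ^ 4 * (real (Suc N))\<^sup>2"
    by (simp add: power4_eq_xxxx power2_eq_square algebra_simps)
  finally show ?case .
qed

text \<open>If a pair has ratio \<open>r = min a b / max a b\<close>, its children have ratios
  \<open>r / (1 + r)\<close> and \<open>1 / (1 + r)\<close> in some order: the two Farey branches.
  The root has ratio 1.\<close>

lemma stern_avg_ratio_function:
  "stern_avg (\<lambda>a b. \<phi> (min a b / max a b)) N = (farey_transfer ^^ N) \<phi> 1"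
proof (induction N arbitrary: \<phi>)
  case (Suc N)
  have "stern_avg (\<lambda>a b. \<phi> (min a b / max a b)) (Suc N)
      = stern_avg (\<lambda>a b. farey_transfer \<phi> (min a b / max a b)) N"
    unfolding stern_avg_Suc
  proof (rule stern_avg_cong)
    fix a b :: real assume ab: "a > 0" "b > 0"
    have *: "\<phi> (min a b / (a + b)) + \<phi> (max a b / (a + b)) = 2 * farey_transfer \<phi> (min a b / max a b)"
      (is "\<phi> ?m + \<phi> ?M = _")
    proof -
      have "c / (c + d) = c / d / (1 + c / d)" "d / (c + d) = 1 / (1 + c / d)" if "c > 0" "d > 0" for c d :: real
        using that by (simp_all add: field_simps)
      note split = this
      have "min a b > 0" "max a b > 0" and sum: "min a b + max a b = a + b"
        using ab by (simp_all add: min_def max_def)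
      show ?thesis
        unfolding farey_transfer_def split[OF \<open>min a b > 0\<close> \<open>max a b > 0\<close>, unfolded sum] by simp
    qed
    have "min a (a + b) = a" "max a (a + b) = a + b" "min (a + b) b = b" "max (a + b) b = a + b"
      using ab by (simp_all add: min_def max_def)
    then show "stern_step (\<lambda>a b. \<phi> (min a b / max a b)) a b = farey_transfer \<phi> (min a b / max a b)"
      using * by (cases "a \<le> b") (simp_all add: stern_step_def)
  qed
  then show ?case by (simp add: Suc funpow_swap1)
qed (simp add: stern_avg_0)

text \<open>Homogeneity leaves only the ratio; exchanging \<open>a\<close> and \<open>b\<close>
  changes the sign, which the square removes.\<close>

lemma log_increment_square_ratio:
  assumes "a > 0" "b > 0"
  shows "(log_increment a b)\<^sup>2 = (log_increment 1 (min a b / max a b))\<^sup>2"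
proof -
  have *: "log_increment 1 (d / c) = log_increment c d" if "c > 0" "d > 0" for c d
    using log_increment_scale[of 1 "d / c" c] that by (simp add: add_pos_pos)
  show ?thesis
    using *[of a b] *[of b a] assms log_increment_swap[of a b] by (simp add: min_def max_def)
qed

definition increment_variance :: real where
  "increment_variance = (LINT x|minkowski_measure. (log_increment 1 x)\<^sup>2)"

lemma stern_avg_increment_square_LIMSEQ:
  "stern_avg (\<lambda>a b. (log_increment a b)\<^sup>2) \<longlonglongrightarrow> increment_variance"
proof -
  have eq: "stern_avg (\<lambda>a b. (log_increment a b)\<^sup>2) = (\<lambda>N. (farey_transfer ^^ N) (\<lambda>x. (log_increment 1 x)\<^sup>2) 1)"
    unfolding stern_avg_ratio_function[symmetric]
    by (intro ext stern_avg_cong) (rule log_increment_square_ratio)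
  show ?thesis
    unfolding eq increment_variance_def
    by (rule farey_transfer_LIMSEQ) (auto intro!: continuous_intros continuous_on_log_increment)
qed

lemma LIMSEQ_arithmetic_mean:
  fixes e :: "nat \<Rightarrow> real"
  assumes "e \<longlonglongrightarrow> l" shows "(\<lambda>N. (\<Sum>i<N. e i) / real N) \<longlonglongrightarrow> l"
proof (rule LIMSEQ_I)
  fix r :: real assume r: "r > 0"
  obtain K where K: "\<And>n. n \<ge> K \<Longrightarrow> \<bar>e n - l\<bar> < r / 2"
    using LIMSEQ_D[OF assms, of "r / 2"] r by auto
  define B where "B = (\<Sum>i<K. \<bar>e i - l\<bar>)"
  obtain M where M: "real M > 2 * B / r" using reals_Archimedean2 by blast
  show "\<exists>N0. \<forall>N\<ge>N0. norm ((\<Sum>i<N. e i) / real N - l) < r"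
  proof (intro exI allI impI)
    fix N assume N: "N \<ge> Suc (max K M)"
    have "(\<Sum>i<N. e i) / real N - l = (\<Sum>i<N. e i - l) / real N"
      using N by (simp add: sum_subtractf field_simps)
    also have "\<bar>\<dots>\<bar> \<le> (\<Sum>i<N. \<bar>e i - l\<bar>) / real N"
      by (simp add: abs_divide divide_right_mono sum_abs)
    also have "(\<Sum>i<N. \<bar>e i - l\<bar>) = B + (\<Sum>i\<in>{K..<N}. \<bar>e i - l\<bar>)"
      using N unfolding B_def lessThan_atLeast0 by (subst sum.atLeastLessThan_concat) auto
    also have "(\<Sum>i\<in>{K..<N}. \<bar>e i - l\<bar>) \<le> (\<Sum>i\<in>{K..<N}. r / 2)"
      using K by (intro sum_mono) (auto intro: less_imp_le)
    also have "\<dots> \<le> r / 2 * real N" using r by (simp add: mult.commute mult_right_mono)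
    also have "(B + r / 2 * real N) / real N < r"
    proof -
      have "real M * r > 2 * B" using M r by (simp add: field_simps)
      moreover have "real M * r \<le> real N * r" using N r by (intro mult_right_mono) auto
      ultimately have "2 * B < real N * r" by linarith
      then show ?thesis using N r by (simp add: field_simps)
    qed
    finally show "norm ((\<Sum>i<N. e i) / real N - l) < r" using N by (simp add: divide_right_mono)
  qed
qed

lemma stern_avg_centred_square_LIMSEQ:
  "(\<lambda>N. stern_avg (\<lambda>a b. (centred_potential N a b)\<^sup>2) N / real N) \<longlonglongrightarrow> increment_variance"
  unfolding stern_avg_centred_square by (rule LIMSEQ_arithmetic_mean[OF stern_avg_increment_square_LIMSEQ])

text \<open>\<open>ln (1 + b / a)\<close> is twice the logarithm of a square root, so its square
  costs only the first power of the ratio, the power whose average is bounded.\<close>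

lemma log_potential_defect_square_le:
  assumes "a > 0" "b > 0"
  shows "(ln a - log_potential a b)\<^sup>2 \<le> 8 + 8 * (a / b + b / a) + 2 * log_defect\<^sup>2"
proof -
  have ln: "ln (a + b) - ln a = ln (1 + b / a)"
  proof -
    have "1 + b / a = (a + b) / a" using assms by (simp add: add_divide_distrib)
    then show ?thesis using assms by (simp add: ln_div)
  qed
  have s: "1 + b / a > 0" using assms by (simp add: add_pos_pos)
  have "ln (1 + b / a) = 2 * ln (sqrt (1 + b / a))" using s by (simp add: ln_sqrt)
  also have "\<dots> \<le> 2 * sqrt (1 + b / a)" using s ln_bound[of "sqrt (1 + b / a)"] by simp
  finally have "(ln (1 + b / a))\<^sup>2 \<le> (2 * sqrt (1 + b / a))\<^sup>2"
    using assms by (intro power_mono) auto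
  then have 1: "(ln a - ln (a + b))\<^sup>2 \<le> 4 * (1 + b / a)"
    using ln s power2_commute[of "ln a" "ln (a + b)"] by (simp add: power_mult_distrib)
  have 2: "(ln (a + b) - log_potential a b)\<^sup>2 \<le> log_defect\<^sup>2"
    using abs_log_potential_le[of a b] assms
    by (intro abs_le_square_iff[THEN iffD1]) (simp add: abs_minus_commute)
  have "(x + y)\<^sup>2 \<le> 2 * x\<^sup>2 + 2 * y\<^sup>2" for x y :: real
    using zero_le_power2[of "x - y"] by (simp add: power2_eq_square algebra_simps)
  from this[of "ln a - ln (a + b)" "ln (a + b) - log_potential a b"]
  have "(ln a - log_potential a b)\<^sup>2 \<le> 2 * (ln a - ln (a + b))\<^sup>2 + 2 * (ln (a + b) - log_potential a b)\<^sup>2" by simp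
  also have "\<dots> \<le> 2 * (4 * (1 + b / a)) + 2 * log_defect\<^sup>2"
    using 1 2 by (intro add_mono mult_left_mono) auto
  also have "\<dots> \<le> 8 + 8 * (a / b + b / a) + 2 * log_defect\<^sup>2"
    using assms by (simp add: distrib_left)
  finally show ?thesis .
qed

lemma stern_avg_potential_defect_le:
  "stern_avg (\<lambda>a b. (ln a - log_potential a b)\<^sup>2) N \<le> 32 + 2 * log_defect\<^sup>2"
proof -
  have "stern_avg (\<lambda>a b. (ln a - log_potential a b)\<^sup>2) N
      \<le> stern_avg (\<lambda>a b. 8 + 8 * (a / b + b / a) + 2 * log_defect\<^sup>2) N"
    by (rule stern_avg_mono) (rule log_potential_defect_square_le)
  also have "\<dots> = 8 + 8 * stern_avg (\<lambda>a b. a / b + b / a) N + 2 * log_defect\<^sup>2"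
    unfolding stern_avg_add stern_avg_cmult stern_avg_const ..
  \<comment> \<open>With mean ratio at most 3 the constant becomes
    \<open>8 + 8 * 3 = 32\<close>.\<close>
  finally show ?thesis using stern_avg_ratio_le[of N] by linarith
qed

section \<open>Mean and variance of the logarithm of the Stern sequence\<close>

lemma expectation_stern_index:
  "measure_pmf.expectation (stern_index N) (\<lambda>n. h n) = (\<Sum>n\<in>{2 ^ N..<2 ^ (N + 1)}. h n) / (2 ^ N :: real)"
  unfolding stern_index_def by (subst integral_pmf_of_set) auto

lemma log_stern_mean_eq: "log_stern_mean N = stern_avg (\<lambda>a b. ln a) N"
  unfolding log_stern_mean_def expectation_stern_index stern_avg_def ..

lemma log_stern_var_eq: "log_stern_var N = stern_avg (\<lambda>a b. (ln a - log_stern_mean N)\<^sup>2) N"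
  unfolding log_stern_var_def log_stern_mean_def[symmetric] expectation_stern_index stern_avg_def ..

lemma log_stern_mean_bound:
  "\<bar>log_stern_mean N - (log_potential 1 1 + farey_drift * real N)\<bar> \<le> 33 + 2 * log_defect\<^sup>2"
proof -
  have "log_stern_mean N - (log_potential 1 1 + farey_drift * real N) = stern_avg (\<lambda>a b. ln a - log_potential a b) N"
    unfolding log_stern_mean_eq stern_avg_diff stern_avg_log_potential ..
  also have "\<bar>\<dots>\<bar> \<le> stern_avg (\<lambda>a b. 1 + (ln a - log_potential a b)\<^sup>2) N"
  proof (rule abs_stern_avg_le)
    fix a b :: real
    \<comment> \<open>Trades the first moment for the second, for which a bound is available; this
      adds the 1 in 33.\<close>
    have "\<bar>x\<bar> \<le> 1 + x\<^sup>2" for x :: real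
      using zero_le_power2[of "\<bar>x\<bar> - 1"] by (simp add: power2_eq_square algebra_simps)
    then show "\<bar>ln a - log_potential a b\<bar> \<le> 1 + (ln a - log_potential a b)\<^sup>2" .
  qed
  also have "\<dots> = 1 + stern_avg (\<lambda>a b. (ln a - log_potential a b)\<^sup>2) N"
    by (simp add: stern_avg_add)
  finally show ?thesis using stern_avg_potential_defect_le[of N] by linarith
qed

lemma log_stern_mean_LIMSEQ: "(\<lambda>N. log_stern_mean N / real N) \<longlonglongrightarrow> farey_drift"
proof -
  let ?B = "33 + 2 * log_defect\<^sup>2 + \<bar>log_potential 1 1\<bar>"
  have "(\<lambda>N. log_stern_mean N / real N - farey_drift) \<longlonglongrightarrow> 0"
  proof (rule Lim_null_comparison)
    show "(\<lambda>N. ?B / real N) \<longlonglongrightarrow> 0" by (rule lim_const_over_n)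
    show "\<forall>\<^sub>F N in sequentially. norm (log_stern_mean N / real N - farey_drift) \<le> ?B / real N"
    proof (rule eventually_mono[OF eventually_gt_at_top[of 0]])
      fix N :: nat assume "N > 0"
      then have "log_stern_mean N / real N - farey_drift = (log_stern_mean N - farey_drift * real N) / real N"
        by (simp add: field_simps)
      moreover have "\<bar>log_stern_mean N - farey_drift * real N\<bar> \<le> ?B"
        using log_stern_mean_bound[of N] by linarith
      ultimately show "norm (log_stern_mean N / real N - farey_drift) \<le> ?B / real N"
        by (simp add: abs_divide divide_right_mono)
    qed
  qed
  then show ?thesis by (simp add: LIM_zero_iff)
qed

text \<open>\<open>ln a - farey_drift * N\<close> is the centred potential plus a remainder bounded
  in mean square. The cross term is split by
  \<open>2 * \<bar>y * z\<bar> \<le> y\<^sup>2 / q + q * z\<^sup>2\<close> with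
  \<open>q = sqrt N\<close>, which balances a second moment of order \<open>N\<close> against a
  bounded one.\<close>

lemma log_stern_var_bound:
  assumes "N > 0"
  shows "\<bar>log_stern_var N - stern_avg (\<lambda>a b. (centred_potential N a b)\<^sup>2) N\<bar>
    \<le> log_defect\<^sup>2 * sqrt N + (64 + 4 * log_defect\<^sup>2 + 2 * (log_potential 1 1)\<^sup>2) * (1 + sqrt N)
      + (33 + 2 * log_defect\<^sup>2 + \<bar>log_potential 1 1\<bar>)\<^sup>2"
    (is "\<bar>_ - ?V\<bar> \<le> ?c * sqrt N + ?C * (1 + sqrt N) + ?M\<^sup>2")
proof -
  define m where "m = log_stern_mean N - farey_drift * real N"
  define Y where "Y = centred_potential N"
  define B where "B a b = ln a - log_potential a b + log_potential 1 1" for a b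
  define q where "q = sqrt N"
  have q: "q > 0" "q * q = N" using assms by (simp_all add: q_def)
  have YB: "ln a - farey_drift * real N = Y a b + B a b" for a b
    by (simp add: Y_def B_def centred_potential_def)
  have mean: "stern_avg (\<lambda>a b. Y a b + B a b) N = m"
    unfolding YB[symmetric] m_def log_stern_mean_eq stern_avg_diff stern_avg_const ..
  have "log_stern_var N = stern_avg (\<lambda>a b. (Y a b + B a b)\<^sup>2 - (2 * m) * (Y a b + B a b) + m\<^sup>2) N"
    unfolding log_stern_var_eq
  proof (rule stern_avg_cong)
    fix a b :: real
    have "ln a - log_stern_mean N = (Y a b + B a b) - m" unfolding YB[symmetric] m_def by simp
    then show "(ln a - log_stern_mean N)\<^sup>2 = (Y a b + B a b)\<^sup>2 - (2 * m) * (Y a b + B a b) + m\<^sup>2"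
      by (simp add: power2_diff)
  qed
  also have "\<dots> = stern_avg (\<lambda>a b. (Y a b + B a b)\<^sup>2) N - m\<^sup>2"
    unfolding stern_avg_add stern_avg_diff stern_avg_cmult stern_avg_const mean[unfolded stern_avg_add]
    by (simp add: power2_eq_square)
  finally have var: "log_stern_var N - ?V = stern_avg (\<lambda>a b. (Y a b + B a b)\<^sup>2 - (Y a b)\<^sup>2) N - m\<^sup>2"
    unfolding stern_avg_diff by (simp add: Y_def)
  have "\<bar>stern_avg (\<lambda>a b. (Y a b + B a b)\<^sup>2 - (Y a b)\<^sup>2) N\<bar>
      \<le> stern_avg (\<lambda>a b. 1 / q * (Y a b)\<^sup>2 + (1 + q) * (B a b)\<^sup>2) N"
  proof (rule abs_stern_avg_le)
    fix a b :: real
    define y z where "y = Y a b" and "z = B a b"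
    have "2 * \<bar>y * z\<bar> \<le> 1 / q * y\<^sup>2 + q * z\<^sup>2"
    proof -
      have "0 \<le> (\<bar>y\<bar> - q * \<bar>z\<bar>)\<^sup>2 / q" using q by simp
      also have "\<dots> = 1 / q * y\<^sup>2 + q * z\<^sup>2 - 2 * \<bar>y * z\<bar>"
        using q by (simp add: power2_eq_square abs_mult field_simps)
      finally show ?thesis by simp
    qed
    moreover have "(y + z)\<^sup>2 - y\<^sup>2 = 2 * (y * z) + z\<^sup>2" by (simp add: power2_sum)
    moreover have "\<bar>2 * (y * z) + z\<^sup>2\<bar> \<le> 2 * \<bar>y * z\<bar> + z\<^sup>2"
      using abs_triangle_ineq[of "2 * (y * z)" "z\<^sup>2"] by (simp add: abs_mult)
    ultimately show "\<bar>(Y a b + B a b)\<^sup>2 - (Y a b)\<^sup>2\<bar> \<le> 1 / q * (Y a b)\<^sup>2 + (1 + q) * (B a b)\<^sup>2"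
      unfolding y_def[symmetric] z_def[symmetric] by (simp add: distrib_right)
  qed
  also have "\<dots> = 1 / q * ?V + (1 + q) * stern_avg (\<lambda>a b. (B a b)\<^sup>2) N"
    unfolding stern_avg_add stern_avg_cmult Y_def ..
  also have "1 / q * ?V \<le> 1 / q * (?c * (q * q))"
    unfolding q(2) using q(1) stern_avg_centred_square_le by (intro mult_left_mono) auto
  also have "1 / q * (?c * (q * q)) = ?c * q" using q(1) by simp
  also have "stern_avg (\<lambda>a b. (B a b)\<^sup>2) N \<le> ?C"
  proof -
    have "stern_avg (\<lambda>a b. (B a b)\<^sup>2) N \<le> stern_avg (\<lambda>a b. 2 * (ln a - log_potential a b)\<^sup>2 + 2 * (log_potential 1 1)\<^sup>2) N"
    proof (rule stern_avg_mono)
      fix a b :: real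
      have "(x + y)\<^sup>2 \<le> 2 * x\<^sup>2 + 2 * y\<^sup>2" for x y :: real
        using zero_le_power2[of "x - y"] by (simp add: power2_eq_square algebra_simps)
      then show "(B a b)\<^sup>2 \<le> 2 * (ln a - log_potential a b)\<^sup>2 + 2 * (log_potential 1 1)\<^sup>2"
        unfolding B_def .
    qed
    also have "\<dots> = 2 * stern_avg (\<lambda>a b. (ln a - log_potential a b)\<^sup>2) N + 2 * (log_potential 1 1)\<^sup>2"
      unfolding stern_avg_add stern_avg_cmult stern_avg_const ..
    finally show ?thesis using stern_avg_potential_defect_le[of N] by linarith
  qed
  finally have 1: "\<bar>stern_avg (\<lambda>a b. (Y a b + B a b)\<^sup>2 - (Y a b)\<^sup>2) N\<bar> \<le> ?c * q + ?C * (1 + q)"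
    using q(1) by (simp add: mult.commute mult_left_mono)
  have "\<bar>m\<bar> \<le> \<bar>?M\<bar>" using log_stern_mean_bound[of N] by (simp add: m_def)
  then have "m\<^sup>2 \<le> ?M\<^sup>2" by (simp only: abs_le_square_iff)
  with 1 show ?thesis unfolding var q_def[symmetric] using zero_le_power2[of m] by linarith
qed

lemma log_stern_var_LIMSEQ: "(\<lambda>N. log_stern_var N / real N) \<longlonglongrightarrow> increment_variance"
proof -
  let ?V = "\<lambda>N. stern_avg (\<lambda>a b. (centred_potential N a b)\<^sup>2) N"
  obtain c C M :: real where bound: "\<And>N. N > 0 \<Longrightarrow> \<bar>log_stern_var N - ?V N\<bar> \<le> c * sqrt N + C * (1 + sqrt N) + M"
    using log_stern_var_bound by blast
  have "(\<lambda>N. log_stern_var N / real N - ?V N / real N) \<longlonglongrightarrow> 0"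
  proof (rule Lim_null_comparison)
    show "(\<lambda>N. (c * sqrt N + C * (1 + sqrt N) + M) / real N) \<longlonglongrightarrow> 0"
      by real_asymp
    show "\<forall>\<^sub>F N in sequentially. norm (log_stern_var N / real N - ?V N / real N) \<le> (c * sqrt N + C * (1 + sqrt N) + M) / real N"
      by (rule eventually_mono[OF eventually_gt_at_top[of 0]])
        (use bound in \<open>auto simp: abs_divide divide_right_mono simp flip: diff_divide_distrib\<close>)
  qed
  from tendsto_add[OF this stern_avg_centred_square_LIMSEQ] show ?thesis by simp
qed

lemma LIMSEQ_of_linear_bigo:
  fixes x :: "nat \<Rightarrow> real"
  assumes "(\<lambda>N. x N - c * real N) \<in> O(\<lambda>_. 1)" shows "(\<lambda>N. x N / real N) \<longlonglongrightarrow> c"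
proof -
  obtain B where B: "\<forall>\<^sub>F N in sequentially. norm (x N - c * real N) \<le> B * norm (1::real)"
    using landau_o.bigE[OF assms] by blast
  have "(\<lambda>N. x N / real N - c) \<longlonglongrightarrow> 0"
  proof (rule Lim_null_comparison)
    show "(\<lambda>N. B / real N) \<longlonglongrightarrow> 0" by (rule lim_const_over_n)
    show "\<forall>\<^sub>F N in sequentially. norm (x N / real N - c) \<le> B / real N"
      using B eventually_gt_at_top[of 0]
    proof eventually_elim
      case (elim N)
      have "x N / real N - c = (x N - c * real N) / real N" using elim by (simp add: field_simps)
      then show ?case using elim by (simp add: abs_divide divide_right_mono)
    qed
  qed
  then show ?thesis by (simp add: LIM_zero_iff)
qed

lemma mean_constant_eq_farey_drift:
  "(\<lambda>N. log_stern_mean N - \<alpha> * real N) \<in> O(\<lambda>_. 1) \<Longrightarrow> \<alpha> = farey_drift"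
  using LIMSEQ_unique[OF LIMSEQ_of_linear_bigo log_stern_mean_LIMSEQ] .

lemma variance_constant_eq_increment_variance:
  "(\<lambda>N. log_stern_var N - s * real N) \<in> O(\<lambda>_. 1) \<Longrightarrow> s = increment_variance"
  using LIMSEQ_unique[OF LIMSEQ_of_linear_bigo log_stern_var_LIMSEQ] .

section \<open>Integral formulas\<close>

lemma farey_drift_eq: "farey_drift = (LINT x|minkowski_measure. ln (1 + x))"
  by (simp add: farey_drift_def log_int_def)

text \<open>The bracket of the variance formula. For irrational \<open>x\<close> in the unit
  interval, adding \<open>log_increment 1 x\<close> gives the sum of \<open>log_increment 1\<close>
  over the Farey orbit of \<open>x\<close>, from its first image until the orbit enters
  \<open>(1/2, 1)\<close>: the run of steps that uses up the first continued fraction digit down to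
  1.\<close>

definition run_increment :: "real \<Rightarrow> real" where
  "run_increment x = ln x + farey_drift * of_int \<lfloor>1 / x\<rfloor> + (log_int 1 (frac (1 / x)) - log_int 1 x)"

lemma borel_measurable_run_increment [measurable]: "run_increment \<in> borel_measurable borel"
  unfolding run_increment_def frac_def by measurable

text \<open>The branch \<open>x / (1 + x)\<close> lengthens the run by one term; after
  \<open>1 / (1 + x)\<close> the run is empty. In the first case the floor grows by 1, in the second
  it equals 1, and the resulting \<open>farey_drift\<close> cancels the one in
  \<open>log_int_split\<close>.\<close>

lemma
  assumes "0 < x" "x < 1"
  shows run_increment_branch_0: "run_increment (x / (1 + x)) + log_increment 1 (x / (1 + x))
      = run_increment x + 2 * log_increment 1 x"
    and run_increment_branch_1: "run_increment (1 / (1 + x)) + log_increment 1 (1 / (1 + x)) = 0"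
proof -
  have scale: "log_int 1 (c / (1 + x)) = log_int (1 + x) c - ln (1 + x)"
    "log_int (c / (1 + x)) 1 = log_int c (1 + x) - ln (1 + x)" if "c \<ge> 0" for c
    using log_int_scale[of "1 + x" c "1 / (1 + x)"] log_int_scale[of c "1 + x" "1 / (1 + x)"] that assms
    by (simp_all add: ln_div)
  have split: "log_int 1 x = (log_int 1 (1 + x) + log_int (1 + x) 1) / 2 - farey_drift"
    "log_int x 1 = (log_int x (1 + x) + log_int (1 + x) x) / 2 - farey_drift"
    using log_int_split[of 1 x] log_int_split[of x 1] assms by (simp_all add: add.commute)
  have inv0: "1 / (x / (1 + x)) = 1 / x + 1" using assms by (simp add: field_simps)
  have "\<lfloor>1 / x + 1\<rfloor> = \<lfloor>1 / x\<rfloor> + 1" "frac (1 / x + 1) = frac (1 / x)" by (simp_all add: frac_def)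
  then have "run_increment (x / (1 + x)) = run_increment x - ln (1 + x) + farey_drift
      + log_int 1 x - log_int 1 (x / (1 + x))"
    unfolding run_increment_def inv0 using assms by (simp add: ln_div algebra_simps)
  then show "run_increment (x / (1 + x)) + log_increment 1 (x / (1 + x))
      = run_increment x + 2 * log_increment 1 x"
    using split scale[of x] assms unfolding log_increment_def by (simp add: field_simps)
  have inv1: "1 / (1 / (1 + x)) = 1 + x" using assms by simp
  have "\<lfloor>1 + x\<rfloor> = 1" using assms by (simp add: floor_eq_iff)
  moreover from this have "frac (1 + x) = x" by (simp add: frac_def)
  ultimately have "run_increment (1 / (1 + x)) = - ln (1 + x) + farey_drift + log_int 1 x - log_int 1 (1 / (1 + x))"
    unfolding run_increment_def inv1 using assms by (simp add: ln_div)
  then show "run_increment (1 / (1 + x)) + log_increment 1 (1 / (1 + x)) = 0"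
    using split scale[of 1] assms unfolding log_increment_def by (simp add: field_simps)
qed

text \<open>Only \<open>ln x\<close> and the floor are unbounded near 0, and both are at most
  \<open>1 / x\<close> in absolute value.\<close>

lemma integrable_run_increment_square: "integrable minkowski_measure (\<lambda>x. (run_increment x)\<^sup>2)"
proof (rule Bochner_Integration.integrable_bound)
  define c where "c = 1 + \<bar>farey_drift\<bar> + 2 * (ln 2 + log_defect)"
  show "integrable minkowski_measure (\<lambda>x. c\<^sup>2 * (1 / x\<^sup>2))"
    using integrable_inverse_square_minkowski by (rule integrable_mult_right)
  show "AE x in minkowski_measure. norm ((run_increment x)\<^sup>2) \<le> norm (c\<^sup>2 * (1 / x\<^sup>2))"
  proof (rule AE_minkowskiI)
    fix x :: real assume x: "0 < x" "x < 1"
    have L: "\<bar>log_int 1 r\<bar> \<le> ln 2 + log_defect" if "0 \<le> r" "r \<le> 1" for r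
    proof -
      have "0 \<le> ln (1 + r)" "ln (1 + r) \<le> ln 2" using that by simp_all
      then show ?thesis using abs_log_int_le[of 1 r] that by linarith
    qed
    have ln: "\<bar>ln x\<bar> \<le> 1 / x"
      using x ln_bound[of "1 / x"] by (simp add: ln_div)
    have fl: "\<bar>of_int \<lfloor>1 / x\<rfloor>\<bar> \<le> 1 / x"
    proof -
      have "0 \<le> \<lfloor>1 / x\<rfloor>" using x by simp
      then show ?thesis by (simp del: zero_le_floor)
    qed
    have "frac (1 / x) \<le> 1" by (intro less_imp_le frac_lt_1)
    then have "\<bar>log_int 1 (frac (1 / x))\<bar> \<le> ln 2 + log_defect" "\<bar>log_int 1 x\<bar> \<le> ln 2 + log_defect"
      using L x frac_ge_0[of "1 / x"] by simp_all
    moreover have "\<bar>a - b\<bar> \<le> 2 * c" if "\<bar>a\<bar> \<le> c" "\<bar>b\<bar> \<le> c" for a b c :: real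
      using that by linarith
    ultimately have "\<bar>log_int 1 (frac (1 / x)) - log_int 1 x\<bar> \<le> 2 * (ln 2 + log_defect)"
      by blast
    also have "\<dots> \<le> 2 * (ln 2 + log_defect) * (1 / x)"
    proof -
      have "0 \<le> 2 * (ln 2 + log_defect)" using log_defect_nonneg by simp
      from mult_left_mono[OF _ this, of 1 "1 / x"] show ?thesis using x by simp
    qed
    finally have 1: "\<bar>log_int 1 (frac (1 / x)) - log_int 1 x\<bar> \<le> 2 * (ln 2 + log_defect) * (1 / x)" .
    have "\<bar>farey_drift * of_int \<lfloor>1 / x\<rfloor>\<bar> \<le> \<bar>farey_drift\<bar> * (1 / x)"
      unfolding abs_mult by (intro mult_left_mono fl) simp
    then have "\<bar>run_increment x\<bar> \<le> 1 / x + \<bar>farey_drift\<bar> * (1 / x) + 2 * (ln 2 + log_defect) * (1 / x)"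
      unfolding run_increment_def using ln 1 by (intro order_trans[OF abs_triangle_ineq] add_mono) auto
    also have "\<dots> = c * (1 / x)" unfolding c_def by (simp only: distrib_right mult_1)
    finally have "\<bar>run_increment x\<bar>\<^sup>2 \<le> (c * (1 / x))\<^sup>2" by (intro power_mono) auto
    then show "norm ((run_increment x)\<^sup>2) \<le> norm (c\<^sup>2 * (1 / x\<^sup>2))"
      by (simp add: power_mult_distrib power_divide)
  qed
qed measurable

text \<open>With \<open>W = run_increment + log_increment 1\<close>, self-similarity gives
  \<open>\<integral> W\<^sup>2 = \<onehalf> \<integral> (W + log_increment 1)\<^sup>2\<close>, and the parallelogram law turns this into
  \<open>\<integral> (W - log_increment 1)\<^sup>2 = 2 \<integral> (log_increment 1)\<^sup>2\<close>.\<close>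

lemma integral_run_increment_square:
  "(LINT x|minkowski_measure. (run_increment x)\<^sup>2) = 2 * increment_variance"
proof -
  define D where "D = log_increment 1"
  define W where "W x = run_increment x + D x" for x
  have [measurable]: "D \<in> borel_measurable borel" "W \<in> borel_measurable borel"
    unfolding D_def W_def by measurable
  have run2: "integrable minkowski_measure (\<lambda>x. (run_increment x)\<^sup>2)" by (rule integrable_run_increment_square)
  have D2: "integrable minkowski_measure (\<lambda>x. (D x)\<^sup>2)"
    unfolding D_def
    by (rule integral_farey_transfer(1)) (auto intro!: continuous_intros continuous_on_log_increment)
  have W2: "integrable minkowski_measure (\<lambda>x. (W x)\<^sup>2)"
  proof (rule Bochner_Integration.integrable_bound)
    show "integrable minkowski_measure (\<lambda>x. 2 * (run_increment x)\<^sup>2 + 2 * (D x)\<^sup>2)" using run2 D2 by simp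
    show "AE x in minkowski_measure. norm ((W x)\<^sup>2) \<le> norm (2 * (run_increment x)\<^sup>2 + 2 * (D x)\<^sup>2)"
    proof (rule AE_I2)
      fix x
      have "(W x)\<^sup>2 + (run_increment x - D x)\<^sup>2 = 2 * (run_increment x)\<^sup>2 + 2 * (D x)\<^sup>2"
        unfolding W_def by (simp add: power2_eq_square algebra_simps)
      then have "(W x)\<^sup>2 \<le> 2 * (run_increment x)\<^sup>2 + 2 * (D x)\<^sup>2"
        using zero_le_power2[of "run_increment x - D x"] by linarith
      then show "norm ((W x)\<^sup>2) \<le> norm (2 * (run_increment x)\<^sup>2 + 2 * (D x)\<^sup>2)" by simp
    qed
  qed measurable
  have parts: "integrable minkowski_measure (\<lambda>x. (W (x / (1 + x)))\<^sup>2)" "integrable minkowski_measure (\<lambda>x. (W (1 / (1 + x)))\<^sup>2)"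
    using W2 integrable_minkowski_iff[of "\<lambda>x. (W x)\<^sup>2"] by simp_all
  have 0: "(LINT x|minkowski_measure. (W (x / (1 + x)))\<^sup>2) = (LINT x|minkowski_measure. (W x + D x)\<^sup>2)"
    using run_increment_branch_0
    by (intro integral_cong_AE AE_minkowskiI) (measurable, simp add: W_def D_def add.commute)
  have 1: "(LINT x|minkowski_measure. (W (1 / (1 + x)))\<^sup>2) = (LINT x|minkowski_measure. 0)"
    using run_increment_branch_1
    by (intro integral_cong_AE AE_minkowskiI) (measurable, simp add: W_def D_def)
  have int: "(LINT x|minkowski_measure. (W x)\<^sup>2) = (LINT x|minkowski_measure. (W x + D x)\<^sup>2) / 2"
    using integral_minkowski(2)[of "\<lambda>x. (W x)\<^sup>2", OF _ parts] unfolding 0 1 by simp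
  have WD: "integrable minkowski_measure (\<lambda>x. (W x + D x)\<^sup>2)"
    using parts(1) by (rule integrable_cong_AE_imp)
      (measurable, rule AE_minkowskiI, use run_increment_branch_0 in \<open>simp add: W_def D_def add.commute\<close>)
  have "(LINT x|minkowski_measure. (run_increment x)\<^sup>2)
      = (LINT x|minkowski_measure. 2 * (W x)\<^sup>2 + 2 * (D x)\<^sup>2 - (W x + D x)\<^sup>2)"
    by (rule Bochner_Integration.integral_cong) (auto simp: W_def power2_eq_square algebra_simps)
  also have "\<dots> = 2 * (LINT x|minkowski_measure. (W x)\<^sup>2) + 2 * (LINT x|minkowski_measure. (D x)\<^sup>2)
      - (LINT x|minkowski_measure. (W x + D x)\<^sup>2)"
    using W2 D2 WD by simp
  finally show ?thesis unfolding int by (simp add: increment_variance_def D_def)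
qed

text \<open>Works without measurability of \<open>f\<close> and \<open>g\<close>, hence for
  integrands that contain an inner integral or \<open>deriv\<close>. Points have measure 0; besides
  the endpoints, 1/2 is excepted as the kink of \<open>farey\<close>.\<close>

lemma set_integral_minkowski_cong:
  assumes "\<And>x. 0 < x \<Longrightarrow> x < 1 \<Longrightarrow> x \<noteq> 1 / 2 \<Longrightarrow> f x = g x"
  shows "(LINT x:{0..1}|minkowski_measure. f x) = (LINT x:{0..1}|minkowski_measure. g x :: real)"
  unfolding set_lebesgue_integral_def
  by (rule integral_discrete_difference[of "{0, 1 / 2, 1}"])
    (use assms in \<open>auto simp: emeasure_minkowski_singleton indicator_def\<close>)

lemma run_increment_formula:
  "increment_variance = 1 / 2 * (LINT x:{0..1}|minkowski_measure.
      (ln x + farey_drift * of_int \<lfloor>1 / x\<rfloor> +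
        (LINT y:{0..1}|minkowski_measure. ln ((1 + y * frac (1 / x)) / (1 + y * x))))\<^sup>2)"
proof -
  have inner: "(LINT y:{0..1}|minkowski_measure. ln ((1 + y * frac (1 / x)) / (1 + y * x)))
      = log_int 1 (frac (1 / x)) - log_int 1 x" if "0 < x" for x
  proof -
    have "(LINT y:{0..1}|minkowski_measure. ln ((1 + y * frac (1 / x)) / (1 + y * x)))
        = (LINT y:{0..1}|minkowski_measure. ln (1 + frac (1 / x) * y) - ln (1 + x * y))"
    proof (rule set_integral_minkowski_cong)
      fix y :: real assume "0 < y"
      then have "0 < 1 + frac (1 / x) * y" "0 < 1 + x * y" using that by (simp_all add: add_pos_nonneg)
      then show "ln ((1 + y * frac (1 / x)) / (1 + y * x)) = ln (1 + frac (1 / x) * y) - ln (1 + x * y)"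
        by (simp add: ln_div mult.commute)
    qed
    also have "\<dots> = (LINT y|minkowski_measure. ln (1 + frac (1 / x) * y) - ln (1 + x * y))"
      by (rule set_integral_minkowski) measurable
    also have "\<dots> = log_int 1 (frac (1 / x)) - log_int 1 x"
      unfolding log_int_def using that
      by (intro Bochner_Integration.integral_diff integrable_ln_affine) (auto simp: add_pos_nonneg)
    finally show ?thesis .
  qed
  have "(LINT x:{0..1}|minkowski_measure.
      (ln x + farey_drift * of_int \<lfloor>1 / x\<rfloor> +
        (LINT y:{0..1}|minkowski_measure. ln ((1 + y * frac (1 / x)) / (1 + y * x))))\<^sup>2)
    = (LINT x:{0..1}|minkowski_measure. (run_increment x)\<^sup>2)"
    by (rule set_integral_minkowski_cong) (simp add: inner run_increment_def)
  also have "\<dots> = (LINT x|minkowski_measure. (run_increment x)\<^sup>2)"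
    by (rule set_integral_minkowski) measurable
  finally show ?thesis using integral_run_increment_square by simp
qed

text \<open>The expansion is that of \<open>ln (1 - x / 2)\<close>, whose terms decay geometrically
  on the whole interval. As \<open>1 - x / 2 = (1 + (1 - x)) / 2\<close>, the reflection symmetry of
  the measure turns its integral into that of \<open>ln (1 + x) - ln 2\<close>.\<close>

lemma minkowski_moment_series:
  "(\<lambda>k. minkowski_moment (k + 1) / (real (k + 1) * 2 ^ (k + 1))) sums (ln 2 - farey_drift)"
proof -
  define f where "f k x = x ^ (k + 1) / (real (k + 1) * 2 ^ (k + 1))" for k and x :: real
  have f_meas[measurable]: "f k \<in> borel_measurable borel" for k unfolding f_def by measurable
  have f_le: "0 \<le> f k x \<and> f k x \<le> (1 / 2) ^ (k + 1)" if "0 < x" "x < 1" for k x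
  proof -
    have "x ^ (k + 1) \<le> 1" using that by (intro power_le_one) auto
    then have "x ^ (k + 1) / (real (k + 1) * 2 ^ (k + 1)) \<le> 1 / (1 * 2 ^ (k + 1))"
      using that by (intro frac_le mult_right_mono) auto
    then show ?thesis using that by (simp add: f_def power_one_over)
  qed
  have f_int: "integrable minkowski_measure (f k)" for k
    by (intro minkowski.integrable_const_bound[where B="(1 / 2) ^ (k + 1)"] AE_minkowskiI)
      (use f_le[of _ k] in auto)
  have geom: "summable (\<lambda>k. (1 / 2) ^ (k + 1) :: real)"
    using summable_Suc_iff[THEN iffD2, OF summable_geometric[of "1 / 2 :: real"]] by simp
  have sums: "(\<lambda>k. LINT x|minkowski_measure. f k x) sums (LINT x|minkowski_measure. (\<Sum>k. f k x))"
  proof (rule sums_integral)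
    show "AE x in minkowski_measure. summable (\<lambda>k. norm (f k x))"
      by (rule AE_minkowskiI, rule summable_comparison_test[OF _ geom]) (use f_le in auto)
    show "summable (\<lambda>k. LINT x|minkowski_measure. norm (f k x))"
    proof (rule summable_comparison_test[OF _ geom], intro exI allI impI)
      fix k
      have "(LINT x|minkowski_measure. norm (f k x)) \<le> (LINT x|minkowski_measure. (1 / 2) ^ (k + 1))"
        using f_int by (intro integral_mono_AE AE_minkowskiI) (use f_le[of _ k] in auto)
      then show "norm (LINT x|minkowski_measure. norm (f k x)) \<le> (1 / 2) ^ (k + 1)"
        using minkowski.prob_space by simp
    qed
  qed (rule f_int)
  have series: "(\<Sum>k. f k x) = ln 2 - ln (1 + (1 - x))" if x: "0 < x" "x < 1" for x
  proof -
    have "ln (1 - x / 2) = (\<Sum>n. (-1) ^ n * (1 / real (n + 1)) * ((1 - x / 2) - 1) ^ Suc n)"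
      by (rule ln_series) (use x in auto)
    also have "(\<lambda>n. (-1) ^ n * (1 / real (n + 1)) * ((1 - x / 2) - 1) ^ Suc n) = (\<lambda>n. - f n x)"
    proof
      fix n
      have "(1 - x / 2) - 1 = -1 * (x / 2)" by simp
      then have "((1 - x / 2) - 1) ^ Suc n = (-1) ^ Suc n * (x ^ (n + 1) / 2 ^ (n + 1))"
        by (simp only: power_mult_distrib power_divide Suc_eq_plus1)
      moreover have "(-1 :: real) ^ n * (-1) ^ Suc n = -1" by (simp flip: power_mult_distrib)
      ultimately show "(-1) ^ n * (1 / real (n + 1)) * ((1 - x / 2) - 1) ^ Suc n = - f n x"
        by (simp add: f_def)
    qed
    also have "(\<Sum>n. - f n x) = - (\<Sum>n. f n x)"
      by (intro suminf_minus summable_comparison_test[OF _ geom]) (use f_le[OF x] in auto)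
    finally have "(\<Sum>n. f n x) = - ln (1 - x / 2)" by simp
    moreover have "1 - x / 2 = (1 + (1 - x)) / 2" by (simp add: field_simps)
    ultimately show ?thesis using x by (simp add: ln_div)
  qed
  have "(LINT x|minkowski_measure. (\<Sum>k. f k x)) = (LINT x|minkowski_measure. ln 2 - ln (1 + (1 - x)))"
    by (intro integral_cong_AE AE_minkowskiI series) measurable
  also have "\<dots> = (LINT x|minkowski_measure. ln 2 - ln (1 + x))"
    by (rule integral_minkowski_reflect[of "\<lambda>x. ln 2 - ln (1 + x)"]) measurable
  also have "\<dots> = ln 2 - farey_drift"
    using integrable_ln_affine[of 1 1] minkowski.prob_space by (simp add: farey_drift_eq)
  finally have total: "(LINT x|minkowski_measure. (\<Sum>k. f k x)) = ln 2 - farey_drift" .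
  have "(LINT x|minkowski_measure. f k x) = minkowski_moment (k + 1) / (real (k + 1) * 2 ^ (k + 1))" for k
  proof -
    have "(LINT x:{0..1}|minkowski_measure. x ^ (k + 1)) = (LINT x|minkowski_measure. x ^ (k + 1))"
      by (rule set_integral_minkowski) measurable
    then show ?thesis unfolding minkowski_moment_def f_def by simp
  qed
  then show ?thesis using sums unfolding total by simp
qed

lemma deriv_farey:
  assumes "0 < x" "x < 1"
  shows "x < 1 / 2 \<Longrightarrow> deriv farey x = 1 / (1 - x)\<^sup>2"
    and "x > 1 / 2 \<Longrightarrow> deriv farey x = - 1 / x\<^sup>2"
proof -
  have cmp: "y / (1 - y) \<le> (1 - y) / y \<longleftrightarrow> y \<le> 1 / 2" if "0 < y" "y < 1" for y :: real
  proof -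
    have "y / (1 - y) \<le> (1 - y) / y \<longleftrightarrow> y * y \<le> (1 - y) * (1 - y)"
      using that by (simp add: divide_simps mult.commute)
    also have "\<dots> \<longleftrightarrow> y \<le> 1 / 2" by (simp add: algebra_simps)
    finally show ?thesis .
  qed
  {
    assume x2: "x < 1 / 2"
    have "((\<lambda>y. y / (1 - y)) has_field_derivative 1 / (1 - x)\<^sup>2) (at x)"
      using assms by (auto intro!: derivative_eq_intros simp: power2_eq_square divide_simps)
    moreover have "\<forall>\<^sub>F y in nhds x. y / (1 - y) = farey y"
      using eventually_nhds_in_open[of "{0<..<1/2}" x] assms x2
      by (auto elim!: eventually_mono simp: farey_def min_def cmp)
    ultimately have "(farey has_field_derivative 1 / (1 - x)\<^sup>2) (at x)"
      by (subst (asm) DERIV_cong_ev[OF refl _ refl]) auto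
    then show "deriv farey x = 1 / (1 - x)\<^sup>2" by (rule DERIV_imp_deriv)
  }
  {
    assume x2: "x > 1 / 2"
    have "((\<lambda>y. (1 - y) / y) has_field_derivative - 1 / x\<^sup>2) (at x)"
      using assms by (auto intro!: derivative_eq_intros simp: power2_eq_square divide_simps)
    moreover have "\<forall>\<^sub>F y in nhds x. (1 - y) / y = farey y"
      using eventually_nhds_in_open[of "{1/2<..<1}" x] assms x2
      by (auto elim!: eventually_mono simp: farey_def min_def cmp)
    ultimately have "(farey has_field_derivative - 1 / x\<^sup>2) (at x)"
      by (subst (asm) DERIV_cong_ev[OF refl _ refl]) auto
    then show "deriv farey x = - 1 / x\<^sup>2" by (rule DERIV_imp_deriv)
  }
qed

text \<open>At both preimages of \<open>x\<close> the derivative of \<open>farey\<close> has modulus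
  \<open>(1 + x)\<^sup>2\<close>, so self-similarity yields \<open>2 * ln (1 + x)\<close> from
  either branch.\<close>

lemma integral_ln_deriv_farey:
  "(LINT x:{0..1}|minkowski_measure. ln \<bar>deriv farey x\<bar>) = 2 * farey_drift"
proof -
  \<comment> \<open>An explicit Borel function that agrees with
    \<open>ln \<bar>deriv farey x\<bar>\<close> on the open unit interval away from 1/2.\<close>
  define g :: "real \<Rightarrow> real" where "g x = (if x < 1 / 2 then - 2 * ln (1 - x) else - 2 * ln x)" for x
  have g_meas[measurable]: "g \<in> borel_measurable borel" unfolding g_def by measurable
  have g: "g (x / (1 + x)) = 2 * ln (1 + 1 * x)" "g (1 / (1 + x)) = 2 * ln (1 + 1 * x)" if "0 < x" "x < 1" for x
  proof -
    have "1 - x / (1 + x) = 1 / (1 + x)" "x / (1 + x) < 1 / 2" "1 / (1 + x) > 1 / 2"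
      using that by (auto simp: field_simps)
    then show "g (x / (1 + x)) = 2 * ln (1 + 1 * x)" "g (1 / (1 + x)) = 2 * ln (1 + 1 * x)"
      using that by (simp_all add: g_def ln_div)
  qed
  have lin: "integrable minkowski_measure (\<lambda>x. 2 * ln (1 + 1 * x))"
    by (intro integrable_mult_right integrable_ln_affine) auto
  have int: "integrable minkowski_measure (\<lambda>x. g (x / (1 + x)))" "integrable minkowski_measure (\<lambda>x. g (1 / (1 + x)))"
    by (rule integrable_cong_AE_imp[OF lin], measurable, rule AE_minkowskiI, simp add: g)+
  have "(LINT x:{0..1}|minkowski_measure. ln \<bar>deriv farey x\<bar>) = (LINT x:{0..1}|minkowski_measure. g x)"
  proof (rule set_integral_minkowski_cong)
    fix x :: real assume x: "0 < x" "x < 1" "x \<noteq> 1 / 2"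
    show "ln \<bar>deriv farey x\<bar> = g x"
    proof (cases "x < 1 / 2")
      case True
      then show ?thesis using x by (simp add: deriv_farey g_def ln_div ln_realpow)
    next
      case False
      then have "x > 1 / 2" using x by linarith
      then show ?thesis using x by (simp add: deriv_farey g_def ln_div ln_realpow)
    qed
  qed
  also have "\<dots> = (LINT x|minkowski_measure. g x)" by (rule set_integral_minkowski) measurable
  also have "\<dots> = ((LINT x|minkowski_measure. g (x / (1 + x))) + (LINT x|minkowski_measure. g (1 / (1 + x)))) / 2"
    by (rule integral_minkowski(2)[OF g_meas int])
  also have "\<dots> = (LINT x|minkowski_measure. 2 * ln (1 + 1 * x))"
  proof -
    have "(LINT x|minkowski_measure. g (x / (1 + x))) = (LINT x|minkowski_measure. 2 * ln (1 + 1 * x))"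
      "(LINT x|minkowski_measure. g (1 / (1 + x))) = (LINT x|minkowski_measure. 2 * ln (1 + 1 * x))"
      by (intro integral_cong_AE AE_minkowskiI g; measurable)+
    then show ?thesis by simp
  qed
  finally show ?thesis by (simp add: farey_drift_eq)
qed

section \<open>Random matrix products\<close>

lemma A0_component: "A0 $ 1 $ 1 = 1" "A0 $ 1 $ 2 = 1" "A0 $ 2 $ 1 = 0" "A0 $ 2 $ 2 = 1"
  and A1_component: "A1 $ 1 $ 1 = 1" "A1 $ 1 $ 2 = 0" "A1 $ 2 $ 1 = 1" "A1 $ 2 $ 2 = 1"
  by (simp_all add: A0_def A1_def)

lemma A0_A1_in_GL2: "A0 \<in> space GL2" "A1 \<in> space GL2"
  by (simp_all add: GL2_def space_restrict_space invertible_det_nz det_2 A0_component A1_component)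

lemma sets_eta [simp, measurable_cong]: "sets eta = sets GL2"
  and space_eta [simp]: "space eta = space GL2"
  by (simp_all add: eta_def)

lemma nn_integral_eta:
  assumes "f \<in> borel_measurable GL2"
  shows "(\<integral>\<^sup>+g. f g \<partial>eta) = (f A0 + f A1) / 2"
  unfolding eta_def
  by (subst nn_integral_half_sum) (use assms A0_A1_in_GL2 in \<open>auto simp: nn_integral_return\<close>)

lemma prob_space_eta: "prob_space eta"
proof (rule prob_spaceI)
  have "emeasure eta (space eta) = (\<integral>\<^sup>+g. 1 \<partial>eta)" by simp
  also have "\<dots> = 1" by (subst nn_integral_eta) (auto simp flip: one_add_one)
  finally show "emeasure eta (space eta) = 1" .
qed

lemma measurable_GL2_borel [measurable]: "(\<lambda>g. g) \<in> GL2 \<rightarrow>\<^sub>M borel"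
  unfolding GL2_def by (rule measurable_restrict_space1) simp

lemma measurable_matrix_component [measurable]:
  "(\<lambda>g :: real^2^2. g $ i $ j) \<in> borel \<rightarrow>\<^sub>M borel"
  by (intro borel_measurable_continuous_onI continuous_intros)

text \<open>\<open>eta\<close> is a measure on all of \<open>GL2\<close>; this makes the
  nonnegativity of \<open>A0\<close> and \<open>A1\<close> available almost surely.\<close>

lemma AE_eta: "AE g in eta. g = A0 \<or> g = A1"
proof -
  have "{g \<in> space GL2. \<not> (g = A0 \<or> g = A1)} = (\<lambda>g. g) -` (- {A0, A1}) \<inter> space GL2" by auto
  moreover have "\<dots> \<in> sets GL2" by (rule measurable_sets[OF measurable_GL2_borel]) auto
  ultimately have *: "{g \<in> space GL2. \<not> (g = A0 \<or> g = A1)} \<in> sets GL2" (is "?S \<in> _") by simp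
  then have "emeasure eta ?S = (\<integral>\<^sup>+g. indicator ?S g \<partial>eta)" by simp
  also have "\<dots> = 0" by (subst nn_integral_eta) (use * in auto)
  finally show ?thesis using * by (intro AE_I[of _ _ ?S]) auto
qed

lemma left_prod_cong: "(\<And>i. 1 \<le> i \<Longrightarrow> i \<le> n \<Longrightarrow> g i = h i) \<Longrightarrow> left_prod g n = left_prod h n"
  by (induction n) auto

lemma measurable_left_prod:
  "n \<le> N \<Longrightarrow> (\<lambda>g. left_prod g n) \<in> borel_measurable (\<Pi>\<^sub>M j\<in>{1..N}. eta)"
proof (induction n)
  case (Suc n)
  have "(\<lambda>g. g (Suc n)) \<in> (\<Pi>\<^sub>M j\<in>{1..N}. eta) \<rightarrow>\<^sub>M GL2"
    using Suc.prems measurable_component_singleton[of "Suc n" "{1..N}" "\<lambda>_. eta"]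
    by (simp cong: measurable_cong_sets)
  then have 1: "(\<lambda>g. g (Suc n)) \<in> borel_measurable (\<Pi>\<^sub>M j\<in>{1..N}. eta)"
    using measurable_GL2_borel by (rule measurable_compose)
  have 2: "(\<lambda>g. left_prod g n) \<in> borel_measurable (\<Pi>\<^sub>M j\<in>{1..N}. eta)"
    using Suc by simp
  have "continuous_on UNIV (\<lambda>p. fst p ** snd p :: real^2^2)"
    unfolding matrix_matrix_mult_def by (intro continuous_intros)
  from borel_measurable_continuous_Pair[OF 1 2 this] show ?case by simp
qed simp

text \<open>The start \<open>(1, 1)\<close> is the root of the Stern tree. The coordinates of the
  orbit add up to the sum of all entries of the product, which for nonnegative entries is comparable
  with the operator norm.\<close>

definition orbit_vec :: "(nat \<Rightarrow> real^2^2) \<Rightarrow> nat \<Rightarrow> real^2" where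
  "orbit_vec g n = left_prod g n *v vector [1, 1]"

lemma orbit_vec_Suc: "orbit_vec g (Suc n) = g (Suc n) *v orbit_vec g n"
  by (simp add: orbit_vec_def matrix_vector_mul_assoc)

lemma A0_A1_mult_vec:
  "(A0 *v v) $ 1 = v $ 1 + v $ 2" "(A0 *v v) $ 2 = v $ 2"
  "(A1 *v v) $ 1 = v $ 1" "(A1 *v v) $ 2 = v $ 1 + v $ 2"
  by (simp_all add: matrix_vector_mult_def sum_2 A0_component A1_component)

lemma measurable_orbit_vec:
  "n \<le> N \<Longrightarrow> (\<lambda>g. orbit_vec g n $ i) \<in> borel_measurable (\<Pi>\<^sub>M j\<in>{1..N}. eta)"
  unfolding orbit_vec_def
  by (rule measurable_compose[OF measurable_left_prod])
    (auto intro!: borel_measurable_continuous_onI continuous_intros simp: matrix_vector_mult_def)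

text \<open>The newest factor acts last and sends \<open>(a, b)\<close> to \<open>(a + b, b)\<close>
  or \<open>(a, a + b)\<close>, the two children. So the orbit vector at time \<open>N\<close> has
  the law of a uniformly chosen Stern pair of level \<open>N\<close>.\<close>

lemma nn_integral_orbit_vec:
  assumes "\<And>a b. 0 \<le> F a b" and "(\<lambda>(a, b). F a b) \<in> borel_measurable (borel \<Otimes>\<^sub>M borel)"
  shows "(\<integral>\<^sup>+g. ennreal (F (orbit_vec g N $ 1) (orbit_vec g N $ 2)) \<partial>(\<Pi>\<^sub>M j\<in>{1..N}. eta)) = ennreal (stern_avg F N)"
  using assms
proof (induction N arbitrary: F)
  case 0
  interpret prob_space eta by (rule prob_space_eta)
  interpret P: product_prob_space "\<lambda>_ :: nat. eta" "{}" ..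
  show ?case by (simp add: stern_avg_0 orbit_vec_def nn_integral_const P.emeasure_space_1)
next
  case (Suc N)
  note [measurable] = Suc.prems(2)
  interpret prob_space eta by (rule prob_space_eta)
  interpret P: product_sigma_finite "\<lambda>_ :: nat. eta" ..
  have set: "{1..Suc N} = insert (Suc N) {1..N}" by auto
  let ?F = "\<lambda>v. ennreal (F (v $ 1) (v $ 2))"
  have F[measurable]: "(\<lambda>x. F (f x) (h x)) \<in> borel_measurable M"
    if [measurable]: "f \<in> borel_measurable M" "h \<in> borel_measurable M" for f h and M :: "'z measure"
    using measurable_compose[OF measurable_Pair[OF that] Suc.prems(2)] by simp
  have step_meas: "(\<lambda>(a, b). stern_step F a b) \<in> borel_measurable (borel \<Otimes>\<^sub>M borel)"
    unfolding stern_step_def split_beta' by measurable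
  have "(\<integral>\<^sup>+g. ?F (orbit_vec g (Suc N)) \<partial>(\<Pi>\<^sub>M j\<in>{1..Suc N}. eta))
      = (\<integral>\<^sup>+g. \<integral>\<^sup>+y. ?F (orbit_vec (g(Suc N := y)) (Suc N)) \<partial>eta \<partial>(\<Pi>\<^sub>M j\<in>{1..N}. eta))"
    unfolding set
  proof (rule P.product_nn_integral_insert)
    show "(\<lambda>g. ?F (orbit_vec g (Suc N))) \<in> borel_measurable (Pi\<^sub>M (insert (Suc N) {1..N}) (\<lambda>j. eta))"
      unfolding set[symmetric]
      by (intro measurable_compose[OF _ measurable_ennreal] F measurable_orbit_vec) simp_all
  qed auto
  also have "\<dots> = (\<integral>\<^sup>+g. ennreal (stern_step F (orbit_vec g N $ 1) (orbit_vec g N $ 2)) \<partial>(\<Pi>\<^sub>M j\<in>{1..N}. eta))"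
  proof (rule nn_integral_cong)
    fix g
    have "left_prod (g(Suc N := y)) N = left_prod g N" for y
      by (rule left_prod_cong) auto
    then have "orbit_vec (g(Suc N := y)) (Suc N) = y *v orbit_vec g N" for y
      by (simp add: orbit_vec_Suc) (simp add: orbit_vec_def)
    moreover have "(\<integral>\<^sup>+y. ?F (y *v orbit_vec g N) \<partial>eta) = (?F (A0 *v orbit_vec g N) + ?F (A1 *v orbit_vec g N)) / 2"
    proof (rule nn_integral_eta)
      have "(\<lambda>y :: real^2^2. (y *v orbit_vec g N) $ i) \<in> borel_measurable borel" for i
        by (auto intro!: borel_measurable_continuous_onI continuous_intros simp: matrix_vector_mult_def)
      from measurable_compose[OF measurable_GL2_borel this]
      show "(\<lambda>y. ?F (y *v orbit_vec g N)) \<in> borel_measurable GL2"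
        by (intro measurable_compose[OF _ measurable_ennreal] F)
    qed
    ultimately show "(\<integral>\<^sup>+y. ?F (orbit_vec (g(Suc N := y)) (Suc N)) \<partial>eta)
        = ennreal (stern_step F (orbit_vec g N $ 1) (orbit_vec g N $ 2))"
      using Suc.prems(1) by (simp add: A0_A1_mult_vec stern_step_def ennreal_divide_numeral add.commute flip: ennreal_plus)
  qed
  also have "\<dots> = ennreal (stern_avg (stern_step F) N)"
    using Suc.prems(1) step_meas by (intro Suc.IH) (auto simp: stern_step_def)
  finally show ?case by (simp add: stern_avg_Suc)
qed

lemma left_prod_nonneg:
  assumes "\<And>i. 1 \<le> i \<Longrightarrow> i \<le> n \<Longrightarrow> g i = A0 \<or> g i = A1"
  shows "0 \<le> left_prod g n $ i $ j"
  using assms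
proof (induction n arbitrary: i j)
  case (Suc n)
  have "0 \<le> g (Suc n) $ i $ k" for k
    using Suc.prems[of "Suc n"] A0_component A1_component exhaust_2[of i] exhaust_2[of k] by auto
  then show ?case using Suc by (auto simp: matrix_matrix_mult_def intro!: sum_nonneg mult_nonneg_nonneg)
qed (simp add: mat_def)

lemma orbit_vec_ge_1:
  assumes "\<And>i. 1 \<le> i \<Longrightarrow> i \<le> n \<Longrightarrow> g i = A0 \<or> g i = A1"
  shows "1 \<le> orbit_vec g n $ 1 \<and> 1 \<le> orbit_vec g n $ 2"
  using assms
proof (induction n)
  case (Suc n)
  then have "1 \<le> orbit_vec g n $ 1 \<and> 1 \<le> orbit_vec g n $ 2" by auto
  then show ?case using Suc.prems[of "Suc n"] by (auto simp: orbit_vec_Suc A0_A1_mult_vec)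
qed (simp add: orbit_vec_def)

text \<open>The operator norm lies between a quarter of the entry sum and the entry sum. The inner
  absolute value changes nothing, as the sum is at least 2; it makes the function nonnegative at
  arbitrary arguments, as \<open>nn_integral_orbit_vec\<close> asks.\<close>

lemma ln_onorm_left_prod:
  assumes "\<And>i. 1 \<le> i \<Longrightarrow> i \<le> n \<Longrightarrow> g i = A0 \<or> g i = A1"
  shows "\<bar>ln (onorm ((*v) (left_prod g n))) - \<bar>ln (orbit_vec g n $ 1 + orbit_vec g n $ 2)\<bar>\<bar> \<le> ln 4"
proof -
  define P where "P = left_prod g n"
  define s where "s = orbit_vec g n $ 1 + orbit_vec g n $ 2"
  have nonneg: "0 \<le> P $ i $ j" for i j using left_prod_nonneg[OF assms] by (simp add: P_def)
  have s_eq: "s = P $ 1 $ 1 + P $ 1 $ 2 + P $ 2 $ 1 + P $ 2 $ 2"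
    by (simp add: s_def orbit_vec_def matrix_vector_mult_def sum_2 P_def)
  have "1 \<le> orbit_vec g n $ 1 \<and> 1 \<le> orbit_vec g n $ 2"
    using assms by (rule orbit_vec_ge_1)
  then have s2: "s \<ge> 2" by (simp add: s_def)
  have "onorm ((*v) P) \<le> s"
    using onorm_le_matrix_component_sum[of P] nonneg by (simp add: s_eq sum_2)
  moreover have "s \<le> 4 * onorm ((*v) P)"
    using matrix_component_le_onorm[of P 1 1] matrix_component_le_onorm[of P 1 2]
      matrix_component_le_onorm[of P 2 1] matrix_component_le_onorm[of P 2 2] nonneg by (simp add: s_eq)
  moreover from this have "onorm ((*v) P) > 0" using s2 by linarith
  ultimately have "ln (onorm ((*v) P)) \<le> ln s" "ln s \<le> ln (4 * onorm ((*v) P))"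
    "ln (4 * onorm ((*v) P)) = ln 4 + ln (onorm ((*v) P))"
    using s2 by (simp, intro ln_mono, auto simp: ln_mult)
  moreover have "ln s \<ge> 0" using s2 by simp
  ultimately show ?thesis unfolding P_def[symmetric] s_def[symmetric] by linarith
qed

lemma continuous_on_onorm_matrix: "continuous_on UNIV (\<lambda>A :: real^2^2. onorm ((*v) A))"
proof (rule continuous_at_imp_continuous_on, rule ballI)
  fix A :: "real^2^2"
  have le: "onorm ((*v) B) \<le> onorm ((*v) C) + onorm ((*v) (B - C))" for B C :: "real^2^2"
  proof -
    have "onorm (\<lambda>x. C *v x + (B - C) *v x) \<le> onorm ((*v) C) + onorm ((*v) (B - C))"
      by (intro onorm_triangle matrix_vector_mul_bounded_linear)
    moreover have "(\<lambda>x. C *v x + (B - C) *v x) = (*v) B"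
      by (simp add: fun_eq_iff matrix_vector_mult_diff_rdistrib)
    ultimately show ?thesis by simp
  qed
  have bound: "\<bar>onorm ((*v) B) - onorm ((*v) A)\<bar> \<le> (\<Sum>i\<in>UNIV. \<Sum>j\<in>UNIV. \<bar>(B - A) $ i $ j\<bar>)" for B
  proof -
    have "onorm ((*v) (A - B)) \<le> (\<Sum>i\<in>UNIV. \<Sum>j\<in>UNIV. \<bar>(A - B) $ i $ j\<bar>)"
      "onorm ((*v) (B - A)) \<le> (\<Sum>i\<in>UNIV. \<Sum>j\<in>UNIV. \<bar>(B - A) $ i $ j\<bar>)"
      by (rule onorm_le_matrix_component_sum)+
    then show ?thesis using le[of A B] le[of B A] by (simp add: abs_minus_commute)
  qed
  have "((\<lambda>B. \<Sum>i\<in>UNIV. \<Sum>j\<in>UNIV. \<bar>(B - A) $ i $ j\<bar>) \<longlongrightarrow> (\<Sum>i\<in>UNIV. \<Sum>j\<in>UNIV. \<bar>(A - A) $ i $ j\<bar>)) (at A)"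
    by (intro tendsto_intros)
  then have "((\<lambda>B. \<Sum>i\<in>UNIV. \<Sum>j\<in>UNIV. \<bar>(B - A) $ i $ j\<bar>) \<longlongrightarrow> 0) (at A)" by simp
  then have "((\<lambda>B. onorm ((*v) B) - onorm ((*v) A)) \<longlongrightarrow> 0) (at A)"
    by (rule Lim_null_comparison[rotated]) (use bound in simp)
  then show "isCont (\<lambda>B. onorm ((*v) B)) A" unfolding isCont_def by (simp add: LIM_zero_iff)
qed

text \<open>The logarithms of norm and entry sum and the potential differ by bounded amounts, and
  the average of the potential is exactly affine in \<open>N\<close>.\<close>

lemma is_max_Lyapunov_exponent_eta: "is_max_Lyapunov_exponent eta farey_drift"
proof -
  interpret eta: prob_space eta by (rule prob_space_eta)
  define E where "E N = (LINT g|(\<Pi>\<^sub>M j\<in>{1..N}. eta). ln (onorm ((*v) (left_prod g N))))" for N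
  have bound: "\<bar>E N - farey_drift * real N\<bar> \<le> ln 4 + log_defect + \<bar>log_potential 1 1\<bar>" for N
  proof -
    let ?M = "\<Pi>\<^sub>M j\<in>{1..N}. eta"
    interpret M: prob_space ?M by (rule prob_space_PiM) (rule prob_space_eta)
    define F :: "real \<Rightarrow> real \<Rightarrow> real" where "F a b = \<bar>ln (a + b)\<bar>" for a b
    let ?s = "\<lambda>g. F (orbit_vec g N $ 1) (orbit_vec g N $ 2)"
    have AE: "AE g in ?M. \<forall>j\<in>{1..N}. g j = A0 \<or> g j = A1"
      by (intro AE_finite_allI AE_PiM_component prob_space_eta AE_eta) auto
    have [measurable]: "(\<lambda>g. orbit_vec g N $ i) \<in> borel_measurable ?M" for i
      by (rule measurable_orbit_vec) simp
    have s_meas: "?s \<in> borel_measurable ?M" unfolding F_def by measurable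
    have nn: "(\<integral>\<^sup>+g. ennreal (?s g) \<partial>?M) = ennreal (stern_avg F N)"
      by (rule nn_integral_orbit_vec) (auto simp: F_def split_beta')
    have F0: "0 \<le> stern_avg F N" by (rule stern_avg_nonneg) (simp add: F_def)
    have s_int: "integrable ?M ?s"
      using nn s_meas by (intro integrableI_nonneg) (auto simp: F_def)
    have s_eq: "(LINT g|?M. ?s g) = stern_avg F N"
      using nn F0 s_meas by (subst integral_eq_nn_integral) (auto simp: F_def)
    have o_meas: "(\<lambda>g. ln (onorm ((*v) (left_prod g N)))) \<in> borel_measurable ?M"
      using measurable_compose[OF measurable_left_prod[of N N] borel_measurable_continuous_onI[OF continuous_on_onorm_matrix]]
      by (intro borel_measurable_ln) simp
    have diff: "AE g in ?M. \<bar>ln (onorm ((*v) (left_prod g N))) - ?s g\<bar> \<le> ln 4"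
      using AE by eventually_elim (simp add: F_def ln_onorm_left_prod)
    have d_int: "integrable ?M (\<lambda>g. ln (onorm ((*v) (left_prod g N))) - ?s g)"
      using o_meas s_meas diff by (intro M.integrable_const_bound[where B="ln 4"]) auto
    have "E N = (LINT g|?M. (ln (onorm ((*v) (left_prod g N))) - ?s g) + ?s g)"
      by (simp add: E_def)
    also have "\<dots> = (LINT g|?M. ln (onorm ((*v) (left_prod g N))) - ?s g) + stern_avg F N"
      using d_int s_int s_eq by (subst Bochner_Integration.integral_add) auto
    finally have "\<bar>E N - stern_avg F N\<bar> = \<bar>LINT g|?M. ln (onorm ((*v) (left_prod g N))) - ?s g\<bar>" by simp
    also have "\<dots> \<le> (LINT g|?M. \<bar>ln (onorm ((*v) (left_prod g N))) - ?s g\<bar>)" by (rule integral_abs_bound)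
    also have "\<dots> \<le> (LINT g|?M. ln 4)" by (intro integral_mono_AE integrable_abs d_int M.integrable_const diff)
    also have "\<dots> = ln 4" using M.prob_space by simp
    finally have 1: "\<bar>E N - stern_avg F N\<bar> \<le> ln 4" .
    have F_le: "F a b \<le> log_potential a b + log_defect" "log_potential a b \<le> F a b + log_defect"
      if "a \<ge> 1" "b \<ge> 1" for a b
    proof -
      have "ln (a + b) \<ge> 0" using that by simp
      then show "F a b \<le> log_potential a b + log_defect" "log_potential a b \<le> F a b + log_defect"
        using abs_log_potential_le[of a b] that unfolding F_def by linarith+
    qed
    have "stern_avg F N \<le> stern_avg (\<lambda>a b. log_potential a b + log_defect) N"
      "stern_avg log_potential N \<le> stern_avg (\<lambda>a b. F a b + log_defect) N"
      by (intro stern_avg_mono_ge_1 F_le; assumption)+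
    then have "\<bar>stern_avg F N - stern_avg log_potential N\<bar> \<le> log_defect"
      unfolding stern_avg_add stern_avg_const by linarith
    with 1 show ?thesis unfolding stern_avg_log_potential by linarith
  qed
  have "(\<lambda>N. E N - farey_drift * real N) \<in> O(\<lambda>_. 1)"
  proof (rule landau_o.bigI)
    show "0 < ln 4 + log_defect + \<bar>log_potential 1 1\<bar>"
      using log_defect_nonneg by (intro add_pos_nonneg) simp_all
    show "\<forall>\<^sub>F N in sequentially. norm (E N - farey_drift * real N)
        \<le> (ln 4 + log_defect + \<bar>log_potential 1 1\<bar>) * norm (1 :: real)"
      using bound by simp
  qed
  then show ?thesis
    unfolding is_max_Lyapunov_exponent_def E_def[symmetric] by (rule LIMSEQ_of_linear_bigo)
qed

section \<open>Measurability on the projective line and the stationary measure\<close>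

lemma sets_proj_borel: "A \<in> sets proj_borel \<longleftrightarrow> Some -` A \<in> sets borel"
proof
  assume "A \<in> sets proj_borel"
  then have "A \<in> sigma_sets UNIV {U. openin (Alexandroff_compactification euclideanreal) U}"
    by (simp add: proj_borel_def)
  then show "Some -` A \<in> sets borel"
  proof induction
    case (Basic U)
    \<comment> \<open>Neighbourhoods of infinity are complements of compact sets; closedness of the
      latter makes the trace on the line open.\<close>
    then consider V where "open V" "U = Some ` V" | C where "closed C" "U = insert None (Some ` (- C))"
      by (auto simp: openin_Alexandroff_compactification Compl_eq_Diff_UNIV)
    then show ?case
    proof cases
      case (1 V)
      then have "Some -` U = V" by auto
      with 1 show ?thesis by simp
    next
      case (2 C)
      then have "Some -` U = - C" by auto
      with 2 show ?thesis by (simp add: open_Compl)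
    qed
  next
    case (Compl A)
    moreover have "Some -` (UNIV - A) = UNIV - Some -` A" by auto
    ultimately show ?case by (metis borel_comp Compl_eq_Diff_UNIV)
  next
    case (Union A)
    then show ?case by (simp add: vimage_UN)
  qed simp
next
  assume "Some -` A \<in> sets borel"
  have Some_UNIV: "Some ` UNIV \<in> sets proj_borel"
    by (simp add: proj_borel_def sigma_sets.Basic)
  have "Some ` B \<in> sets proj_borel" if "B \<in> sigma_sets UNIV {S. open S}" for B :: "real set"
    using that
  proof induction
    case (Basic S)
    then show ?case by (simp add: proj_borel_def sigma_sets.Basic)
  next
    case (Compl B)
    have "Some ` (UNIV - B) = Some ` UNIV - Some ` B" by auto
    then show ?case using Compl Some_UNIV by auto
  next
    case (Union B)
    then show ?case by (simp add: image_UN)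
  qed simp
  then have B: "Some ` (Some -` A) \<in> sets proj_borel"
    using \<open>Some -` A \<in> sets borel\<close> by (simp add: sets_borel del: image_vimage_eq)
  have "space proj_borel = UNIV" by (simp add: proj_borel_def space_measure_of_conv)
  \<comment> \<open>The point at infinity is the complement of the embedded line, which is
    open.\<close>
  moreover have "{None :: real option} = UNIV - Some ` UNIV" using notin_range_Some by auto
  ultimately have "{None} \<in> sets proj_borel"
    using Some_UNIV sets.compl_sets by metis
  have "A = (if None \<in> A then {None} else {}) \<union> Some ` (Some -` A)"
    by (auto simp: image_iff) (metis not_Some_eq)
  also have "\<dots> \<in> sets proj_borel" using B \<open>{None} \<in> sets proj_borel\<close>
    by (intro sets.Un) (simp_all del: image_vimage_eq)
  finally show "A \<in> sets proj_borel" .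
qed

lemma space_proj_borel [simp]: "space proj_borel = UNIV"
  by (simp add: proj_borel_def space_measure_of_conv)

lemma measurable_Some [measurable]: "Some \<in> borel \<rightarrow>\<^sub>M proj_borel"
  by (rule measurableI) (simp_all add: sets_proj_borel)

lemma pred_None [measurable]: "Measurable.pred proj_borel (\<lambda>p. p = None)"
  unfolding pred_def by (simp add: sets_proj_borel vimage_def)

lemma measurable_affine_coordinate [measurable]: "case_option 0 (\<lambda>x. x) \<in> proj_borel \<rightarrow>\<^sub>M borel"
  by (rule measurableI) (auto simp: sets_proj_borel vimage_def)

lemma measurable_homography [measurable]:
  "(\<lambda>(g, v). homography g v) \<in> GL2 \<Otimes>\<^sub>M proj_borel \<rightarrow>\<^sub>M proj_borel"
proof -
  let ?x = "case_option 0 (\<lambda>x. x)"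
  have [measurable]: "(\<lambda>g. g $ i $ j) \<in> GL2 \<rightarrow>\<^sub>M borel" for i j :: 2
    by (rule measurable_compose[OF measurable_GL2_borel measurable_matrix_component])
  have eq: "(\<lambda>(g, v). homography g v) = (\<lambda>p.
     if snd p = None then (if fst p $ 2 $ 1 = 0 then None else Some (fst p $ 1 $ 1 / fst p $ 2 $ 1))
     else if fst p $ 2 $ 1 * ?x (snd p) + fst p $ 2 $ 2 = 0 then None
     else Some ((fst p $ 1 $ 1 * ?x (snd p) + fst p $ 1 $ 2) / (fst p $ 2 $ 1 * ?x (snd p) + fst p $ 2 $ 2)))"
    by (auto simp: homography_def fun_eq_iff split: option.split)
  show ?thesis unfolding eq by measurable
qed

lemma measurable_proj_inverse [measurable]: "proj_inverse \<in> proj_borel \<rightarrow>\<^sub>M proj_borel"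
proof -
  let ?x = "case_option 0 (\<lambda>x. x)"
  have eq: "proj_inverse = (\<lambda>p. if p = None then Some 0 else if ?x p = 0 then None else Some (1 / ?x p))"
    by (auto simp: proj_inverse_def fun_eq_iff split: option.split)
  show ?thesis unfolding eq by measurable
qed

lemma sets_xi [simp, measurable_cong]: "sets xi = sets proj_borel"
  and space_xi [simp]: "space xi = UNIV"
  by (simp_all add: xi_def minkowski_proj_def)

lemma nn_integral_xi:
  assumes [measurable]: "h \<in> borel_measurable proj_borel"
  shows "(\<integral>\<^sup>+p. h p \<partial>xi) = ((\<integral>\<^sup>+x. h (Some x) \<partial>minkowski_measure)
    + (\<integral>\<^sup>+x. h (proj_inverse (Some x)) \<partial>minkowski_measure)) / 2"
proof -
  have [measurable]: "Some \<in> minkowski_measure \<rightarrow>\<^sub>M proj_borel" by measurable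
  show ?thesis
    unfolding xi_def minkowski_proj_def
    by (subst nn_integral_half_sum) (simp_all add: nn_integral_distr)
qed

lemma prob_space_xi: "prob_space xi"
proof (rule prob_spaceI)
  have "emeasure xi (space xi) = (\<integral>\<^sup>+p. 1 \<partial>xi)" by simp
  also have "\<dots> = 1" by (subst nn_integral_xi) (auto simp: minkowski.emeasure_space_1[simplified] simp flip: one_add_one)
  finally show "emeasure xi (space xi) = 1" .
qed

lemma homography_A0_A1:
  assumes "0 < x"
  shows "homography A0 (Some x) = proj_inverse (Some (1 / (1 + x)))"
    "homography A0 (proj_inverse (Some x)) = proj_inverse (Some (x / (1 + x)))"
    "homography A1 (Some x) = Some (x / (1 + x))"
    "homography A1 (proj_inverse (Some x)) = Some (1 / (1 + x))"
  using assms by (auto simp: homography_def proj_inverse_def A0_component A1_component field_simps)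

text \<open>By \<open>homography_A0_A1\<close>, \<open>A1\<close> maps the two parts of
  \<open>xi\<close> to the two branch images of \<open>minkowski_measure\<close>, and
  \<open>A0\<close> maps them to the inverted branch images. Self-similarity reassembles one part of
  \<open>xi\<close> from each matrix.\<close>

lemma is_stationary_eta_xi: "is_stationary eta xi"
  unfolding is_stationary_def
proof (intro conjI prob_space_xi)
  interpret xi: prob_space xi by (rule prob_space_xi)
  have hom[measurable]: "(\<lambda>(g, v). homography g v) \<in> eta \<Otimes>\<^sub>M xi \<rightarrow>\<^sub>M proj_borel" by measurable
  show "distr (eta \<Otimes>\<^sub>M xi) proj_borel (\<lambda>(g, v). homography g v) = xi"
  proof (rule measure_eqI)
    fix A assume "A \<in> sets (distr (eta \<Otimes>\<^sub>M xi) proj_borel (\<lambda>(g, v). homography g v))"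
    then have A[measurable]: "A \<in> sets proj_borel" by simp
    define h :: "real option \<Rightarrow> ennreal" where "h = indicator A"
    have [measurable]: "h \<in> borel_measurable proj_borel" unfolding h_def by measurable
    define k l where "k x = h (Some x)" and "l x = h (proj_inverse (Some x))" for x
    have [measurable]: "k \<in> borel_measurable borel" "l \<in> borel_measurable borel"
      unfolding k_def l_def by measurable
    have A0_meas: "(\<lambda>v. h (homography g v)) \<in> borel_measurable proj_borel" if "g \<in> space GL2" for g
      using measurable_compose[OF measurable_Pair2[OF measurable_homography that], of h borel] by simp
    have xi: "(\<integral>\<^sup>+v. h (homography g v) \<partial>xi) = ((\<integral>\<^sup>+x. h (homography g (Some x)) \<partial>minkowski_measure)
        + (\<integral>\<^sup>+x. h (homography g (proj_inverse (Some x))) \<partial>minkowski_measure)) / 2" if "g \<in> space GL2" for g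
      using A0_meas[OF that] by (rule nn_integral_xi)
    have "emeasure (distr (eta \<Otimes>\<^sub>M xi) proj_borel (\<lambda>(g, v). homography g v)) A
        = (\<integral>\<^sup>+p. h p \<partial>distr (eta \<Otimes>\<^sub>M xi) proj_borel (\<lambda>(g, v). homography g v))"
      by (simp add: h_def)
    also have "\<dots> = (\<integral>\<^sup>+p. h (homography (fst p) (snd p)) \<partial>(eta \<Otimes>\<^sub>M xi))"
      by (subst nn_integral_distr[OF hom]) (auto simp: split_beta')
    also have "\<dots> = (\<integral>\<^sup>+g. \<integral>\<^sup>+v. h (homography g v) \<partial>xi \<partial>eta)"
      by (subst xi.nn_integral_fst[symmetric]) (auto simp: split_beta')
    also have "\<dots> = ((\<integral>\<^sup>+v. h (homography A0 v) \<partial>xi) + (\<integral>\<^sup>+v. h (homography A1 v) \<partial>xi)) / 2"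
      by (rule nn_integral_eta) measurable
    also have "(\<integral>\<^sup>+v. h (homography A0 v) \<partial>xi) = ((\<integral>\<^sup>+x. l (1 / (1 + x)) \<partial>minkowski_measure)
        + (\<integral>\<^sup>+x. l (x / (1 + x)) \<partial>minkowski_measure)) / 2"
      unfolding xi[OF A0_A1_in_GL2(1)] l_def
      by (intro arg_cong2[where f="\<lambda>a b. (a + b) / 2"] nn_integral_cong_AE AE_minkowskiI) (simp_all add: homography_A0_A1)
    also have "\<dots> = (\<integral>\<^sup>+x. l x \<partial>minkowski_measure)"
      by (subst nn_integral_minkowski[of l]) (simp_all add: add.commute)
    also have "(\<integral>\<^sup>+v. h (homography A1 v) \<partial>xi) = ((\<integral>\<^sup>+x. k (x / (1 + x)) \<partial>minkowski_measure)
        + (\<integral>\<^sup>+x. k (1 / (1 + x)) \<partial>minkowski_measure)) / 2"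
      unfolding xi[OF A0_A1_in_GL2(2)] k_def
      by (intro arg_cong2[where f="\<lambda>a b. (a + b) / 2"] nn_integral_cong_AE AE_minkowskiI) (simp_all add: homography_A0_A1)
    also have "\<dots> = (\<integral>\<^sup>+x. k x \<partial>minkowski_measure)"
      by (rule nn_integral_minkowski[symmetric]) measurable
    also have "((\<integral>\<^sup>+x. l x \<partial>minkowski_measure) + (\<integral>\<^sup>+x. k x \<partial>minkowski_measure)) / 2 = (\<integral>\<^sup>+p. h p \<partial>xi)"
      unfolding k_def l_def by (subst nn_integral_xi) (simp_all add: add.commute)
    finally show "emeasure (distr (eta \<Otimes>\<^sub>M xi) proj_borel (\<lambda>(g, v). homography g v)) A = emeasure xi A"
      by (simp add: h_def)
  qed simp
qed simp

section \<open>Almost sure growth of Farey denominators\<close>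

lemma borel_measurable_farey [measurable]: "farey \<in> borel_measurable borel"
  unfolding farey_def[abs_def] by measurable

lemma farey_branch:
  assumes "0 < x" "x < 1"
  shows "farey (x / (1 + x)) = x" "farey (1 / (1 + x)) = x"
proof -
  have eq: "1 - x / (1 + x) = 1 / (1 + x)" "1 - 1 / (1 + x) = x / (1 + x)"
    "(x / (1 + x)) / (1 / (1 + x)) = x" "(1 / (1 + x)) / (x / (1 + x)) = 1 / x"
    using assms by (simp_all add: field_simps)
  have "x \<le> 1 / x" using assms by (simp add: field_simps mult_le_one)
  then show "farey (x / (1 + x)) = x" "farey (1 / (1 + x)) = x"
    unfolding farey_def eq by simp_all
qed

text \<open>\<open>farey\<close> undoes both branches, so self-similarity becomes
  invariance.\<close>

lemma nn_integral_farey: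
  assumes [measurable]: "g \<in> borel_measurable borel"
  shows "(\<integral>\<^sup>+x. g (farey x) \<partial>minkowski_measure) = (\<integral>\<^sup>+x. g x \<partial>minkowski_measure)"
proof -
  have "(\<integral>\<^sup>+x. g (farey (x / (1 + x))) \<partial>minkowski_measure) = (\<integral>\<^sup>+x. g x \<partial>minkowski_measure)"
    "(\<integral>\<^sup>+x. g (farey (1 / (1 + x))) \<partial>minkowski_measure) = (\<integral>\<^sup>+x. g x \<partial>minkowski_measure)"
    by (intro nn_integral_cong_AE AE_minkowskiI; simp add: farey_branch)+
  then show ?thesis
    by (subst nn_integral_minkowski) (simp_all add: mult_2[symmetric] ennreal_mult_divide_eq mult.commute[of 2])
qed

lemma borel_measurable_farey_funpow [measurable]: "(farey ^^ n) \<in> borel_measurable borel"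
  by (induction n) (auto intro: measurable_comp borel_measurable_farey simp: id_def)

lemma nn_integral_farey_funpow:
  assumes "g \<in> borel_measurable borel"
  shows "(\<integral>\<^sup>+x. g ((farey ^^ n) x) \<partial>minkowski_measure) = (\<integral>\<^sup>+x. g x \<partial>minkowski_measure)"
proof (induction n)
  case (Suc n)
  have "(\<lambda>x. g ((farey ^^ n) x)) \<in> borel_measurable borel"
    by (rule measurable_compose[OF borel_measurable_farey_funpow assms])
  from nn_integral_farey[OF this] show ?case using Suc by (simp add: funpow_swap1)
qed simp

text \<open>\<open>farey_den n (1, 1) x\<close> are the denominators of the images of \<open>0\<close> and \<open>1\<close> under the inverse
  branch of \<open>farey ^^ n\<close> whose range contains \<open>x\<close>.\<close>

definition farey_den_step :: "real \<Rightarrow> real \<times> real \<Rightarrow> real \<times> real" where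
  "farey_den_step x w = (if x < 1 / 2 then fst w else snd w, fst w + snd w)"

primrec farey_den :: "nat \<Rightarrow> real \<times> real \<Rightarrow> real \<Rightarrow> real \<times> real" where
  "farey_den 0 w x = w"
| "farey_den (Suc n) w x = farey_den n (farey_den_step x w) (farey x)"

text \<open>The definition peels off the first Farey step, as integration by self-similarity
  requires; this recursion appends the last one, as the refinement of cylinders requires.\<close>

lemma farey_den_Suc': "farey_den (Suc n) w x = farey_den_step ((farey ^^ n) x) (farey_den n w x)"
  by (induction n arbitrary: w x) (simp_all add: funpow_swap1)

lemma measurable_farey_den:
  assumes "f \<in> M \<rightarrow>\<^sub>M borel \<Otimes>\<^sub>M borel" "h \<in> borel_measurable M"
  shows "(\<lambda>z. farey_den n (f z) (h z)) \<in> M \<rightarrow>\<^sub>M borel \<Otimes>\<^sub>M borel"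
  using assms
proof (induction n arbitrary: f h)
  case (Suc n)
  note [measurable] = Suc.prems
  have "(\<lambda>z. farey_den_step (h z) (f z)) \<in> M \<rightarrow>\<^sub>M borel \<Otimes>\<^sub>M borel"
    unfolding farey_den_step_def by measurable
  moreover have "(\<lambda>z. farey (h z)) \<in> borel_measurable M" by measurable
  ultimately show ?case using Suc.IH by simp
qed simp

lemma stern_avg_funpow: "stern_avg f N = (stern_step ^^ N) f 1 1"
  by (induction N arbitrary: f) (simp_all add: stern_avg_0 stern_avg_Suc funpow_swap1)

text \<open>Symmetry of \<open>g\<close> enters because the branch \<open>1 / (1 + x)\<close> yields
  \<open>(v, u + v)\<close> where the Stern tree has \<open>(u + v, v)\<close>: the denominators are
  ordered by the images of 0 and 1.\<close>

lemma nn_integral_farey_den: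
  assumes g_nonneg: "\<And>a b. 0 \<le> g a b" and g_sym: "\<And>a b. g a b = g b a"
    and g_meas: "(\<lambda>(a, b). g a b) \<in> borel_measurable (borel \<Otimes>\<^sub>M borel)"
  shows "(\<integral>\<^sup>+x. ennreal (case_prod g (farey_den n (1, 1) x)) \<partial>minkowski_measure) = ennreal (stern_avg g n)"
proof -
  have S: "0 \<le> (stern_step ^^ n) g a b \<and> (stern_step ^^ n) g a b = (stern_step ^^ n) g b a" for n a b
  proof (induction n arbitrary: a b)
    case (Suc n)
    have "(stern_step ^^ n) g a (a + b) = (stern_step ^^ n) g (a + b) a"
      "(stern_step ^^ n) g (a + b) b = (stern_step ^^ n) g b (a + b)"
      using Suc by blast+
    moreover have "0 \<le> (stern_step ^^ n) g c d" for c d using Suc by blast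
    ultimately show ?case
      by (simp add: stern_step_def[of "(stern_step ^^ n) g"] add.commute)
  qed (use g_nonneg g_sym in auto)
  have "(\<integral>\<^sup>+x. ennreal (case_prod g (farey_den n (u, v) x)) \<partial>minkowski_measure) = ennreal ((stern_step ^^ n) g u v)" for u v
  proof (induction n arbitrary: u v)
    case 0
    then show ?case by (simp add: nn_integral_const minkowski.emeasure_space_1[simplified])
  next
    case (Suc n)
    let ?h = "\<lambda>x. ennreal (case_prod g (farey_den (Suc n) (u, v) x))"
    have "(\<lambda>x. farey_den (Suc n) (u, v) x) \<in> borel \<rightarrow>\<^sub>M borel \<Otimes>\<^sub>M borel"
      by (rule measurable_farey_den) simp_all
    from measurable_compose[OF this g_meas] have h: "?h \<in> borel_measurable borel"
      by simp
    have "(\<integral>\<^sup>+x. ?h (x / (1 + x)) \<partial>minkowski_measure)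
        = (\<integral>\<^sup>+x. ennreal (case_prod g (farey_den n (u, u + v) x)) \<partial>minkowski_measure)"
    proof (intro nn_integral_cong_AE AE_minkowskiI)
      fix x :: real assume x: "0 < x" "x < 1"
      then have "x / (1 + x) < 1 / 2" by (simp add: field_simps)
      then show "?h (x / (1 + x)) = ennreal (case_prod g (farey_den n (u, u + v) x))"
        using x by (simp add: farey_branch farey_den_step_def)
    qed
    moreover have "(\<integral>\<^sup>+x. ?h (1 / (1 + x)) \<partial>minkowski_measure)
        = (\<integral>\<^sup>+x. ennreal (case_prod g (farey_den n (v, u + v) x)) \<partial>minkowski_measure)"
    proof (intro nn_integral_cong_AE AE_minkowskiI)
      fix x :: real assume x: "0 < x" "x < 1"
      then have "\<not> 1 / (1 + x) < 1 / 2" by (simp add: field_simps)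
      then show "?h (1 / (1 + x)) = ennreal (case_prod g (farey_den n (v, u + v) x))"
        using x by (simp add: farey_branch farey_den_step_def)
    qed
    ultimately have "(\<integral>\<^sup>+x. ?h x \<partial>minkowski_measure)
        = (ennreal ((stern_step ^^ n) g u (u + v)) + ennreal ((stern_step ^^ n) g v (u + v))) / 2"
      using Suc.IH by (subst nn_integral_minkowski[OF h]) simp
    also have "\<dots> = ennreal ((stern_step ^^ Suc n) g u v)"
      using S[of n] by (simp add: stern_step_def[of "(stern_step ^^ n) g"] ennreal_divide_numeral flip: ennreal_plus)
    finally show ?case .
  qed
  then show ?thesis by (simp add: stern_avg_funpow)
qed

text \<open>The weights \<open>1 / (n + 1)\<^sup>2\<close> are summable, so the weighted series has
  finite expectation; hence it converges almost surely and its terms tend to 0.\<close>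

lemma AE_minkowski_LIMSEQ_zero:
  assumes [measurable]: "\<And>n. h n \<in> borel_measurable borel" and nonneg: "\<And>n x. 0 \<le> h n x"
    and bound: "\<And>n. (\<integral>\<^sup>+x. ennreal (h n x) \<partial>minkowski_measure) \<le> ennreal C"
  shows "AE x in minkowski_measure. (\<lambda>n. h n x / (real n + 1)\<^sup>2) \<longlonglongrightarrow> 0"
proof -
  define w :: "nat \<Rightarrow> real" where "w n = 1 / (real n + 1)\<^sup>2" for n
  have w_nonneg: "0 \<le> w n" for n by (simp add: w_def)
  have w_summable: "summable w"
    using inverse_power_summable[of 2, where 'a=real] summable_Suc_iff[of "\<lambda>n. inverse (real n ^ 2)"]
    by (simp add: w_def[abs_def] divide_inverse add.commute)
  have "(\<integral>\<^sup>+x. (\<Sum>n. ennreal (w n * h n x)) \<partial>minkowski_measure) = (\<Sum>n. \<integral>\<^sup>+x. ennreal (w n * h n x) \<partial>minkowski_measure)"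
    by (rule nn_integral_suminf) measurable
  also have "\<dots> \<le> (\<Sum>n. ennreal (w n * C))"
  proof (rule suminf_le)
    fix n
    have "(\<integral>\<^sup>+x. ennreal (w n * h n x) \<partial>minkowski_measure) = ennreal (w n) * (\<integral>\<^sup>+x. ennreal (h n x) \<partial>minkowski_measure)"
      using w_nonneg nonneg by (simp add: ennreal_mult nn_integral_cmult)
    also have "\<dots> \<le> ennreal (w n) * ennreal C" using bound by (rule mult_left_mono) simp
    finally show "(\<integral>\<^sup>+x. ennreal (w n * h n x) \<partial>minkowski_measure) \<le> ennreal (w n * C)"
      using w_nonneg by (simp add: ennreal_mult')
  qed auto
  also have "\<dots> \<le> (\<Sum>n. ennreal (w n * \<bar>C\<bar>))"
    using w_nonneg by (intro suminf_le ennreal_leI mult_left_mono) auto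
  also have "\<dots> < \<infinity>"
    using w_summable w_nonneg by (simp add: less_top[symmetric] ennreal_suminf_neq_top summable_mult2)
  finally have "AE x in minkowski_measure. (\<Sum>n. ennreal (w n * h n x)) \<noteq> \<infinity>"
    by (intro nn_integral_PInf_AE) auto
  then show ?thesis
  proof eventually_elim
    case (elim x)
    then have "summable (\<lambda>n. w n * h n x)"
      using w_nonneg nonneg by (intro summable_suminf_not_top) auto
    then show ?case using summable_LIMSEQ_zero by (simp add: w_def)
  qed
qed

text \<open>By invariance the mean does not depend on \<open>n\<close>. Since
  \<open>(farey ^^ n) x\<close> gives the relative position of \<open>x\<close> in its cylinder,
  \<open>x\<close> is almost surely not too close to the ends.\<close>

lemma AE_farey_orbit_boundary:
  "AE x in minkowski_measure. (\<lambda>n. (\<bar>1 / (farey ^^ n) x\<bar> + \<bar>1 / (1 - (farey ^^ n) x)\<bar>) / (real n + 1)\<^sup>2) \<longlonglongrightarrow> 0"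
proof (rule AE_minkowski_LIMSEQ_zero[where C="2 * log_defect"])
  fix n
  have le: "(\<integral>\<^sup>+y. ennreal \<bar>1 / y\<bar> \<partial>minkowski_measure) \<le> ennreal log_defect"
  proof -
    have "(\<integral>\<^sup>+y. ennreal \<bar>1 / y\<bar> \<partial>minkowski_measure) \<le> (\<integral>\<^sup>+y. ennreal (1 / y\<^sup>2) \<partial>minkowski_measure)"
      by (intro nn_integral_mono_AE AE_minkowskiI ennreal_leI)
        (auto simp: power2_eq_square field_simps)
    also have "\<dots> = ennreal log_defect"
      unfolding log_defect_def by (rule nn_integral_eq_integral[OF integrable_inverse_square_minkowski]) simp
    finally show ?thesis .
  qed
  have "(\<integral>\<^sup>+x. ennreal (\<bar>1 / (farey ^^ n) x\<bar> + \<bar>1 / (1 - (farey ^^ n) x)\<bar>) \<partial>minkowski_measure)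
      = (\<integral>\<^sup>+y. ennreal (\<bar>1 / y\<bar> + \<bar>1 / (1 - y)\<bar>) \<partial>minkowski_measure)"
    by (rule nn_integral_farey_funpow[of "\<lambda>y. ennreal (\<bar>1 / y\<bar> + \<bar>1 / (1 - y)\<bar>)"]) measurable
  also have "\<dots> = (\<integral>\<^sup>+y. ennreal \<bar>1 / y\<bar> \<partial>minkowski_measure) + (\<integral>\<^sup>+y. ennreal \<bar>1 / (1 - y)\<bar> \<partial>minkowski_measure)"
    by (simp add: nn_integral_add)
  also have "(\<integral>\<^sup>+y. ennreal \<bar>1 / (1 - y)\<bar> \<partial>minkowski_measure) = (\<integral>\<^sup>+y. ennreal \<bar>1 / y\<bar> \<partial>minkowski_measure)"
    by (rule nn_integral_minkowski_reflect[of "\<lambda>y. ennreal \<bar>1 / y\<bar>"]) measurable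
  also have "(\<integral>\<^sup>+y. ennreal \<bar>1 / y\<bar> \<partial>minkowski_measure) + (\<integral>\<^sup>+y. ennreal \<bar>1 / y\<bar> \<partial>minkowski_measure)
      \<le> ennreal log_defect + ennreal log_defect"
    by (intro add_mono le)
  also have "\<dots> = ennreal (2 * log_defect)"
    using log_defect_nonneg by (simp flip: ennreal_plus)
  finally show "(\<integral>\<^sup>+x. ennreal (\<bar>1 / (farey ^^ n) x\<bar> + \<bar>1 / (1 - (farey ^^ n) x)\<bar>) \<partial>minkowski_measure)
      \<le> ennreal (2 * log_defect)" .
  show "(\<lambda>x. \<bar>1 / (farey ^^ n) x\<bar> + \<bar>1 / (1 - (farey ^^ n) x)\<bar>) \<in> borel_measurable borel"
    by (rule measurable_compose[OF borel_measurable_farey_funpow]) measurable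
qed simp

lemma measurable_case_prod_farey_den:
  assumes "(\<lambda>(a, b). g a b) \<in> borel_measurable (borel \<Otimes>\<^sub>M borel)"
  shows "(\<lambda>x. case_prod g (farey_den n w x)) \<in> borel_measurable borel"
  by (rule measurable_compose[OF measurable_farey_den assms]) (simp_all add: space_pair_measure)

lemma AE_farey_den_ratio:
  "AE x in minkowski_measure. (\<lambda>n. (case farey_den n (1, 1) x of (u, v) \<Rightarrow> \<bar>u / v\<bar> + \<bar>v / u\<bar>) / (real n + 1)\<^sup>2) \<longlonglongrightarrow> 0"
proof (rule AE_minkowski_LIMSEQ_zero[where C=3])
  have meas: "(\<lambda>(u, v). \<bar>u / v\<bar> + \<bar>v / u\<bar>) \<in> borel_measurable (borel \<Otimes>\<^sub>M borel :: (real \<times> real) measure)"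
    by measurable
  show "(\<lambda>x. case farey_den n (1, 1) x of (u, v) \<Rightarrow> \<bar>u / v\<bar> + \<bar>v / u\<bar>) \<in> borel_measurable borel" for n
    by (rule measurable_case_prod_farey_den[OF meas])
  fix n
  have "(\<integral>\<^sup>+x. ennreal (case farey_den n (1, 1) x of (u, v) \<Rightarrow> \<bar>u / v\<bar> + \<bar>v / u\<bar>) \<partial>minkowski_measure)
      = ennreal (stern_avg (\<lambda>u v. \<bar>u / v\<bar> + \<bar>v / u\<bar>) n)"
    by (rule nn_integral_farey_den[OF _ _ meas]) (auto simp: add.commute)
  also have "stern_avg (\<lambda>u v. \<bar>u / v\<bar> + \<bar>v / u\<bar>) n = stern_avg (\<lambda>u v. u / v + v / u) n"
    by (rule stern_avg_cong) simp
  finally show "(\<integral>\<^sup>+x. ennreal (case farey_den n (1, 1) x of (u, v) \<Rightarrow> \<bar>u / v\<bar> + \<bar>v / u\<bar>) \<partial>minkowski_measure) \<le> ennreal 3"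
    by (simp only: ennreal_leI stern_avg_ratio_le)
qed (auto split: prod.split)

text \<open>Dividing the fourth power by \<open>(n + 1)\<^sup>2\<close> makes its mean bounded; a
  second such factor turns it into the fourth power of the quotient in question.\<close>

lemma AE_farey_den_growth:
  "AE x in minkowski_measure. (\<lambda>n. (case farey_den n (1, 1) x of (u, v) \<Rightarrow> centred_potential n u v) / (real n + 1)) \<longlonglongrightarrow> 0"
proof -
  have "AE x in minkowski_measure. (\<lambda>n. (case farey_den n (1, 1) x of (u, v) \<Rightarrow> (centred_potential n u v) ^ 4 / (real n + 1)\<^sup>2)
      / (real n + 1)\<^sup>2) \<longlonglongrightarrow> 0"
  proof (rule AE_minkowski_LIMSEQ_zero[where C="3 * log_defect ^ 4"])
    have meas: "(\<lambda>(u, v). (centred_potential n u v) ^ 4 / (real n + 1)\<^sup>2) \<in> borel_measurable (borel \<Otimes>\<^sub>M borel)" for n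
      unfolding centred_potential_def log_potential_def split_beta' by measurable
    show "(\<lambda>x. case farey_den n (1, 1) x of (u, v) \<Rightarrow> (centred_potential n u v) ^ 4 / (real n + 1)\<^sup>2) \<in> borel_measurable borel" for n
      by (rule measurable_case_prod_farey_den[OF meas])
    fix n
    have "(\<integral>\<^sup>+x. ennreal (case farey_den n (1, 1) x of (u, v) \<Rightarrow> (centred_potential n u v) ^ 4 / (real n + 1)\<^sup>2) \<partial>minkowski_measure)
        = ennreal (stern_avg (\<lambda>u v. (centred_potential n u v) ^ 4 / (real n + 1)\<^sup>2) n)"
      by (rule nn_integral_farey_den[OF _ _ meas])
        (auto simp: centred_potential_def log_potential_commute zero_le_even_power)
    also have "stern_avg (\<lambda>u v. (centred_potential n u v) ^ 4 / (real n + 1)\<^sup>2) n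
        = 1 / (real n + 1)\<^sup>2 * stern_avg (\<lambda>u v. (centred_potential n u v) ^ 4) n"
      unfolding stern_avg_cmult[symmetric] by simp
    also have "\<dots> \<le> 1 / (real n + 1)\<^sup>2 * (3 * log_defect ^ 4 * (real n)\<^sup>2)"
      by (intro mult_left_mono stern_avg_centred_fourth_le) simp
    also have "\<dots> = 3 * log_defect ^ 4 * ((real n)\<^sup>2 / (real n + 1)\<^sup>2)" by simp
    also have "\<dots> \<le> 3 * log_defect ^ 4 * 1"
      by (intro mult_left_mono) (auto simp: zero_le_even_power power_mono)
    finally show "(\<integral>\<^sup>+x. ennreal (case farey_den n (1, 1) x of (u, v) \<Rightarrow> (centred_potential n u v) ^ 4 / (real n + 1)\<^sup>2) \<partial>minkowski_measure)
        \<le> ennreal (3 * log_defect ^ 4)"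
      by (simp add: ennreal_leI)
  qed (auto split: prod.split simp: zero_le_even_power)
  then show ?thesis
  proof eventually_elim
    case (elim x)
    define z where "z n = (case farey_den n (1, 1) x of (u, v) \<Rightarrow> centred_potential n u v) / (real n + 1)" for n
    have "(case farey_den n (1, 1) x of (u, v) \<Rightarrow> (centred_potential n u v) ^ 4 / (real n + 1)\<^sup>2) / (real n + 1)\<^sup>2 = z n ^ 4" for n
      by (simp add: z_def power_divide split: prod.split flip: power_add)
    then have "(\<lambda>n. z n ^ 4) \<longlonglongrightarrow> 0" using elim by simp
    then have "(\<lambda>n. root 4 (z n ^ 4)) \<longlonglongrightarrow> root 4 0" by (rule tendsto_real_root)
    moreover have "root 4 (z n ^ 4) = \<bar>z n\<bar>" for n
      using real_root_power_cancel[of 4 "\<bar>z n\<bar>"] by simp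
    ultimately have "(\<lambda>n. \<bar>z n\<bar>) \<longlonglongrightarrow> 0" by simp
    then have "z \<longlonglongrightarrow> 0" by (simp add: tendsto_rabs_zero_iff)
    then show ?case unfolding z_def .
  qed
qed

section \<open>The Lipschitz exponent\<close>

lemma farey_unit_irrational_cases:
  assumes "0 < y" "y < 1" "y \<notin> \<rat>"
  obtains "y < 1 / 2" "0 < farey y" "farey y < 1" "farey y \<notin> \<rat>" "y = farey y / (1 + farey y)"
    | "\<not> y < 1 / 2" "0 < farey y" "farey y < 1" "farey y \<notin> \<rat>" "y = 1 / (1 + farey y)"
proof -
  have "y \<in> unit_irrationals" using assms by auto
  then show thesis
  proof (cases rule: unit_irrationals_cases)
    case (1 z)
    from 1(1) have z: "0 < z" "z < 1" "z \<notin> \<rat>" by (auto simp: less_le)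
    have f: "farey y = z" unfolding 1(2) using z by (intro farey_branch)
    show thesis by (rule that(1)[unfolded f, OF 1(3) z 1(2)])
  next
    case (2 z)
    from 2(1) have z: "0 < z" "z < 1" "z \<notin> \<rat>" by (auto simp: less_le)
    have f: "farey y = z" unfolding 2(2) using z by (intro farey_branch)
    have "\<not> y < 1 / 2" using 2(3) by simp
    then show thesis by (rule that(2)[unfolded f, OF _ z 2(2)])
  qed
qed

text \<open>The fraction in \<open>t\<close> is the inverse branch of \<open>farey ^^ n\<close>
  whose range contains \<open>x\<close>, with \<open>p\<close> and \<open>q\<close> the numerators
  that belong to \<open>u\<close> and \<open>v\<close>. The invariant records its determinant, that
  it sends \<open>y n\<close> to \<open>x\<close>, and that \<open>question_mark\<close> is an
  affine copy of itself on the cylinder; the sign of \<open>s\<close> is the orientation of the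
  branch.\<close>

lemma farey_cylinder_affine:
  assumes x: "0 < x" "x < 1" "x \<notin> \<rat>"
  defines "y n \<equiv> (farey ^^ n) x"
  shows "0 < y n \<and> y n < 1 \<and> y n \<notin> \<rat> \<and> (case farey_den n (1, 1) x of (u, v) \<Rightarrow> 1 \<le> u \<and> 1 \<le> v \<and>
    (\<exists>p q c s. \<bar>q * u - p * v\<bar> = 1 \<and> x * ((1 - y n) * u + y n * v) = (1 - y n) * p + y n * q \<and> \<bar>s\<bar> = (1 / 2) ^ n \<and>
      (\<forall>t\<in>{0..1}. question_mark (((1 - t) * p + t * q) / ((1 - t) * u + t * v)) = c + s * question_mark t)))"
proof (induction n)
  case 0
  have "\<exists>p q c s. \<bar>q * 1 - p * 1\<bar> = (1 :: real) \<and> x * ((1 - x) * 1 + x * 1) = (1 - x) * p + x * q \<and> \<bar>s\<bar> = (1 :: real) \<and>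
      (\<forall>t\<in>{0..1}. question_mark (((1 - t) * p + t * q) / ((1 - t) * 1 + t * 1)) = c + s * question_mark t)"
    by (rule exI[of _ 0], rule exI[of _ 1], rule exI[of _ 0], rule exI[of _ 1]) simp
  then show ?case using x by (simp add: y_def)
next
  case (Suc n)
  obtain u v where uv: "farey_den n (1, 1) x = (u, v)" by fastforce
  from Suc uv obtain p q c s where *: "1 \<le> u" "1 \<le> v" "\<bar>q * u - p * v\<bar> = 1"
    "x * ((1 - y n) * u + y n * v) = (1 - y n) * p + y n * q" "\<bar>s\<bar> = (1 / 2) ^ n"
    "\<And>t. t \<in> {0..1} \<Longrightarrow> question_mark (((1 - t) * p + t * q) / ((1 - t) * u + t * v)) = c + s * question_mark t"
    by auto
  have y: "0 < y n" "y n < 1" "y n \<notin> \<rat>" using Suc by auto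
  have y_Suc: "y (Suc n) = farey (y n)" by (simp add: y_def)
  define z where "z = y (Suc n)"
  from y show ?case
  proof (cases rule: farey_unit_irrational_cases)
    case 1
    then have z: "0 < z" "z < 1" "z \<notin> \<rat>" "y n = z / (1 + z)" by (simp_all add: z_def y_Suc)
    have den: "farey_den (Suc n) (1, 1) x = (u, u + v)"
      using 1 by (simp add: farey_den_Suc' uv farey_den_step_def y_def del: farey_den.simps)
    have lin: "(1 - t / (1 + t)) * a + t / (1 + t) * b = ((1 - t) * a + t * (a + b)) / (1 + t)"
      if "t \<ge> 0" for t a b :: real
      using that by (simp add: divide_simps) (simp add: algebra_simps)
    have "question_mark (((1 - t) * p + t * (p + q)) / ((1 - t) * u + t * (u + v))) = c + s / 2 * question_mark t"
      if t: "t \<in> {0..1}" for t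
    proof -
      have t0: "t \<ge> 0" and ft: "t / (1 + t) \<in> {0..1}" using t by auto
      show ?thesis
        using *(6)[OF ft] t unfolding lin[OF t0] question_mark_branches[OF t] by simp
    qed
    moreover have "x * ((1 - z) * u + z * (u + v)) = (1 - z) * p + z * (p + q)"
      using *(4) z(1) unfolding z(4) lin[OF less_imp_le[OF z(1)]] by simp
    moreover have "\<bar>(p + q) * u - p * (u + v)\<bar> = 1" using *(3) by (simp add: algebra_simps)
    moreover have "\<bar>s / 2\<bar> = (1 / 2) ^ Suc n" using *(5) by simp
    ultimately have "\<exists>p' q' c' s'. \<bar>q' * u - p' * (u + v)\<bar> = 1 \<and> x * ((1 - z) * u + z * (u + v)) = (1 - z) * p' + z * q' \<and>
        \<bar>s'\<bar> = (1 / 2) ^ Suc n \<and>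
        (\<forall>t\<in>{0..1}. question_mark (((1 - t) * p' + t * q') / ((1 - t) * u + t * (u + v))) = c' + s' * question_mark t)"
      by (rule_tac x=p in exI, rule_tac x="p + q" in exI, rule_tac x=c in exI, rule_tac x="s / 2" in exI) blast
    then show ?thesis
      unfolding den z_def[symmetric] prod.case by (intro conjI z) (use *(1,2) in simp_all)
  next
    case 2
    then have z: "0 < z" "z < 1" "z \<notin> \<rat>" "y n = 1 / (1 + z)" by (simp_all add: z_def y_Suc)
    have den: "farey_den (Suc n) (1, 1) x = (v, u + v)"
      using 2 by (simp add: farey_den_Suc' uv farey_den_step_def y_def del: farey_den.simps)
    have lin: "(1 - 1 / (1 + t)) * a + 1 / (1 + t) * b = ((1 - t) * b + t * (a + b)) / (1 + t)"
      if "t \<ge> 0" for t a b :: real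
      using that by (simp add: divide_simps) (simp add: algebra_simps)
    \<comment> \<open>\<open>1 / (1 + t)\<close> decreases and sends 0 to the old end at 1, so that
      end comes first, the offset becomes \<open>c + s\<close>, and \<open>s\<close> changes
      sign.\<close>
    have "question_mark (((1 - t) * q + t * (p + q)) / ((1 - t) * v + t * (u + v))) = (c + s) + (- s / 2) * question_mark t"
      if t: "t \<in> {0..1}" for t
    proof -
      have t0: "t \<ge> 0" and ft: "1 / (1 + t) \<in> {0..1}" using t by auto
      show ?thesis
        using *(6)[OF ft] t unfolding lin[OF t0] question_mark_branches[OF t] by (simp add: right_diff_distrib)
    qed
    moreover have "x * ((1 - z) * v + z * (u + v)) = (1 - z) * q + z * (p + q)"
      using *(4) z(1) unfolding z(4) lin[OF less_imp_le[OF z(1)]] by simp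
    moreover have "\<bar>(p + q) * v - q * (u + v)\<bar> = 1" using *(3) by (simp add: algebra_simps abs_minus_commute)
    moreover have "\<bar>- s / 2\<bar> = (1 / 2) ^ Suc n" using *(5) by simp
    ultimately have "\<exists>p' q' c' s'. \<bar>q' * v - p' * (u + v)\<bar> = 1 \<and> x * ((1 - z) * v + z * (u + v)) = (1 - z) * p' + z * q' \<and>
        \<bar>s'\<bar> = (1 / 2) ^ Suc n \<and>
        (\<forall>t\<in>{0..1}. question_mark (((1 - t) * p' + t * q') / ((1 - t) * v + t * (u + v))) = c' + s' * question_mark t)"
      by (rule_tac x=q in exI, rule_tac x="p + q" in exI, rule_tac x="c + s" in exI, rule_tac x="- s / 2" in exI) blast
    then show ?thesis
      unfolding den z_def[symmetric] prod.case by (intro conjI z) (use *(1,2) in simp_all)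
  qed
qed

text \<open>\<open>l\<close> and \<open>r\<close> are \<open>p / u\<close> and \<open>q / v\<close>,
  ordered by the sign of the determinant. Their distances from \<open>x\<close> are
  \<open>y / (D * u)\<close> and \<open>(1 - y) / (D * v)\<close> with
  \<open>D = (1 - y) * u + y * v \<le> u + v\<close>.\<close>

lemma farey_cylinder:
  assumes x: "0 < x" "x < 1" "x \<notin> \<rat>" and y: "y = (farey ^^ n) x" and uv: "farey_den n (1, 1) x = (u, v)"
  obtains l r where "1 \<le> u" "1 \<le> v" "0 < y" "y < 1"
    "question_mark r - question_mark l = (1 / 2) ^ n"
    "x - l \<ge> min y (1 - y) / (u + v)\<^sup>2" "r - x \<ge> min y (1 - y) / (u + v)\<^sup>2" "r - l = 1 / (u * v)"
proof -
  obtain p q c s where *: "0 < y" "y < 1" "1 \<le> u" "1 \<le> v" "\<bar>q * u - p * v\<bar> = 1"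
    "x * ((1 - y) * u + y * v) = (1 - y) * p + y * q" "\<bar>s\<bar> = (1 / 2) ^ n"
    "\<And>t. t \<in> {0..1} \<Longrightarrow> question_mark (((1 - t) * p + t * q) / ((1 - t) * u + t * v)) = c + s * question_mark t"
    using farey_cylinder_affine[OF x, of n] unfolding uv y[symmetric] by auto
  define D where "D = (1 - y) * u + y * v"
  have D: "0 < D" "D \<le> u + v"
  proof -
    have "(1 - y) * u > 0" "y * v > 0" "(1 - y) * u \<le> 1 * u" "y * v \<le> 1 * v"
      using * by (auto intro!: mult_right_mono)
    then show "0 < D" "D \<le> u + v" unfolding D_def by linarith+
  qed
  have x_eq: "x = ((1 - y) * p + y * q) / D" using *(6) D by (simp add: D_def field_simps)
  have diff0: "x - p / u = y * (q * u - p * v) / (D * u)"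
    unfolding x_eq using D *(3) by (simp add: field_simps) (simp add: D_def algebra_simps)
  have diff1: "q / v - x = (1 - y) * (q * u - p * v) / (D * v)"
    unfolding x_eq using D *(4) by (simp add: field_simps) (simp add: D_def algebra_simps)
  have diff: "q / v - p / u = (q * u - p * v) / (u * v)"
    using *(3,4) by (simp add: field_simps)
  have le: "min y (1 - y) / (u + v)\<^sup>2 \<le> y / (D * u)" "min y (1 - y) / (u + v)\<^sup>2 \<le> (1 - y) / (D * v)"
    unfolding power2_eq_square using D *(1-4) by (auto intro!: frac_le mult_mono)
  have jump: "question_mark (q / v) - question_mark (p / u) = s"
    using *(8)[of 0] *(8)[of 1] by (simp add: question_mark_0 question_mark_1)
  consider "q * u - p * v = 1" | "q * u - p * v = - 1" using *(5) by linarith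
  then show thesis
  proof cases
    case 1
    have "0 \<le> q / v - p / u" unfolding diff 1 using *(3,4) by simp
    then have "p / u \<le> q / v" by linarith
    \<comment> \<open>Only the modulus of \<open>s\<close> is known so far; monotonicity of
      \<open>question_mark\<close> decides its sign.\<close>
    then have s: "s = (1 / 2) ^ n" using mono_question_mark[of "p / u" "q / v"] jump *(7) by simp
    show thesis
    proof (rule that[OF *(3,4,1,2)])
      show "question_mark (q / v) - question_mark (p / u) = (1 / 2) ^ n" unfolding jump s ..
      show "min y (1 - y) / (u + v)\<^sup>2 \<le> x - p / u" unfolding diff0 1 using le(1) by simp
      show "min y (1 - y) / (u + v)\<^sup>2 \<le> q / v - x" unfolding diff1 1 using le(2) by simp
      show "q / v - p / u = 1 / (u * v)" unfolding diff 1 ..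
    qed
  next
    case 2
    have swapped: "p / u - x = y / (D * u)" "x - q / v = (1 - y) / (D * v)" "p / u - q / v = 1 / (u * v)"
      using diff0 diff1 diff unfolding 2 by linarith+
    have "0 \<le> p / u - q / v" unfolding swapped using *(3,4) by simp
    then have "q / v \<le> p / u" by linarith
    then have s: "s = - ((1 / 2) ^ n)" using mono_question_mark[of "q / v" "p / u"] jump *(7) by simp
    show thesis
    proof (rule that[OF *(3,4,1,2)])
      show "question_mark (p / u) - question_mark (q / v) = (1 / 2) ^ n" using jump s by linarith
      show "min y (1 - y) / (u + v)\<^sup>2 \<le> x - q / v" unfolding swapped by (rule le(2))
      show "min y (1 - y) / (u + v)\<^sup>2 \<le> p / u - x" unfolding swapped by (rule le(1))
      show "p / u - q / v = 1 / (u * v)" by (rule swapped(3))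
    qed
  qed
qed

text \<open>A given \<open>h\<close> is compared with two levels, \<open>n\<close> near
  \<open>- ln h / (c + d)\<close> and \<open>m\<close> near \<open>- ln h / (c - d)\<close>, chosen
  so that \<open>hi m \<le> h \<le> lo n\<close>. This puts \<open>G h\<close> between
  \<open>(1 / 2) ^ m\<close> and \<open>(1 / 2) ^ n\<close>, and then \<open>d\<close> tends to
  0.\<close>

lemma tendsto_ln_ratio_of_scales:
  fixes G :: "real \<Rightarrow> real" and lo hi :: "nat \<Rightarrow> real"
  assumes c: "c > 0" and pos: "\<And>n. lo n > 0" "\<And>n. hi n > 0"
    and lo: "(\<lambda>n. - ln (lo n) / real n) \<longlonglongrightarrow> c" and hi: "(\<lambda>n. - ln (hi n) / real n) \<longlonglongrightarrow> c"
    and upper: "\<forall>\<^sub>F n in sequentially. \<forall>h. 0 < h \<longrightarrow> h \<le> lo n \<longrightarrow> G h \<le> (1 / 2) ^ n"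
    and lower: "\<forall>\<^sub>F n in sequentially. \<forall>h. hi n \<le> h \<longrightarrow> (1 / 2) ^ n \<le> G h"
  shows "((\<lambda>h. ln (G h) / ln h) \<longlongrightarrow> ln 2 / c) (at_right 0)"
proof -
  have ln_half: "ln ((1 / 2) ^ n) = - (real n * ln 2)" for n by (simp add: ln_realpow ln_div)
  have H_top: "filterlim (\<lambda>h :: real. - ln h) at_top (at_right 0)"
    using ln_at_0 by (simp add: filterlim_uminus_at_bot[symmetric] filterlim_uminus_at_top)
  \<comment> \<open>The terms \<open>ln 2 / (- ln h)\<close> are the price of rounding the levels to
    integers.\<close>
  have step: "\<forall>\<^sub>F h in at_right 0. ln 2 / (c + d) - ln 2 / (- ln h) \<le> ln (G h) / ln h \<and>
      ln (G h) / ln h \<le> ln 2 / (c - d) + ln 2 / (- ln h)" if d: "0 < d" "d < c" for d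
  proof -
    have "\<forall>\<^sub>F n in sequentially. - ln (lo n) / real n < c + d" "\<forall>\<^sub>F n in sequentially. c - d < - ln (hi n) / real n"
      using order_tendstoD[OF lo] order_tendstoD[OF hi] d by simp_all
    then have "\<forall>\<^sub>F n in sequentially. - ln (lo n) \<le> (c + d) * real n \<and> (c - d) * real n \<le> - ln (hi n) \<and>
      (\<forall>h. 0 < h \<longrightarrow> h \<le> lo n \<longrightarrow> G h \<le> (1 / 2) ^ n) \<and> (\<forall>h. hi n \<le> h \<longrightarrow> (1 / 2) ^ n \<le> G h)"
      using upper lower eventually_gt_at_top[of 0]
      by eventually_elim (simp add: field_simps)
    then obtain N where N: "\<And>n. n \<ge> N \<Longrightarrow> - ln (lo n) \<le> (c + d) * real n \<and> (c - d) * real n \<le> - ln (hi n) \<and>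
      (\<forall>h. 0 < h \<longrightarrow> h \<le> lo n \<longrightarrow> G h \<le> (1 / 2) ^ n) \<and> (\<forall>h. hi n \<le> h \<longrightarrow> (1 / 2) ^ n \<le> G h)"
      unfolding eventually_sequentially by blast
    have "\<forall>\<^sub>F h in at_right 0. (0 :: real) < h" by (rule eventually_at_right_less)
    \<comment> \<open>The extra 1 keeps the level \<open>n\<close> at least \<open>N\<close> after
      rounding down.\<close>
    moreover have "\<forall>\<^sub>F h :: real in at_right 0. (c + d) * (real N + 1) \<le> - ln h"
      using H_top by (simp add: filterlim_at_top)
    ultimately show ?thesis
    proof eventually_elim
      case (elim h)
      define H where "H = - ln h"
      have H: "H \<ge> (c + d) * (real N + 1)" using elim by (simp add: H_def)
      have H0: "H > 0" using H d c by (intro less_le_trans[OF _ H] mult_pos_pos) auto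
      have H_c: "H / (c + d) \<ge> real N + 1" using H d c by (simp add: pos_le_divide_eq mult.commute)
      have H_d: "H / (c - d) \<ge> H / (c + d)" using H0 d by (intro divide_left_mono) auto
      define m n where "m = nat \<lceil>H / (c - d)\<rceil>" and "n = nat \<lfloor>H / (c + d)\<rfloor>"
      have m: "H / (c - d) \<le> real m" "real m \<le> H / (c - d) + 1"
        using H_c H_d unfolding m_def by linarith+
      have n: "real n \<le> H / (c + d)" "H / (c + d) - 1 \<le> real n"
        using H_c unfolding n_def by linarith+
      have "N \<le> m" "N \<le> n" using m n H_c H_d by linarith+
      have "hi m \<le> h"
      proof -
        have "H \<le> (c - d) * real m" using m(1) d by (simp add: pos_divide_le_eq mult.commute)
        also have "\<dots> \<le> - ln (hi m)" using N[OF \<open>N \<le> m\<close>] by simp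
        finally show ?thesis using elim pos by (simp add: H_def)
      qed
      then have G_lower: "(1 / 2) ^ m \<le> G h" using N[OF \<open>N \<le> m\<close>] by simp
      then have G_pos: "G h > 0" by (rule less_le_trans[rotated]) simp
      have "h \<le> lo n"
      proof -
        have "- ln (lo n) \<le> (c + d) * real n" using N[OF \<open>N \<le> n\<close>] by simp
        also have "\<dots> \<le> H" using n(1) d c by (simp add: pos_le_divide_eq mult.commute)
        finally show ?thesis using elim pos by (simp add: H_def)
      qed
      then have G_upper: "G h \<le> (1 / 2) ^ n" using N[OF \<open>N \<le> n\<close>] elim by simp
      have "- ln (G h) \<le> real m * ln 2"
        using ln_mono[OF G_lower] ln_half[of m] by simp
      also have "\<dots> \<le> (H / (c - d) + 1) * ln 2" using m(2) by (intro mult_right_mono) auto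
      finally have up: "- ln (G h) / H \<le> ln 2 / (c - d) + ln 2 / H"
        using H0 by (simp add: field_simps)
      have "(H / (c + d) - 1) * ln 2 \<le> real n * ln 2" using n(2) by (intro mult_right_mono) auto
      also have "\<dots> \<le> - ln (G h)" using ln_mono[OF G_upper G_pos] ln_half[of n] by simp
      finally have "(H / (c + d) - 1) * ln 2 / H \<le> - ln (G h) / H" using H0 by (intro divide_right_mono) auto
      moreover have "(H / (c + d) - 1) * ln 2 / H = ln 2 / (c + d) - ln 2 / H"
        using H0 by (simp add: diff_divide_distrib left_diff_distrib)
      ultimately show ?case using up by (simp add: H_def)
    qed
  qed
  have vanish: "((\<lambda>h :: real. ln 2 / (- ln h)) \<longlongrightarrow> 0) (at_right 0)"
    by (intro tendsto_divide_0[OF tendsto_const] filterlim_at_top_imp_at_infinity H_top)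
  show ?thesis
  proof (rule order_tendstoI)
    fix a assume a: "a < ln 2 / c"
    have "((\<lambda>d. ln 2 / (c + d)) \<longlongrightarrow> ln 2 / (c + 0)) (at_right 0)"
      using c by (intro tendsto_intros) auto
    then have "\<forall>\<^sub>F d in at_right 0. a < ln 2 / (c + d)" using a by (intro order_tendstoD) simp_all
    moreover have "\<forall>\<^sub>F d in at_right 0. 0 < d \<and> d < c"
      using c by (simp add: eventually_at_right_field) (meson order.refl)
    ultimately have "\<forall>\<^sub>F d in at_right 0. a < ln 2 / (c + d) \<and> 0 < d \<and> d < c" by eventually_elim simp
    then obtain d where d: "a < ln 2 / (c + d)" "0 < d" "d < c"
      using eventually_happens[of _ "at_right (0 :: real)"] by (auto simp: trivial_limit_at_right_real)
    have "\<forall>\<^sub>F h :: real in at_right 0. ln 2 / (- ln h) < ln 2 / (c + d) - a"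
      using d by (intro order_tendstoD[OF vanish]) simp
    with step[OF d(2,3)] show "\<forall>\<^sub>F h in at_right 0. a < ln (G h) / ln h"
      by eventually_elim linarith
  next
    fix a assume a: "ln 2 / c < a"
    have "((\<lambda>d. ln 2 / (c - d)) \<longlongrightarrow> ln 2 / (c - 0)) (at_right 0)"
      using c by (intro tendsto_intros) auto
    then have "\<forall>\<^sub>F d in at_right 0. ln 2 / (c - d) < a" using a by (intro order_tendstoD) simp_all
    moreover have "\<forall>\<^sub>F d in at_right 0. 0 < d \<and> d < c"
      using c by (simp add: eventually_at_right_field) (meson order.refl)
    ultimately have "\<forall>\<^sub>F d in at_right 0. ln 2 / (c - d) < a \<and> 0 < d \<and> d < c" by eventually_elim simp
    then obtain d where d: "ln 2 / (c - d) < a" "0 < d" "d < c"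
      using eventually_happens[of _ "at_right (0 :: real)"] by (auto simp: trivial_limit_at_right_real)
    have "\<forall>\<^sub>F h :: real in at_right 0. ln 2 / (- ln h) < a - ln 2 / (c - d)"
      using d by (intro order_tendstoD[OF vanish]) simp
    with step[OF d(2,3)] show "\<forall>\<^sub>F h in at_right 0. ln (G h) / ln h < a"
      by eventually_elim linarith
  qed
qed

text \<open>Both scales are \<open>1 / (u + v)\<^sup>2\<close> up to polynomial factors in
  \<open>n\<close>; as \<open>ln (u + v)\<close> grows like \<open>farey_drift * n\<close>, the
  square is the source of the factor 2 in the denominator of the exponent.\<close>

lemma ae_Lipschitz_exponent_question_mark:
  assumes drift: "farey_drift > 0"
  shows "ae_Lipschitz_exponent minkowski_measure question_mark (ln 2 / (2 * farey_drift))"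
  unfolding ae_Lipschitz_exponent_def
  using AE_minkowski_unit_irrational AE_farey_orbit_boundary AE_farey_den_ratio AE_farey_den_growth
proof eventually_elim
  case (elim x)
  note x_facts = elim
  define y u v where "y n = (farey ^^ n) x" and "u n = fst (farey_den n (1, 1) x)" and "v n = snd (farey_den n (1, 1) x)" for n
  have uv: "farey_den n (1, 1) x = (u n, v n)" for n by (simp add: u_def v_def)
  have cylinder: "\<exists>l r. 1 \<le> u n \<and> 1 \<le> v n \<and> 0 < y n \<and> y n < 1 \<and> question_mark r - question_mark l = (1 / 2) ^ n \<and>
      x - l \<ge> min (y n) (1 - y n) / (u n + v n)\<^sup>2 \<and> r - x \<ge> min (y n) (1 - y n) / (u n + v n)\<^sup>2 \<and>
      r - l = 1 / (u n * v n)" for n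
    by (rule farey_cylinder[of x "y n" n "u n" "v n"]) (use x_facts uv y_def in blast)+
  then have basic: "0 < y n" "y n < 1" "1 \<le> u n" "1 \<le> v n" for n
    by blast+
  define w where "w n = (real n + 1)\<^sup>2" for n
  have w1: "1 \<le> w n" for n by (simp add: w_def)
  \<comment> \<open>Once \<open>1 / y n\<close> and \<open>1 / (1 - y n)\<close> are below
    \<open>w n\<close>, \<open>lo n\<close> is at most the distance from \<open>x\<close> to either
    end of the cylinder. Since \<open>(u + v)\<^sup>2 / (u * v) = u / v + v / u + 2\<close>,
    \<open>hi n\<close> is at least the length of the cylinder once the ratios add up to less than
    \<open>w n\<close>.\<close>
  define lo hi where "lo n = 1 / (w n * (u n + v n)\<^sup>2)" and "hi n = (w n + 2) / (u n + v n)\<^sup>2" for n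
  have s_pos: "u n + v n > 0" for n using basic[of n] by linarith
  have lo_pos: "lo n > 0" and hi_pos: "hi n > 0" for n
    using s_pos[of n] w1[of n] by (simp_all add: lo_def hi_def)
  have growth: "(\<lambda>n. ln (u n + v n) / real n) \<longlonglongrightarrow> farey_drift"
  proof -
    define Z where "Z n = centred_potential n (u n) (v n)" for n
    have Z: "(\<lambda>n. Z n / (real n + 1)) \<longlonglongrightarrow> 0" using x_facts by (simp add: uv Z_def)
    have "(\<lambda>n. (real n + 1) / real n) \<longlonglongrightarrow> 1" by real_asymp
    from tendsto_mult[OF Z this] have "(\<lambda>n. Z n / (real n + 1) * ((real n + 1) / real n)) \<longlonglongrightarrow> 0" by simp
    then have Z: "(\<lambda>n. Z n / real n) \<longlonglongrightarrow> 0"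
      by (rule Lim_transform_eventually) (auto intro!: always_eventually simp: divide_simps)
    have "(\<lambda>n. ln (u n + v n) / real n - (Z n / real n + farey_drift)) \<longlonglongrightarrow> 0"
    proof (rule Lim_null_comparison)
      show "(\<lambda>n. (log_defect + \<bar>log_potential 1 1\<bar>) / real n) \<longlonglongrightarrow> 0" by (rule lim_const_over_n)
      show "\<forall>\<^sub>F n in sequentially. norm (ln (u n + v n) / real n - (Z n / real n + farey_drift))
          \<le> (log_defect + \<bar>log_potential 1 1\<bar>) / real n"
      proof (rule eventually_mono[OF eventually_gt_at_top[of 0]])
        fix n :: nat assume n: "n > 0"
        have "ln (u n + v n) / real n - (Z n / real n + farey_drift)
            = (ln (u n + v n) - log_potential (u n) (v n) + log_potential 1 1) / real n"
          using n by (simp add: Z_def centred_potential_def field_simps)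
        moreover have "\<bar>ln (u n + v n) - log_potential (u n) (v n) + log_potential 1 1\<bar> \<le> log_defect + \<bar>log_potential 1 1\<bar>"
          using abs_log_potential_le[of "u n" "v n"] basic[of n] s_pos[of n] by linarith
        ultimately show "norm (ln (u n + v n) / real n - (Z n / real n + farey_drift)) \<le> (log_defect + \<bar>log_potential 1 1\<bar>) / real n"
          by (simp add: abs_divide divide_right_mono)
      qed
    qed
    from tendsto_add[OF this tendsto_add[OF Z tendsto_const[of farey_drift]]] show ?thesis by simp
  qed
  show ?case
  proof (rule tendsto_ln_ratio_of_scales[OF _ lo_pos hi_pos])
    show "0 < 2 * farey_drift" using drift by simp
    have "(\<lambda>n. ln (w n) / real n) \<longlonglongrightarrow> 0" unfolding w_def by real_asymp
    from tendsto_add[OF this tendsto_mult[OF tendsto_const[of 2] growth]]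
    have "(\<lambda>n. ln (w n) / real n + 2 * (ln (u n + v n) / real n)) \<longlonglongrightarrow> 2 * farey_drift" by simp
    moreover have "ln (w n) / real n + 2 * (ln (u n + v n) / real n) = - ln (lo n) / real n" for n
      using s_pos[of n] w1[of n] by (simp add: lo_def ln_div ln_mult ln_realpow add_divide_distrib)
    ultimately show "(\<lambda>n. - ln (lo n) / real n) \<longlonglongrightarrow> 2 * farey_drift" by simp
    have "(\<lambda>n. ln (w n + 2) / real n) \<longlonglongrightarrow> 0" unfolding w_def by real_asymp
    from tendsto_diff[OF tendsto_mult[OF tendsto_const[of 2] growth] this]
    have "(\<lambda>n. 2 * (ln (u n + v n) / real n) - ln (w n + 2) / real n) \<longlonglongrightarrow> 2 * farey_drift" by simp
    moreover have "2 * (ln (u n + v n) / real n) - ln (w n + 2) / real n = - ln (hi n) / real n" for n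
      using s_pos[of n] w1[of n] by (simp add: hi_def ln_div ln_realpow diff_divide_distrib)
    ultimately show "(\<lambda>n. - ln (hi n) / real n) \<longlonglongrightarrow> 2 * farey_drift" by simp
    have "\<forall>\<^sub>F n in sequentially. (\<bar>1 / y n\<bar> + \<bar>1 / (1 - y n)\<bar>) / w n < 1"
      using x_facts by (intro order_tendstoD(2)[of _ 0]) (simp_all add: y_def w_def)
    then show "\<forall>\<^sub>F n in sequentially. \<forall>h. 0 < h \<longrightarrow> h \<le> lo n \<longrightarrow> question_mark (x + h) - question_mark (x - h) \<le> (1 / 2) ^ n"
    proof eventually_elim
      case (elim n)
      obtain l r where lr: "question_mark r - question_mark l = (1 / 2) ^ n"
        "x - l \<ge> min (y n) (1 - y n) / (u n + v n)\<^sup>2" "r - x \<ge> min (y n) (1 - y n) / (u n + v n)\<^sup>2"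
        using cylinder[of n] by blast
      have "1 / y n + 1 / (1 - y n) < w n"
        using elim basic[of n] w1[of n] by (simp add: pos_divide_less_eq)
      moreover have "1 / y n > 0" "1 / (1 - y n) > 0" using basic[of n] by simp_all
      ultimately have "1 / y n \<le> w n" "1 / (1 - y n) \<le> w n" by linarith+
      then have "1 / w n \<le> min (y n) (1 - y n)"
        using basic[of n] w1[of n] by (simp add: field_simps)
      then have "lo n \<le> min (y n) (1 - y n) / (u n + v n)\<^sup>2"
        unfolding lo_def divide_divide_eq_left[symmetric] by (rule divide_right_mono) simp
      then have "question_mark (x + h) \<le> question_mark r" "question_mark l \<le> question_mark (x - h)" if "h \<le> lo n" for h
        using that lr by (intro mono_question_mark; linarith)+
      then show ?case using lr(1) by fastforce
    qed
    have "\<forall>\<^sub>F n in sequentially. (\<bar>u n / v n\<bar> + \<bar>v n / u n\<bar>) / w n < 1"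
      using x_facts by (intro order_tendstoD(2)[of _ 0]) (simp_all add: uv w_def)
    then show "\<forall>\<^sub>F n in sequentially. \<forall>h. hi n \<le> h \<longrightarrow> (1 / 2) ^ n \<le> question_mark (x + h) - question_mark (x - h)"
    proof eventually_elim
      case (elim n)
      obtain l r where lr: "question_mark r - question_mark l = (1 / 2) ^ n"
        "x - l \<ge> min (y n) (1 - y n) / (u n + v n)\<^sup>2" "r - x \<ge> min (y n) (1 - y n) / (u n + v n)\<^sup>2" "r - l = 1 / (u n * v n)"
        using cylinder[of n] by blast
      have "min (y n) (1 - y n) / (u n + v n)\<^sup>2 \<ge> 0" using basic[of n] by simp
      then have lxr: "l \<le> x" "x \<le> r" using lr by linarith+
      have "u n / v n + v n / u n < w n"
        using elim basic[of n] w1[of n] by (simp add: pos_divide_less_eq)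
      moreover have "(u n + v n)\<^sup>2 / (u n * v n) = u n / v n + v n / u n + 2"
        using basic[of n] by (simp add: power2_eq_square field_simps)
      ultimately have "(u n + v n)\<^sup>2 / (u n * v n) \<le> w n + 2" by linarith
      then have "1 / (u n * v n) \<le> hi n"
        unfolding hi_def using s_pos[of n] basic[of n] by (simp add: field_simps)
      then have "question_mark r \<le> question_mark (x + h)" "question_mark (x - h) \<le> question_mark l" if "hi n \<le> h" for h
        using that lr(4) lxr by (intro mono_question_mark; linarith)+
      then show ?case using lr(1) by fastforce
    qed
  qed
qed

theorem theorem2p1:
  fixes \<alpha> \<sigma> :: real
  assumes "0 < \<alpha>" and "0 < \<sigma>"
    and "(\<lambda>N. log_stern_mean N - \<alpha> * real N) \<in> O(\<lambda>_. 1)"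
    and "(\<lambda>N. log_stern_var N - \<sigma>\<^sup>2 * real N) \<in> O(\<lambda>_. 1)"
  shows
    "(summable (\<lambda>k. minkowski_moment (k + 1) / (real (k + 1) * 2 ^ (k + 1))) \<and>
      \<alpha> = ln 2 - (\<Sum>k. minkowski_moment (k + 1) / (real (k + 1) * 2 ^ (k + 1)))) \<and>
     (\<alpha> = (LINT x:{0..1}|minkowski_measure. ln (1 + x)) \<and>
      ae_Lipschitz_exponent minkowski_measure question_mark (ln 2 / (2 * \<alpha>))) \<and>
     2 * \<alpha> = (LINT x:{0..1}|minkowski_measure. ln \<bar>deriv farey x\<bar>) \<and>
     (is_max_Lyapunov_exponent eta \<alpha> \<and> is_stationary eta xi) \<and>
     \<sigma>\<^sup>2 = 1 / 2 * (LINT x:{0..1}|minkowski_measure.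
        (ln x + \<alpha> * of_int \<lfloor>1 / x\<rfloor> +
          (LINT y:{0..1}|minkowski_measure. ln ((1 + y * frac (1 / x)) / (1 + y * x))))\<^sup>2)"
proof -
  have \<alpha>: "\<alpha> = farey_drift" by (rule mean_constant_eq_farey_drift) (rule assms(3))
  have \<sigma>: "\<sigma>\<^sup>2 = increment_variance" by (rule variance_constant_eq_increment_variance) (rule assms(4))
  have drift: "farey_drift > 0" using assms(1) \<alpha> by simp
  have "(LINT x:{0..1}|minkowski_measure. ln (1 + x)) = farey_drift"
    unfolding farey_drift_eq by (rule set_integral_minkowski) measurable
  then show ?thesis
    unfolding \<sigma> \<alpha>
    using minkowski_moment_series run_increment_formula integral_ln_deriv_farey is_max_Lyapunov_exponent_eta
      is_stationary_eta_xi ae_Lipschitz_exponent_question_mark[OF drift]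
    by (auto simp: sums_iff)
qed

end
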